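(* There exists a universal constant $\gamma>0$ such that the following holds. Let $f\in L^2_{rad}(\mathbb{R}^2)$, $f\neq 0$, and let $u(x,t)$, $(x,t)\in\mathbb{R}^2\times\mathbb{R}$, be the solution of the Schrödinger equation $\partial_t u = i\Delta u$ with initial data $u(x,0)=f(x)$. Then $$\|u\|_{L^4(\mathbb{R}^2\times\mathbb{R})}\leq \frac{1}{\sqrt{2}}\, \|f\|_{L^2(\mathbb{R}^2)}\left[1-\gamma\, \frac{\mathrm{Dist}^2_{L^2(\mathbb{R}^4)}\left(f\otimes f,\,L^2_{rad}(\mathbb{R}^4)\right)}{\|f\|^4_{L^2(\mathbb{R}^2)}}\right]^{1/4},$$ where $f\otimes f(x,y)=f(x)f(y)$ for $(x,y)\in\mathbb{R}^2\times\mathbb{R}^2=\mathbb{R}^4$.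
   Context: Functions are complex-valued. A function on $\mathbb{R}^d$ is radial if it depends only on the Euclidean norm of its argument; $L^2_{rad}(\mathbb{R}^d)$ is the space of radial functions in $L^2(\mathbb{R}^d)$. For $g\in L^2(\mathbb{R}^d)$ and a family $\mathcal{F}\subset L^2(\mathbb{R}^d)$, $\mathrm{Dist}_{L^2(\mathbb{R}^d)}(g,\mathcal{F})=\inf\{\|g-h\|_{L^2(\mathbb{R}^d)}: h\in\mathcal{F}\}$. The solution of the Schrödinger equation with initial data $f\in L^2$ is $u(\cdot,t)=e^{it\Delta}f$. *)

theory Defs
  imports "HOL-Analysis.Analysis"
begin

text \<open>
  Elements of Lebesgue spaces are represented by Borel functions; every class of Lebesgue
  measurable functions modulo null sets has such a representative. The predicates below are
  insensitive to the choice of the representative.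
\<close>

definition Lp :: "nat \<Rightarrow> ('a::euclidean_space \<Rightarrow> complex) set" where
  "Lp p = {f \<in> borel_measurable lborel. integrable lborel (\<lambda>x. norm (f x) ^ p)}"

text \<open>
  The Bochner integral of a non-integrable function is 0, so the value is meaningful only
  on \<^term>\<open>Lp p\<close>.
\<close>

definition Lp_norm :: "nat \<Rightarrow> ('a::euclidean_space \<Rightarrow> complex) \<Rightarrow> real" where
  "Lp_norm p f = root p (LINT x|lborel. norm (f x) ^ p)"

definition radial :: "('a::real_normed_vector \<Rightarrow> 'b) \<Rightarrow> bool" where
  "radial f \<longleftrightarrow> (\<forall>x y. norm x = norm y \<longrightarrow> f x = f y)"

definition L2_rad :: "('a::euclidean_space \<Rightarrow> complex) set" where
  "L2_rad = {f \<in> Lp 2. \<exists>h. radial h \<and> (AE x in lborel. f x = h x)}"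

definition L2_Dist :: "('a::euclidean_space \<Rightarrow> complex) \<Rightarrow> ('a \<Rightarrow> complex) set \<Rightarrow> real" where
  "L2_Dist g F = (INF h\<in>F. Lp_norm 2 (\<lambda>x. g x - h x))"

definition tensor :: "('a \<Rightarrow> complex) \<Rightarrow> ('b \<Rightarrow> complex) \<Rightarrow> 'a \<times> 'b \<Rightarrow> complex" where
  "tensor f g = (\<lambda>(x, y). f x * g y)"

definition fourier :: "('a::euclidean_space \<Rightarrow> complex) \<Rightarrow> 'a \<Rightarrow> complex" where
  "fourier f \<xi> = (LINT x|lborel. exp (- \<i> * complex_of_real (x \<bullet> \<xi>)) * f x)"

text \<open>
  The Fourier-Plancherel transform: \<open>g\<close> is the limit in \<open>L\<^sup>2\<close> of the Fourier integrals of the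
  truncations of \<open>f\<close> to balls, which are in \<open>L\<^sup>1 \<inter> L\<^sup>2\<close>. The limit is taken in \<^typ>\<open>ennreal\<close>, so
  that a non-integrable difference is not mistaken for zero.
\<close>

definition is_L2_fourier ::
  "('a::euclidean_space \<Rightarrow> complex) \<Rightarrow> ('a \<Rightarrow> complex) \<Rightarrow> bool" where
  "is_L2_fourier f g \<longleftrightarrow> f \<in> Lp 2 \<and> g \<in> Lp 2 \<and>
     (\<lambda>n. \<integral>\<^sup>+ \<xi>. ennreal ((norm (fourier (\<lambda>x. indicator (cball 0 (real n)) x * f x) \<xi> - g \<xi>))\<^sup>2)
          \<partial>lborel) \<longlonglongrightarrow> 0"

text \<open>
  \<open>v = e\<^bsup>it\<Delta>\<^esup> f\<close> almost everywhere: since the Laplacian has symbol \<open>-|\<xi>|\<^sup>2\<close>, the transform of \<open>v\<close> is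
  \<open>e\<^bsup>-it|\<xi>|\<^sup>2\<^esup>\<close> times that of \<open>f\<close>. This does not depend on the normalization of the transform.
\<close>

definition is_schroedinger_propagation ::
  "real \<Rightarrow> ('a::euclidean_space \<Rightarrow> complex) \<Rightarrow> ('a \<Rightarrow> complex) \<Rightarrow> bool" where
  "is_schroedinger_propagation t f v \<longleftrightarrow>
     (\<exists>g. is_L2_fourier f g \<and>
          is_L2_fourier v (\<lambda>\<xi>. exp (- \<i> * complex_of_real (t * (norm \<xi>)\<^sup>2)) * g \<xi>))"

text \<open>
  The solution is determined up to null sets; joint measurability makes its space-time norm
  meaningful.
\<close>

definition is_schroedinger_solution ::
  "('a::euclidean_space \<Rightarrow> complex) \<Rightarrow> ('a \<times> real \<Rightarrow> complex) \<Rightarrow> bool" where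
  "is_schroedinger_solution f u \<longleftrightarrow>
     u \<in> borel_measurable lborel \<and>
     (\<forall>t. is_schroedinger_propagation t f (\<lambda>x. u (x, t)))"

end

theory Submission
  imports Defs "HOL-Probability.Probability"
begin

text \<open>
  Let \<open>G\<close> be the Fourier transform of \<open>f\<close>; like \<open>f\<close> it is radial, \<open>G k = \<phi> (|k|\<^sup>2)\<close>. The square of the
  solution is, up to a constant, the space-time Fourier transform of the push-forward \<open>H\<close> of
  \<open>G \<otimes> G\<close> under \<open>(k, l) \<mapsto> (k + l, |k|\<^sup>2 + |l|\<^sup>2)\<close>, so Plancherel bounds the fourth power of its \<open>L\<^sup>4\<close>
  norm by the \<open>L\<^sup>2\<close> norm of \<open>H\<close>. At \<open>(a, T)\<close>, with \<open>A = |a|\<^sup>2\<close>, the function \<open>H\<close> is the integral of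
  \<open>\<phi> p * \<phi> (T - p)\<close> over the fibre, where \<open>p = |k|\<^sup>2\<close> is distributed with a density \<open>\<kappa> A T p\<close> of mass at
  most \<open>\<pi> / 2\<close>. The deficit in Cauchy-Schwarz on a fibre is a variance, and since the integral over \<open>A\<close>
  of \<open>\<kappa> A T p * \<kappa> A T q\<close> is at least \<open>2 / T\<close>, the total deficit controls the variance of
  \<open>p \<mapsto> \<phi> p * \<phi> (T - p)\<close> on the whole interval \<open>0 < p < T\<close>. Hence it controls the distance from \<open>G \<otimes> G\<close> to
  the radial function \<open>\<phi> (s T) * \<phi> ((1 - s) T)\<close>, \<open>T = |k|\<^sup>2 + |l|\<^sup>2\<close>, for some \<open>s\<close>, and the inverse
  Fourier transform carries this over to \<open>f \<otimes> f\<close>.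

  Only the inequality in Plancherel's theorem is needed. It follows by inserting a Gaussian, whose
  transform is a positive kernel of known mass. In the same way, averaging \<open>u (\<cdot>, t)\<close> against the
  heat kernel gives an absolutely convergent Fourier integral of a Gaussian times the transform.
\<close>

text \<open>What radiality buys is that \<open>fiber \<phi> T p\<close> depends on the fibre only
  through \<open>T\<close>. Unless \<open>A = T\<close>, a single fibre sees only part of the
  interval \<open>0 < p < T\<close>, so its own variance says nothing about the rest. But all fibres
  of the same energy carry the same function, and their variances can be added over \<open>a\<close>
  before any estimate is made.

  The bound \<open>2 / T\<close> has the right form because \<open>dq / T\<close> is the uniform law
  on \<open>(0, T)\<close>: with \<open>q = s * T\<close> it becomes an average over
  \<open>0 < s < 1\<close>, and some \<open>s\<close> does at least as well as the average. Sampling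
  at \<open>s\<close> rather than subtracting the mean over the interval costs a factor 2 in the
  constant, but yields a profile without integrating \<phi>.

  Plancherel's inequality is applied with its sharp constant each time, so nothing is lost in the
  main term: \<open>(1 / (2 * pi)) ^ 5 * (pi / 2) * (2 * pi) ^ 4 = 1 / 4\<close>. The same
  bookkeeping on the deficit gives \<open>2 / pi^2\<close> for the constant of the theorem.

  Regularization is unavoidable because the transform \<phi> of a square integrable function need
  not be integrable, and a Bochner integral that fails to converge is 0.\<close>

type_synonym plane = "real ^ 2"

abbreviation lebesgue_nn_integral :: "('a::euclidean_space \<Rightarrow> ennreal) \<Rightarrow> ennreal"  (binder "NNINT " 10) where
  "lebesgue_nn_integral f \<equiv> integral\<^sup>N lborel f"

abbreviation nsq :: "'a::real_normed_vector \<Rightarrow> ennreal" where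
  "nsq z \<equiv> ennreal ((norm z)\<^sup>2)"

abbreviation expi :: "real \<Rightarrow> complex" where
  "expi x \<equiv> exp (- \<i> * complex_of_real x)"

abbreviation gauss :: "real \<Rightarrow> 'a::real_normed_vector \<Rightarrow> complex" where
  "gauss e x \<equiv> complex_of_real (exp (- e * (norm x)\<^sup>2))"

subsection \<open>Gaussians and the Plancherel inequality\<close>

text \<open>Rescaling by \<open>c\<close> with \<open>c^2 = 2 * e\<close> turns the integrand into a
  constant times that of the characteristic function of the standard normal distribution.\<close>

lemma gaussian_fourier_real:
  fixes e w :: real assumes "e > 0"
  shows "integrable lborel (\<lambda>x. expi (x * w) * complex_of_real (exp (- e * x\<^sup>2)))"
    and "(LINT x|lborel. expi (x * w) * complex_of_real (exp (- e * x\<^sup>2)))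
       = complex_of_real (sqrt (pi / e) * exp (- w\<^sup>2 / (4 * e)))"
proof -
  let ?g = "\<lambda>x. expi (x * w) * complex_of_real (exp (- e * x\<^sup>2))"
  define c where "c = sqrt (2 * e)"
  have c: "c > 0" "c\<^sup>2 = 2 * e" using assms by (auto simp: c_def)
  define t where "t = - w / c"
  define f where "f = (\<lambda>x::real. std_normal_density x *\<^sub>R iexp (t * x))"
  have "integrable lborel (\<lambda>x. std_normal_density x *\<^sub>R iexp (t * x))"
    by (rule Bochner_Integration.integrable_bound[where f=std_normal_density]) auto
  then have int_f: "integrable lborel f" by (simp add: f_def)
  have "(LINT x|lborel. f x) = char std_normal_distribution t"
    unfolding f_def char_def by (subst integral_density) auto
  also have "\<dots> = of_real (exp (- (t\<^sup>2) / 2))" by (simp add: char_std_normal_distribution)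
  finally have f_val: "(LINT x|lborel. f x) = of_real (exp (- (t\<^sup>2) / 2))" .
  have fc: "f (0 + c * x) = of_real (1 / sqrt (2 * pi)) * (?g x)" for x
  proof -
    have "(c * x)\<^sup>2 / 2 = e * x\<^sup>2" using c by (simp add: power_mult_distrib)
    moreover have "t * (c * x) = - x * w" using c by (simp add: t_def field_simps)
    ultimately show ?thesis
      unfolding f_def std_normal_density_def scaleR_conv_of_real
      by (simp flip: of_real_mult)
  qed
  have "integrable lborel (\<lambda>x. f (0 + c * x))"
    using lborel_integrable_real_affine[OF int_f, of c 0] c by simp
  then have i: "integrable lborel (\<lambda>x. of_real (1 / sqrt (2 * pi)) * (?g x))"
    by (simp only: fc)
  then show "integrable lborel (\<lambda>x. ?g x)"
    using integrable_mult_right[of "complex_of_real (sqrt (2 * pi))", OF i]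
    by (simp add: real_sqrt_mult)
  have "(LINT x|lborel. f x) = c *\<^sub>R (LINT x|lborel. f (0 + c * x))"
    using lborel_integral_real_affine[of c f 0] c by simp
  also have "\<dots> = of_real (c / sqrt (2 * pi)) * (LINT x|lborel. ?g x)"
    by (simp only: fc integral_mult_right_zero) (simp add: scaleR_conv_of_real)
  finally have eq: "of_real (exp (- (t\<^sup>2) / 2)) = of_real (c / sqrt (2 * pi)) * (LINT x|lborel. ?g x)"
    by (simp only: f_val)
  have cc: "sqrt (pi / e) * (c / sqrt (2 * pi)) = 1"
    using assms by (simp add: c_def real_sqrt_divide real_sqrt_mult)
  have tt: "- (t\<^sup>2) / 2 = - w\<^sup>2 / (4 * e)" by (simp add: t_def power_divide c(2))
  have "complex_of_real (sqrt (pi / e) * exp (- w\<^sup>2 / (4 * e))) = of_real (sqrt (pi / e)) * of_real (exp (- (t\<^sup>2) / 2))"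
    by (simp only: tt of_real_mult)
  also have "\<dots> = of_real (sqrt (pi / e) * (c / sqrt (2 * pi))) * (LINT x|lborel. ?g x)"
    unfolding eq by (simp only: of_real_mult mult.assoc)
  finally show "(LINT x|lborel. ?g x)
       = complex_of_real (sqrt (pi / e) * exp (- w\<^sup>2 / (4 * e)))"
    unfolding cc by simp
qed

text \<open>The integrand is a product over the coordinates and \<open>lborel\<close> is the image
  of the product measure, so the one-dimensional formula applies to each factor.\<close>

lemma gaussian_fourier:
  fixes w :: "'a::euclidean_space" assumes "e > 0"
  shows integrable_gaussian_fourier: "integrable lborel (\<lambda>x::'a. expi (x \<bullet> w) * gauss e x)"
    and fourier_gaussian: "fourier (\<lambda>x. gauss e x) w
       = complex_of_real (sqrt (pi / e) ^ DIM('a) * exp (- (norm w)\<^sup>2 / (4 * e)))"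
proof -
  interpret P: product_sigma_finite "\<lambda>b::'a. lborel :: real measure" by standard
  define g where "g b x = expi (x * (w \<bullet> b)) * complex_of_real (exp (- e * x\<^sup>2))" for b :: 'a and x :: real
  define F where "F = (\<lambda>x::'a. expi (x \<bullet> w) * gauss e x)"
  have [measurable]: "F \<in> borel_measurable borel" by (simp add: F_def)
  have gi: "integrable lborel (g b)" for b
    unfolding g_def by (rule gaussian_fourier_real[OF assms])
  have prod: "F (\<Sum>b\<in>Basis. f b *\<^sub>R b) = (\<Prod>b\<in>Basis. g b (f b))" for f
  proof -
    let ?x = "\<Sum>b\<in>Basis. f b *\<^sub>R b"
    have xb: "?x \<bullet> b = f b" if "b \<in> Basis" for b
      using that by (simp add: inner_sum_left inner_Basis if_distrib cong: if_cong)
    have 1: "?x \<bullet> w = (\<Sum>b\<in>Basis. f b * (w \<bullet> b))"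
      by (simp add: inner_sum_left inner_commute[of w])
    have 2: "(norm ?x)\<^sup>2 = (\<Sum>b\<in>Basis. (f b)\<^sup>2)"
      by (subst norm_eq_sqrt_inner, subst euclidean_inner) (simp add: xb power2_eq_square sum_nonneg)
    show ?thesis
      unfolding F_def 1 2 g_def
      by (simp add: prod.distrib exp_sum sum_distrib_left sum_negf flip: sum_negf)
  qed
  have iP: "integrable (\<Pi>\<^sub>M b\<in>Basis. lborel) (\<lambda>f. \<Prod>b\<in>Basis. g b (f b))"
    by (rule P.product_integrable_prod) (auto simp: gi)
  have "integrable lborel F"
    unfolding lborel_eq[where 'a='a] by (subst integrable_distr_eq) (auto simp: prod iP)
  then show "integrable lborel (\<lambda>x::'a. expi (x \<bullet> w) * gauss e x)"
    by (simp add: F_def)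
  have "(LINT x|lborel. F x) = (LINT f|(\<Pi>\<^sub>M b\<in>Basis. lborel). (\<Prod>b\<in>Basis. g b (f b)))"
    unfolding lborel_eq[where 'a='a] by (subst integral_distr) (auto simp: prod)
  also have "\<dots> = (\<Prod>b\<in>Basis. (LINT x|lborel. g b x))"
    by (rule P.product_integral_prod) (auto simp: gi)
  also have "\<dots> = (\<Prod>b\<in>Basis. complex_of_real (sqrt (pi / e) * exp (- (w \<bullet> b)\<^sup>2 / (4 * e))))"
    unfolding g_def by (simp only: gaussian_fourier_real[OF assms])
  also have "\<dots> = complex_of_real (sqrt (pi / e) ^ DIM('a) * exp (- (norm w)\<^sup>2 / (4 * e)))"
  proof -
    have "(norm w)\<^sup>2 = (\<Sum>b\<in>Basis. (w \<bullet> b)\<^sup>2)"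
      by (subst norm_eq_sqrt_inner, subst euclidean_inner) (simp add: power2_eq_square sum_nonneg)
    then have "exp (- (norm w)\<^sup>2 / (4 * e)) = (\<Prod>b\<in>Basis. exp (- (w \<bullet> b)\<^sup>2 / (4 * e)))"
      by (simp add: exp_sum sum_negf sum_divide_distrib flip: sum_negf)
    then show ?thesis by (simp add: prod.distrib)
  qed
  finally show "fourier (\<lambda>x. gauss e x) w
       = complex_of_real (sqrt (pi / e) ^ DIM('a) * exp (- (norm w)\<^sup>2 / (4 * e)))"
    by (simp add: fourier_def F_def)
qed

lemma integrable_gaussian:
  assumes "e > 0" shows "integrable lborel (\<lambda>x::'a::euclidean_space. exp (- e * (norm x)\<^sup>2))"
  using integrable_norm[OF integrable_gaussian_fourier[OF assms, of "0::'a"]] by simp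

lemma nn_integral_gaussian:
  assumes "e > 0"
  shows "(NNINT x::'a::euclidean_space. ennreal (exp (- e * (norm x)\<^sup>2))) = ennreal (sqrt (pi / e) ^ DIM('a))"
proof -
  have "complex_of_real (LINT x::'a|lborel. exp (- e * (norm x)\<^sup>2)) = fourier (\<lambda>x. gauss e x) (0::'a)"
    by (simp add: fourier_def)
  also have "\<dots> = complex_of_real (sqrt (pi / e) ^ DIM('a))"
    by (subst fourier_gaussian[OF assms]) simp
  finally have "(LINT x::'a|lborel. exp (- e * (norm x)\<^sup>2)) = sqrt (pi / e) ^ DIM('a)"
    by (simp only: of_real_eq_iff)
  then show ?thesis
    using integrable_gaussian[OF assms, where 'a='a] by (subst nn_integral_eq_integral) auto
qed

lemma fourier_measurable [measurable]:
  fixes h :: "'a::euclidean_space \<Rightarrow> complex"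
  assumes [measurable]: "h \<in> borel_measurable borel"
  shows "fourier h \<in> borel_measurable borel"
  unfolding fourier_def by measurable

lemma norm_exp_ii [simp]: "norm (exp (- (\<i> * complex_of_real x))) = 1"
  using norm_exp_i_times[of "-x"] by simp

text \<open>A Bochner integral that does not exist is 0, which keeps the bound true in that case as
  well.\<close>

lemma ennreal_norm_integral_le:
  fixes f :: "'a \<Rightarrow> 'b::{banach, second_countable_topology}"
  shows "ennreal (norm (integral\<^sup>L M f)) \<le> (\<integral>\<^sup>+ x. ennreal (norm (f x)) \<partial>M)"
  by (cases "integrable M f") (auto simp: not_integrable_integral_eq intro: integral_norm_bound_ennreal)

lemma integrable_exp_mult:
  fixes h :: "'a::euclidean_space \<Rightarrow> complex"
  assumes "integrable lborel h" and [measurable]: "g \<in> borel_measurable borel"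
  shows "integrable lborel (\<lambda>x. expi (g x) * h x)"
proof -
  have [measurable]: "h \<in> borel_measurable borel" using assms by auto
  show ?thesis
    by (rule Bochner_Integration.integrable_bound[OF assms(1)]) (auto simp: norm_mult)
qed

lemma norm_fourier_le:
  fixes h :: "'a::euclidean_space \<Rightarrow> complex"
  shows "norm (fourier h w) \<le> (LINT x|lborel. norm (h x))"
  unfolding fourier_def
  using integral_norm_bound[of lborel "\<lambda>x. expi (x \<bullet> w) * h x"] by (simp add: norm_mult)

lemma nn_integral_lborel_diff:
  fixes f :: "'a::euclidean_space \<Rightarrow> ennreal"
  assumes [measurable]: "f \<in> borel_measurable borel"
  shows "(NNINT y. f (x - y)) = (NNINT y. f y)"
proof -
  have "lborel = distr lborel borel (\<lambda>y. x - y)"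
    using lborel_affine[of "-1" x] by (simp add: density_1)
  then have "(NNINT y. f y) = (\<integral>\<^sup>+ y. f y \<partial>distr lborel borel (\<lambda>y. x - y))" by simp
  also have "\<dots> = (NNINT y. f (x - y))"
    by (subst nn_integral_distr) auto
  finally show ?thesis by simp
qed

lemma nn_integral_lborel_plus:
  fixes f :: "'a::euclidean_space \<Rightarrow> ennreal"
  assumes [measurable]: "f \<in> borel_measurable borel"
  shows "(NNINT y. f (x + y)) = (NNINT y. f y)"
proof -
  have "lborel = distr lborel borel (\<lambda>y. x + y)"
    using lborel_distr_plus[of x] by simp
  then have "(NNINT y. f y) = (\<integral>\<^sup>+ y. f y \<partial>distr lborel borel (\<lambda>y. x + y))" by simp
  also have "\<dots> = (NNINT y. f (x + y))"
    by (subst nn_integral_distr) auto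
  finally show ?thesis by simp
qed

lemma fst_snd_borel_measurable [measurable]:
  "fst \<in> (borel :: ('a::second_countable_topology \<times> 'b::second_countable_topology) measure) \<rightarrow>\<^sub>M borel"
  "snd \<in> (borel :: ('a::second_countable_topology \<times> 'b::second_countable_topology) measure) \<rightarrow>\<^sub>M borel"
  by (simp_all add: borel_prod[symmetric])

lemma borel_measurable_cnj [measurable]:
  "f \<in> borel_measurable M \<Longrightarrow> (\<lambda>x. cnj (f x)) \<in> borel_measurable M"
  by (rule borel_measurable_continuous_on[OF continuous_on_cnj]) (auto intro: continuous_intros)

text \<open>Writing the square as a double integral of \<open>h x * cnj (h y)\<close> and
  integrating over \<open>w\<close> first leaves the kernel \<open>k (x - y)\<close>, the transform
  of the Gaussian weight. Since \<open>k\<close> is positive with mass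
  \<open>(2 * pi) ^ DIM('a)\<close> whatever \<open>e\<close> is, bounding the product by half the
  sum of squares (Schur's test) gives a constant independent of \<open>e\<close>.\<close>

lemma fourier_gaussian_weighted_le:
  fixes h :: "'a::euclidean_space \<Rightarrow> complex"
  assumes h: "integrable lborel h" and e: "e > 0"
  shows "(NNINT w. ennreal ((norm (fourier h w))\<^sup>2 * exp (- e * (norm w)\<^sup>2)))
     \<le> ennreal ((2 * pi) ^ DIM('a)) * (NNINT x. nsq (h x))"
proof -
  have [measurable]: "h \<in> borel_measurable borel" using h by auto
  define H where "H = (\<lambda>(x::'a, y::'a). h x * cnj (h y))"
  define g where "g = (\<lambda>w::'a. exp (- e * (norm w)\<^sup>2))"
  define k where "k = (\<lambda>w::'a. sqrt (pi / e) ^ DIM('a) * exp (- (norm w)\<^sup>2 / (4 * e)))"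
  have [measurable]: "H \<in> borel_measurable borel" "g \<in> borel_measurable borel" "k \<in> borel_measurable borel"
    unfolding H_def g_def k_def by (simp_all add: borel_prod[symmetric] split_beta)
  have k0: "k w \<ge> 0" for w using e by (simp add: k_def)
  let ?c = "\<lambda>w z. expi ((fst z - snd z) \<bullet> w) * H z"
  let ?P = "\<lambda>z. ennreal ((norm (h (fst z)))\<^sup>2 / 2) * k (fst z - snd z)"
  let ?S = "\<lambda>z. ennreal ((norm (h (snd z)))\<^sup>2 / 2) * k (fst z - snd z)"
  let ?N = "NNINT x. ennreal ((norm (h x))\<^sup>2 / 2)"
  let ?g = "\<lambda>w. (norm (fourier h w))\<^sup>2 * g w"
  have ik: "(NNINT w. ennreal (k w)) = ennreal ((2 * pi) ^ DIM('a))"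
  proof -
    have "(NNINT w. ennreal (k w)) = ennreal (sqrt (pi / e) ^ DIM('a)) * (NNINT w::'a. ennreal (exp (- (1/(4*e)) * (norm w)\<^sup>2)))"
      using e by (subst nn_integral_cmult[symmetric]) (auto simp: k_def ennreal_mult intro!: nn_integral_cong)
    also have "\<dots> = ennreal ((sqrt (pi / e) * sqrt (pi / (1/(4*e)))) ^ DIM('a))"
      using e by (subst nn_integral_gaussian) (auto simp: ennreal_mult'' power_mult_distrib)
    also have "sqrt (pi / e) * sqrt (pi / (1/(4*e))) = 2 * pi"
      using e by (simp add: real_sqrt_mult[symmetric] real_sqrt_mult real_sqrt_divide)
    finally show ?thesis .
  qed
  have iH: "integrable lborel H"
  proof -
    have "integrable (lborel \<Otimes>\<^sub>M lborel) (\<lambda>(x::'a, y::'a). h x * cnj (h y))"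
    proof (rule lborel_pair.Fubini_integrable)
      show "(\<lambda>(x, y). h x * cnj (h y)) \<in> borel_measurable (lborel \<Otimes>\<^sub>M lborel)" by measurable
      show "integrable lborel (\<lambda>x. LINT y|lborel. norm (case (x, y) of (x, y) \<Rightarrow> h x * cnj (h y)))"
        using h by (simp add: norm_mult)
      show "AE x in lborel. integrable lborel (\<lambda>y. case (x, y) of (x, y) \<Rightarrow> h x * cnj (h y))"
        using h by (auto intro!: integrable_mult_right integrable_cnj)
    qed
    then show ?thesis by (simp add: H_def lborel_prod)
  qed
  have sq: "of_real ((norm (fourier h w))\<^sup>2) = (LINT z|lborel. ?c w z)" for w
  proof -
    have i: "integrable lborel (\<lambda>z. ?c w z)"
      by (rule integrable_exp_mult[OF iH]) simp
    have "(LINT z|lborel. ?c w z)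
      = (LINT x|lborel. LINT y|lborel. expi ((x - y) \<bullet> w) * (h x * cnj (h y)))"
      using lborel_pair.integral_fst'[of "\<lambda>z. ?c w z"] i
      by (simp add: lborel_prod H_def)
    also have "\<dots> = (LINT x|lborel. LINT y|lborel. (expi (x \<bullet> w) * h x) * cnj (expi (y \<bullet> w) * h y))"
      by (intro Bochner_Integration.integral_cong refl)
         (simp add: exp_cnj inner_diff_left algebra_simps exp_diff exp_minus divide_inverse)
    also have "\<dots> = fourier h w * cnj (fourier h w)"
      by (simp only: fourier_def integral_mult_right_zero integral_mult_left_zero Bochner_Integration.integral_cnj)
    finally show ?thesis by (simp only: complex_norm_square)
  qed
  have bdd: "integrable lborel (\<lambda>w. ?g w)"
  proof (rule Bochner_Integration.integrable_bound)
    show "integrable lborel (\<lambda>w. (LINT x|lborel. norm (h x))\<^sup>2 * g w)"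
      unfolding g_def by (intro integrable_mult_right integrable_gaussian e)
    show "AE w in lborel. norm (?g w) \<le> norm ((LINT x|lborel. norm (h x))\<^sup>2 * g w)"
      by (auto simp: g_def abs_mult intro!: mult_right_mono power_mono norm_fourier_le)
  qed measurable
  \<comment> \<open>The Gaussian weight is what makes the triple integral absolutely convergent:
    without it nothing decays in \<open>w\<close>.\<close>
  have big: "integrable (lborel \<Otimes>\<^sub>M lborel) (\<lambda>(w, z). ?c w z * of_real (g w))"
  proof (rule lborel_pair.Fubini_integrable)
    have "(LINT z|lborel. norm (H z) * g w) = (LINT z|lborel. norm (H z)) * g w" for w by simp
    then show "integrable lborel (\<lambda>w. LINT z|lborel. norm (case (w, z) of (w, z) \<Rightarrow> ?c w z * of_real (g w)))"
      using integrable_gaussian[OF e, where 'a='a] by (simp add: norm_mult g_def)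
    show "AE w in lborel. integrable lborel (\<lambda>z. case (w, z) of (w, z) \<Rightarrow> ?c w z * of_real (g w))"
      unfolding prod.case
      by (intro AE_I2 integrable_mult_left impI integrable_exp_mult[OF iH]) measurable
  qed measurable
  have "of_real (LINT w|lborel. ?g w)
      = (LINT w|lborel. LINT z|lborel. ?c w z * of_real (g w))"
    by (simp only: integral_complex_of_real[symmetric] of_real_mult sq integral_mult_left_zero)
  also have "\<dots> = (LINT z|lborel. LINT w|lborel. ?c w z * of_real (g w))"
    using lborel_pair.Fubini_integral[OF big] by simp
  also have "\<dots> = (LINT z|lborel. H z * of_real (k (fst z - snd z)))"
  proof (rule Bochner_Integration.integral_cong[OF refl])
    fix z :: "'a \<times> 'a"
    have "(LINT w|lborel. ?c w z * of_real (g w))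
      = (LINT w|lborel. H z * (expi (w \<bullet> (fst z - snd z)) * of_real (g w)))"
      by (simp only: inner_commute mult_ac)
    also have "\<dots> = H z * fourier (\<lambda>x. complex_of_real (g x)) (fst z - snd z)"
      by (simp add: fourier_def)
    also have "fourier (\<lambda>x. complex_of_real (g x)) (fst z - snd z) = of_real (k (fst z - snd z))"
      unfolding g_def k_def by (rule fourier_gaussian[OF e])
    finally show "(LINT w|lborel. ?c w z * of_real (g w)) = H z * of_real (k (fst z - snd z))" .
  qed
  finally have eq: "of_real (LINT w|lborel. ?g w) = (LINT z|lborel. H z * of_real (k (fst z - snd z)))" .
  have g0: "g w \<ge> 0" for w by (simp add: g_def)
  have "(NNINT w. ennreal (?g w)) = ennreal (LINT w|lborel. ?g w)"
    by (rule nn_integral_eq_integral[OF bdd]) (simp add: g0)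
  also have "(LINT w|lborel. ?g w) \<le> norm (complex_of_real (LINT w|lborel. ?g w))" by simp
  then have "ennreal (LINT w|lborel. ?g w) \<le> ennreal (norm (LINT z|lborel. H z * of_real (k (fst z - snd z))))"
    unfolding eq by (rule ennreal_leI)
  also have "\<dots> \<le> (NNINT z. ennreal (norm (H z * of_real (k (fst z - snd z)))))"
    by (rule ennreal_norm_integral_le)
  also have "\<dots> \<le> (NNINT z. ennreal ((norm (h (fst z)))\<^sup>2 / 2 * k (fst z - snd z) + (norm (h (snd z)))\<^sup>2 / 2 * k (fst z - snd z)))"
  proof (intro nn_integral_mono ennreal_leI)
    fix z :: "'a \<times> 'a"
    have "norm (H z) \<le> (norm (h (fst z)))\<^sup>2 / 2 + (norm (h (snd z)))\<^sup>2 / 2"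
      using sum_squares_bound[of "norm (h (fst z))" "norm (h (snd z))"]
      by (simp add: H_def split_beta norm_mult)
    then have "norm (H z) * k (fst z - snd z) \<le> ((norm (h (fst z)))\<^sup>2 / 2 + (norm (h (snd z)))\<^sup>2 / 2) * k (fst z - snd z)"
      by (intro mult_right_mono k0)
    then show "norm (H z * of_real (k (fst z - snd z))) \<le> (norm (h (fst z)))\<^sup>2 / 2 * k (fst z - snd z) + (norm (h (snd z)))\<^sup>2 / 2 * k (fst z - snd z)"
      by (simp add: norm_mult k0 algebra_simps)
  qed
  also have "\<dots> = (NNINT z. ?P z + ?S z)"
    by (intro nn_integral_cong) (simp add: k0 flip: ennreal_mult)
  also have "\<dots> = (NNINT z. ?P z) + (NNINT z. ?S z)"
    by (rule nn_integral_add) measurable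
  also have "(NNINT z. ?P z) = ?N * ennreal ((2 * pi) ^ DIM('a))"
  proof -
    have "(NNINT z. ?P z)
       = (NNINT x. NNINT y. ennreal ((norm (h x))\<^sup>2 / 2) * k (x - y))"
      by (subst lborel_prod[symmetric], subst lborel.nn_integral_fst[symmetric]) simp_all
    also have "\<dots> = (NNINT x. ennreal ((norm (h x))\<^sup>2 / 2) * ennreal ((2 * pi) ^ DIM('a)))"
      by (simp add: nn_integral_cmult nn_integral_lborel_diff[of "\<lambda>y. ennreal (k y)"] ik)
    finally show ?thesis by (simp add: nn_integral_multc)
  qed
  also have "(NNINT z. ?S z) = ?N * ennreal ((2 * pi) ^ DIM('a))"
  proof -
    have kc: "k (x - y) = k (y - x)" for x y by (simp add: k_def norm_minus_commute)
    have "(NNINT z. ?S z)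
       = (NNINT y. NNINT x. ennreal ((norm (h y))\<^sup>2 / 2) * k (y - x))"
      by (subst lborel_prod[symmetric], subst lborel_pair.nn_integral_snd[symmetric]) (simp_all add: kc)
    also have "\<dots> = (NNINT x. ennreal ((norm (h x))\<^sup>2 / 2) * ennreal ((2 * pi) ^ DIM('a)))"
      by (simp add: nn_integral_cmult nn_integral_lborel_diff[of "\<lambda>y. ennreal (k y)"] ik)
    finally show ?thesis by (simp add: nn_integral_multc)
  qed
  also have "?N * ennreal ((2 * pi) ^ DIM('a)) + ?N * ennreal ((2 * pi) ^ DIM('a))
     = ennreal ((2 * pi) ^ DIM('a)) * (NNINT x. ennreal ((norm (h x))\<^sup>2 / 2) + ennreal ((norm (h x))\<^sup>2 / 2))"
    by (subst nn_integral_add) (auto simp: algebra_simps)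
  also have "(NNINT x. ennreal ((norm (h x))\<^sup>2 / 2) + ennreal ((norm (h x))\<^sup>2 / 2)) = (NNINT x. nsq (h x))"
    by (simp flip: ennreal_plus)
  finally show ?thesis by (simp add: g_def)
qed

text \<open>The weighted bound is uniform in \<open>e\<close>, so Fatou's lemma along
  \<open>e = 1 / (n + 1)\<close> removes the weight.\<close>

lemma plancherel_le:
  fixes h :: "'a::euclidean_space \<Rightarrow> complex"
  assumes h: "integrable lborel h"
  shows "(NNINT w. nsq (fourier h w))
     \<le> ennreal ((2 * pi) ^ DIM('a)) * (NNINT x. nsq (h x))"
proof -
  have [measurable]: "h \<in> borel_measurable borel" using h by auto
  define a where "a n w = ennreal ((norm (fourier h w))\<^sup>2 * exp (- (1 / real (Suc n)) * (norm w)\<^sup>2))" for n and w :: 'a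
  have "(\<lambda>n. a n w) \<longlonglongrightarrow> nsq (fourier h w)" for w
  proof -
    have "(\<lambda>n. (norm (fourier h w))\<^sup>2 * exp (- (1 / real (Suc n)) * (norm w)\<^sup>2)) \<longlonglongrightarrow> (norm (fourier h w))\<^sup>2 * exp (- 0 * (norm w)\<^sup>2)"
      by (intro tendsto_intros LIMSEQ_Suc[OF lim_1_over_n])
    then show ?thesis unfolding a_def by (intro tendsto_ennrealI) simp
  qed
  then have "nsq (fourier h w) = liminf (\<lambda>n. a n w)" for w
    by (simp add: lim_imp_Liminf[symmetric])
  then have "(NNINT w. nsq (fourier h w)) = (NNINT w. liminf (\<lambda>n. a n w))" by simp
  also have "\<dots> \<le> liminf (\<lambda>n. NNINT w. a n w)"
    by (rule nn_integral_liminf) (simp add: a_def)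
  also have "\<dots> \<le> limsup (\<lambda>n. NNINT w. a n w)" by (rule Liminf_le_Limsup) simp
  also have "\<dots> \<le> ennreal ((2 * pi) ^ DIM('a)) * (NNINT x. nsq (h x))"
    unfolding a_def by (intro Limsup_bounded always_eventually allI fourier_gaussian_weighted_le h) simp
  finally show ?thesis .
qed

subsection \<open>Rotations and the transform of radial functions\<close>

lemma orthogonal_transformation_measurable:
  fixes T :: "'a::euclidean_space \<Rightarrow> 'a"
  shows "orthogonal_transformation T \<Longrightarrow> T \<in> borel_measurable borel"
  by (intro borel_measurable_continuous_onI linear_continuous_on)
    (simp add: orthogonal_transformation_linear flip: linear_conv_bounded_linear)

text \<open>Comparing the two measures of \<open>A\<close> by Fubini against the unit ball \<open>B\<close>, which the map preserves,
  uses translation invariance only; no determinant is needed.\<close>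

lemma lborel_distr_orthogonal:
  fixes T :: "'a::euclidean_space \<Rightarrow> 'a"
  assumes T: "orthogonal_transformation T"
  shows "distr lborel borel T = lborel"
proof (rule measure_eqI)
  show "sets (distr lborel borel T) = sets lborel" by simp
next
  fix A assume "A \<in> sets (distr lborel borel T)"
  then have [measurable]: "A \<in> sets borel" by simp
  define S where "S = inv T"
  have lin: "linear T" using T by (rule orthogonal_transformation_linear)
  have TS: "T (S y) = y" for y
    unfolding S_def using orthogonal_transformation_surj[OF T] by (rule surj_f_inv_f)
  have oS: "orthogonal_transformation S"
    unfolding S_def using T by (rule orthogonal_transformation_inv)
  have [measurable]: "T \<in> borel_measurable borel" "S \<in> borel_measurable borel"
    using T oS by (auto intro: orthogonal_transformation_measurable)
  define B where "B = ball (0::'a) 1"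
  have [measurable]: "B \<in> sets borel" by (simp add: B_def)
  have Bsym: "indicator B (y - T x) = (indicator B (S y - x) :: ennreal)" for x y
  proof -
    have "norm (y - T x) = norm (T (S y - x))"
      by (simp add: linear_diff[OF lin] TS)
    then have "norm (y - T x) = norm (S y - x)"
      by (simp add: orthogonal_transformation_norm[OF T])
    then show ?thesis by (simp add: B_def indicator_def)
  qed
  have eB: "emeasure lborel B \<noteq> 0" "emeasure lborel B \<noteq> \<infinity>"
    using content_ball_pos[of 1 "0::'a"] emeasure_bounded_finite[of B]
    by (auto simp: B_def measure_def) 
  have "emeasure (distr lborel borel T) A * emeasure lborel B
     = (NNINT y. NNINT x. indicator A (T x) * indicator B y)"
  proof -
    have "emeasure (distr lborel borel T) A = (\<integral>\<^sup>+ x. indicator A x \<partial>distr lborel borel T)" by simp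
    also have "\<dots> = (NNINT x. indicator A (T x))" by (rule nn_integral_distr) simp_all
    finally show ?thesis by (simp add: nn_integral_cmult nn_integral_multc)
  qed
  also have "\<dots> = (NNINT y. NNINT x. indicator A (T (S y + x)) * indicator B y)"
    by (intro nn_integral_cong nn_integral_lborel_plus[symmetric]) measurable
  also have "\<dots> = (NNINT y. NNINT x. indicator A (T x + y) * indicator B y)"
    by (simp add: linear_add[OF lin] TS add.commute)
  also have "\<dots> = (NNINT x. NNINT y. indicator A (T x + y) * indicator B y)"
    by (rule lborel_pair.Fubini') measurable
  also have "\<dots> = (NNINT x. NNINT y. indicator A y * indicator B (y - T x))"
  proof (rule nn_integral_cong)
    fix x
    show "(NNINT y. indicator A (T x + y) * indicator B y) = (NNINT y. indicator A y * indicator B (y - T x))"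
      using nn_integral_lborel_plus[of "\<lambda>y. indicator A y * indicator B (y - T x)" "T x"] by simp
  qed
  also have "\<dots> = (NNINT y. NNINT x. indicator A y * indicator B (S y - x))"
    unfolding Bsym by (rule lborel_pair.Fubini') measurable
  also have "\<dots> = (NNINT y. indicator A y * emeasure lborel B)"
    by (simp add: nn_integral_cmult nn_integral_lborel_diff[of "indicator B"])
  also have "\<dots> = emeasure lborel A * emeasure lborel B"
    by (simp add: nn_integral_multc)
  finally show "emeasure (distr lborel borel T) A = emeasure lborel A"
    using eB ennreal_mult_cancel_left[of "emeasure lborel B"] by (auto simp: mult.commute[of _ "emeasure lborel B"])
qed

text \<open>The witness is the reflection in the hyperplane orthogonal to \<open>a - b\<close>;
  equal norms make it send \<open>a\<close> to \<open>b\<close>.\<close>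

lemma ex_orthogonal_transformation_swap:
  fixes a b :: "'a::euclidean_space"
  assumes "norm a = norm b"
  shows "\<exists>T. orthogonal_transformation T \<and> T a = b"
proof (cases "a = b")
  case True
  then show ?thesis by (intro exI[of _ "\<lambda>x. x"]) auto
next
  case False
  define n where "n = a - b"
  define T where "T = (\<lambda>x. x - (2 * (x \<bullet> n) / (n \<bullet> n)) *\<^sub>R n)"
  have n: "n \<bullet> n \<noteq> 0" using False by (simp add: n_def)
  have "a \<bullet> a = b \<bullet> b" using assms by (simp add: norm_eq)
  then have "2 * (a \<bullet> n) = n \<bullet> n" by (simp add: n_def inner_diff inner_commute)
  then have "T a = b" using n by (simp add: T_def) (simp add: n_def)
  moreover have "orthogonal_transformation T"
    unfolding orthogonal_transformation_def
  proof (intro conjI allI)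
    show "linear T"
      unfolding T_def by (intro linearI) (simp_all add: inner_add_left algebra_simps add_divide_distrib)
    show "T v \<bullet> T w = v \<bullet> w" for v w
      using n unfolding T_def by (simp add: inner_diff inner_commute field_simps)
  qed
  ultimately show ?thesis by blast
qed

text \<open>Substituting an orthogonal \<open>T\<close> with \<open>T a = b\<close> turns the
  integral at \<open>b\<close> into the one at \<open>a\<close>. Null sets are invisible to the
  integral and preserved by \<open>T\<close>, so almost everywhere radiality of \<open>h\<close>
  gives radiality of the transform at every point. This pointwise form is needed to restrict
  transforms to a single ray in \<open>L2_fourier_radial\<close>.\<close>

lemma radial_fourier:
  fixes h :: "'a::euclidean_space \<Rightarrow> complex"
  assumes [measurable]: "h \<in> borel_measurable borel"
    and r: "radial k" and ae: "AE x in lborel. h x = k x"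
  shows "radial (fourier h)"
  unfolding radial_def
proof (intro allI impI)
  fix a b :: 'a assume "norm a = norm b"
  then obtain T where T: "orthogonal_transformation T" "T a = b"
    using ex_orthogonal_transformation_swap by blast
  have [measurable]: "T \<in> borel_measurable borel"
    using T(1) by (rule orthogonal_transformation_measurable)
  have "AE x in distr lborel borel T. h x = k x"
    using ae by (simp only: lborel_distr_orthogonal[OF T(1)])
  then have aeT: "AE x in lborel. h (T x) = k (T x)" by (rule AE_distrD[rotated]) simp
  have kT: "k (T x) = k x" for x
    using r orthogonal_transformation_norm[OF T(1), of x] unfolding radial_def by blast
  have "fourier h b = (LINT x|distr lborel borel T. expi (x \<bullet> b) * h x)"
    by (simp add: fourier_def lborel_distr_orthogonal[OF T(1)])
  also have "\<dots> = (LINT x|lborel. expi (T x \<bullet> T a) * h (T x))"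
    by (subst integral_distr) (simp_all add: T(2))
  also have "\<dots> = (LINT x|lborel. expi (x \<bullet> a) * h x)"
    using T(1) ae aeT
    by (intro integral_cong_AE) (auto simp: orthogonal_transformation_def kT elim!: AE_mp)
  finally show "fourier h a = fourier h b" by (simp add: fourier_def)
qed

section \<open>Limits in mean square and the Fourier-Plancherel transform\<close>

lemma L2_AE_subseq:
  fixes v :: "nat \<Rightarrow> 'a \<Rightarrow> complex"
  assumes [measurable]: "\<And>n. v n \<in> borel_measurable M" "w \<in> borel_measurable M"
    and lim: "(\<lambda>n. \<integral>\<^sup>+ x. nsq (v n x - w x) \<partial>M) \<longlonglongrightarrow> 0"
  shows "\<exists>r. strict_mono r \<and> (AE x in M. (\<lambda>n. v (r n) x) \<longlonglongrightarrow> w x)"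
proof -
  define a where "a n = (\<integral>\<^sup>+ x. nsq (v n x - w x) \<partial>M)" for n
  \<comment> \<open>The first integrals may be infinite; dropping them makes all squared differences
    integrable, so that the subsequence theorem for convergence in mean applies to them.\<close>
  have "eventually (\<lambda>n. a n < 1) sequentially"
    using order_tendstoD(2)[OF lim, of 1] by (simp add: a_def)
  then obtain N where N: "\<And>n. n \<ge> N \<Longrightarrow> a n < 1" by (auto simp: eventually_sequentially)
  define u where "u n x = (norm (v (n + N) x - w x))\<^sup>2" for n x
  have i: "integrable M (u n)" for n
    using N[of "n + N"] unfolding u_def a_def
    by (intro integrableI_nonneg) (auto simp: less_top intro: le_less_trans order_less_trans)
  have eq: "ennreal (\<integral>x. norm (u n x) \<partial>M) = a (n + N)" for n
    using nn_integral_eq_integral[OF i[of n]] by (simp add: u_def[abs_def] a_def)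
  have "(\<lambda>n. a (n + N)) \<longlonglongrightarrow> 0"
    using lim unfolding a_def by (rule LIMSEQ_ignore_initial_segment)
  then have "(\<lambda>n. ennreal (\<integral>x. norm (u n x) \<partial>M)) \<longlonglongrightarrow> ennreal 0"
    by (simp only: eq ennreal_0)
  then have "(\<lambda>n. \<integral>x. norm (u n x) \<partial>M) \<longlonglongrightarrow> 0"
    by (subst (asm) tendsto_ennreal_iff) auto
  from tendsto_L1_AE_subseq[OF i this] obtain r where r: "strict_mono r" "AE x in M. (\<lambda>n. u (r n) x) \<longlonglongrightarrow> 0" by auto
  have "strict_mono (\<lambda>n. r n + N)" using r(1) by (simp add: strict_mono_def)
  moreover have "AE x in M. (\<lambda>n. v (r n + N) x) \<longlonglongrightarrow> w x"
    using r(2)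
  proof eventually_elim
    case (elim x)
    have "(\<lambda>n. norm (v (r n + N) x - w x)) \<longlonglongrightarrow> 0"
      using tendsto_real_sqrt[OF elim] by (simp add: u_def)
    then show ?case by (simp add: tendsto_norm_zero_iff flip: LIM_zero_iff[of _ "w x"])
  qed
  ultimately show ?thesis by blast
qed

lemma nn_integral_norm_power_fatou:
  fixes v :: "nat \<Rightarrow> 'a \<Rightarrow> complex"
  assumes [measurable]: "\<And>n. v n \<in> borel_measurable M" 
    and lim: "AE x in M. (\<lambda>n. v n x) \<longlonglongrightarrow> w x"
  shows "(\<integral>\<^sup>+ x. ennreal (norm (w x) ^ k) \<partial>M) \<le> liminf (\<lambda>n. \<integral>\<^sup>+ x. ennreal (norm (v n x) ^ k) \<partial>M)"
proof -
  have "(\<integral>\<^sup>+ x. ennreal (norm (w x) ^ k) \<partial>M) = (\<integral>\<^sup>+ x. liminf (\<lambda>n. ennreal (norm (v n x) ^ k)) \<partial>M)"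
  proof (rule nn_integral_cong_AE)
    show "AE x in M. ennreal (norm (w x) ^ k) = liminf (\<lambda>n. ennreal (norm (v n x) ^ k))"
      using lim
    proof eventually_elim
      case (elim x)
      have "(\<lambda>n. ennreal (norm (v n x) ^ k)) \<longlonglongrightarrow> ennreal (norm (w x) ^ k)"
        by (intro tendsto_ennrealI tendsto_power tendsto_norm elim)
      then show ?case by (simp add: lim_imp_Liminf[symmetric])
    qed
  qed
  also have "\<dots> \<le> liminf (\<lambda>n. \<integral>\<^sup>+ x. ennreal (norm (v n x) ^ k) \<partial>M)"
    by (rule nn_integral_liminf) measurable
  finally show ?thesis .
qed

lemma Lp_measurable: "f \<in> Lp p \<Longrightarrow> f \<in> borel_measurable borel"
  by (simp add: Lp_def)

lemma Lp_iff:
  "f \<in> Lp p \<longleftrightarrow> f \<in> borel_measurable borel \<and> (NNINT x. ennreal (norm (f x) ^ p)) < \<infinity>"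
  by (auto simp: Lp_def integrable_iff_bounded)

lemma nn_integral_Lp:
  "f \<in> Lp p \<Longrightarrow> (NNINT x. ennreal (norm (f x) ^ p)) = ennreal (LINT x|lborel. norm (f x) ^ p)"
  by (rule nn_integral_eq_integral) (auto simp: Lp_def)

lemma integrable_mult_L2:
  fixes f g :: "'a::euclidean_space \<Rightarrow> complex"
  assumes "f \<in> Lp 2" "g \<in> Lp 2"
  shows "integrable lborel (\<lambda>x. f x * g x)"
proof -
  have [measurable]: "f \<in> borel_measurable borel" "g \<in> borel_measurable borel"
    using assms by (auto simp: Lp_def)
  have "integrable lborel (\<lambda>x. norm (f x) ^ 2 + norm (g x) ^ 2)"
    using assms by (simp add: Lp_def)
  then show ?thesis
  proof (rule Bochner_Integration.integrable_bound)
    show "AE x in lborel. norm (f x * g x) \<le> norm (norm (f x) ^ 2 + norm (g x) ^ 2)"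
    proof (intro AE_I2)
      fix x
      have "2 * (norm (f x) * norm (g x)) \<le> norm (f x) ^ 2 + norm (g x) ^ 2"
        using sum_squares_bound[of "norm (f x)" "norm (g x)"] by simp
      moreover have "0 \<le> norm (f x) * norm (g x)" by simp
      ultimately have "norm (f x) * norm (g x) \<le> norm (f x) ^ 2 + norm (g x) ^ 2" by linarith
      then show "norm (f x * g x) \<le> norm (norm (f x) ^ 2 + norm (g x) ^ 2)"
        by (simp add: norm_mult)
    qed
  qed measurable
qed

abbreviation trunc :: "real \<Rightarrow> ('a::euclidean_space \<Rightarrow> complex) \<Rightarrow> 'a \<Rightarrow> complex" where
  "trunc R f \<equiv> (\<lambda>x. indicator (cball 0 R) x * f x)"

lemma integrable_truncation:
  fixes f :: "'a::euclidean_space \<Rightarrow> complex"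
  assumes "f \<in> Lp 2"
  shows "integrable lborel (trunc R f)"
proof (rule integrable_mult_L2[OF _ assms])
  have "emeasure lborel (cball (0::'a) R) < \<infinity>"
    by (rule emeasure_bounded_finite) simp
  moreover have "(NNINT x. ennreal (norm (indicator (cball (0::'a) R) x :: complex) ^ 2)) = emeasure lborel (cball (0::'a) R)" (is "?L = ?R")
  proof -
    have "?L = (NNINT x. indicator (cball (0::'a) R) x)"
      by (intro nn_integral_cong) (auto split: split_indicator)
    also have "\<dots> = ?R" by (rule nn_integral_indicator) simp
    finally show ?thesis .
  qed
  ultimately show "indicator (cball (0::'a) R) \<in> Lp 2" by (simp add: Lp_iff borel_measurable_indicator)
qed

lemma fourier_truncation_measurable [measurable]:
  fixes f :: "'a::euclidean_space \<Rightarrow> complex"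
  assumes [measurable]: "f \<in> borel_measurable borel"
  shows "(trunc R f) \<in> borel_measurable borel"
  by (intro borel_measurable_times borel_measurable_indicator) auto

lemma L2_fourier_truncation_subseq:
  assumes "is_L2_fourier f g"
  obtains r where "strict_mono (r :: nat \<Rightarrow> nat)"
    "AE w in lborel. (\<lambda>n. fourier (trunc (real (r n)) f) w) \<longlonglongrightarrow> g w"
proof -
  have [measurable]: "f \<in> borel_measurable borel" "g \<in> borel_measurable borel"
    using assms by (auto simp: is_L2_fourier_def Lp_def)
  have "\<exists>r. strict_mono r \<and> (AE w in lborel. (\<lambda>n. fourier (trunc (real (r n)) f) w) \<longlonglongrightarrow> g w)"
  proof (rule L2_AE_subseq)
    show "fourier (trunc (real n) f) \<in> borel_measurable lborel" for n
      by (simp add: fourier_measurable fourier_truncation_measurable)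
  qed (use assms in \<open>simp_all add: is_L2_fourier_def\<close>)
  then show ?thesis using that by blast
qed

text \<open>Truncations are integrable, so \<open>plancherel_le\<close> applies to them, and
  truncating does not increase the norm. Fatou's lemma along an almost everywhere convergent
  subsequence does the rest.\<close>

lemma L2_fourier_norm_le:
  fixes f g :: "'a::euclidean_space \<Rightarrow> complex"
  assumes "is_L2_fourier f g"
  shows "(NNINT w. nsq (g w)) \<le> ennreal ((2 * pi) ^ DIM('a)) * (NNINT x. nsq (f x))"
proof -
  have f: "f \<in> Lp 2" using assms by (simp add: is_L2_fourier_def)
  then have [measurable]: "f \<in> borel_measurable borel" by (rule Lp_measurable)
  obtain r where r: "strict_mono (r :: nat \<Rightarrow> nat)"
    "AE w in lborel. (\<lambda>n. fourier (trunc (real (r n)) f) w) \<longlonglongrightarrow> g w"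
    using L2_fourier_truncation_subseq[OF assms] .
  let ?F = "\<lambda>n. fourier (trunc (real (r n)) f)"
  let ?B = "ennreal ((2 * pi) ^ DIM('a)) * (NNINT x. nsq (f x))"
  have "(NNINT w. nsq (g w))
     \<le> liminf (\<lambda>n. NNINT w. nsq (?F n w))"
    by (rule nn_integral_norm_power_fatou[OF _ r(2)]) (simp add: fourier_measurable fourier_truncation_measurable)
  also have "\<dots> \<le> limsup (\<lambda>n. NNINT w. nsq (?F n w))"
    by (rule Liminf_le_Limsup) simp
  also have "\<dots> \<le> ?B"
  proof (intro Limsup_bounded always_eventually allI)
    fix n
    have "(NNINT w. nsq (?F n w))
      \<le> ennreal ((2 * pi) ^ DIM('a)) * (NNINT x. nsq (indicator (cball 0 (real (r n))) x * f x))"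
      by (rule plancherel_le[OF integrable_truncation[OF f]])
    also have "\<dots> \<le> ?B"
      by (intro mult_left_mono nn_integral_mono) (auto split: split_indicator)
    finally show "(NNINT w. nsq (?F n w))
      \<le> ?B" .
  qed
  finally show ?thesis .
qed

lemma L2_fourier_radial:
  fixes f g :: "'a::euclidean_space \<Rightarrow> complex"
  assumes fg: "is_L2_fourier f g" and f: "f \<in> L2_rad"
  obtains \<phi> :: "real \<Rightarrow> complex" where "\<phi> \<in> borel_measurable borel" "AE w in lborel. g w = \<phi> ((norm w)\<^sup>2)"
proof -
  obtain h where h: "radial h" "AE x in lborel. f x = h x" using f by (auto simp: L2_rad_def)
  have [measurable]: "f \<in> borel_measurable borel" using f by (auto simp: L2_rad_def Lp_def)
  obtain r where r: "strict_mono (r :: nat \<Rightarrow> nat)"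
    "AE w in lborel. (\<lambda>n. fourier (trunc (real (r n)) f) w) \<longlonglongrightarrow> g w"
    using L2_fourier_truncation_subseq[OF fg] .
  define F where "F n = fourier (trunc (real (r n)) f)" for n
  have [measurable]: "F n \<in> borel_measurable borel" for n by (simp add: F_def fourier_measurable fourier_truncation_measurable)
  have rF: "radial (F n)" for n
    unfolding F_def
  proof (rule radial_fourier)
    show "radial (trunc (real (r n)) h)"
      unfolding radial_def
    proof (intro allI impI)
      fix x y :: 'a assume "norm x = norm y"
      moreover from this have "h x = h y" using h(1) unfolding radial_def by blast
      ultimately show "indicator (cball 0 (real (r n))) x * h x = indicator (cball 0 (real (r n))) y * h y"
        by (simp add: indicator_def)
    qed
    show "AE x in lborel. indicator (cball 0 (real (r n))) x * f x = indicator (cball 0 (real (r n))) x * h x"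
      using h(2) by eventually_elim simp
  qed (simp add: fourier_truncation_measurable)
  obtain e :: 'a where e: "e \<in> Basis" using nonempty_Basis by blast
  \<comment> \<open>A ray is a null set, but each \<open>F n\<close> is radial at every point:
    convergence at \<open>w\<close> forces convergence at the point of the ray with the same norm.
    Where the limit does not exist, \<open>lim\<close> is still some value, and the result is Borel
    measurable.\<close>
  define \<phi> where "\<phi> = (\<lambda>s::real. lim (\<lambda>n. F n (sqrt s *\<^sub>R e)))"
  have "\<phi> \<in> borel_measurable borel" unfolding \<phi>_def by measurable
  moreover have "AE w in lborel. g w = \<phi> ((norm w)\<^sup>2)"
    using r(2)
  proof eventually_elim
    case (elim w)
    have "F n w = F n (sqrt ((norm w)\<^sup>2) *\<^sub>R e)" for n
    proof -
      have "norm w = norm (sqrt ((norm w)\<^sup>2) *\<^sub>R e)" using e by simp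
      then show ?thesis using rF[of n] unfolding radial_def by blast
    qed
    moreover have "lim (\<lambda>n. F n w) = g w" using elim unfolding F_def by (rule limI)
    ultimately show ?case by (simp add: \<phi>_def)
  qed
  ultimately show ?thesis using that by blast
qed

subsection \<open>Continuity of translations and the heat kernel\<close>

lemma tendsto_nn_integral_zeroI:
  fixes a :: "nat \<Rightarrow> 'a \<Rightarrow> real"
  assumes "\<And>n. integrable M (a n)" "\<And>n x. a n x \<ge> 0"
  shows "(\<lambda>n. \<integral>\<^sup>+ x. ennreal (a n x) \<partial>M) \<longlonglongrightarrow> 0 \<longleftrightarrow> (\<lambda>n. \<integral>x. a n x \<partial>M) \<longlonglongrightarrow> 0"
proof -
  have "(\<integral>\<^sup>+ x. ennreal (a n x) \<partial>M) = ennreal (\<integral>x. a n x \<partial>M)" for n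
    by (rule nn_integral_eq_integral) (auto simp: assms)
  then have "(\<lambda>n. \<integral>\<^sup>+ x. ennreal (a n x) \<partial>M) \<longlonglongrightarrow> 0 \<longleftrightarrow> (\<lambda>n. ennreal (\<integral>x. a n x \<partial>M)) \<longlonglongrightarrow> ennreal 0"
    by (simp only: ennreal_0)
  also have "\<dots> \<longleftrightarrow> (\<lambda>n. \<integral>x. a n x \<partial>M) \<longlonglongrightarrow> 0"
    by (rule tendsto_ennreal_iff) (auto intro!: always_eventually integral_nonneg simp: assms)
  finally show ?thesis .
qed

lemma nn_integral_lborel_minus:
  fixes f :: "'a::euclidean_space \<Rightarrow> ennreal"
  assumes [measurable]: "f \<in> borel_measurable borel"
  shows "(NNINT x. f (x - w)) = (NNINT x. f x)"
  using nn_integral_lborel_plus[OF assms, of "-w"] by simp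

text \<open>The two indicators have the same integral, so the integral of their absolute difference is twice
  that of its positive part, which tends to 0 pointwise because \<open>U\<close> is open.\<close>

lemma translation_continuous_open:
  fixes U :: "'a::euclidean_space set"
  assumes U: "open U" "emeasure lborel U < \<infinity>" and w: "w \<longlonglongrightarrow> 0"
  shows "(\<lambda>n. NNINT x. ennreal \<bar>indicator U (x - w n) - indicator U x\<bar>) \<longlonglongrightarrow> 0"
proof -
  have [measurable]: "U \<in> sets borel" using U by simp
  define p :: "nat \<Rightarrow> 'a \<Rightarrow> real" where "p n x = indicator U x * (1 - indicator U (x - w n))" for n x
  have [measurable]: "p n \<in> borel_measurable borel" for n unfolding p_def by measurable
  have iU: "integrable lborel (indicator U :: 'a \<Rightarrow> real)"
    using U by (intro integrable_real_indicator) auto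
  have iUw: "integrable lborel (\<lambda>x. indicator U (x - w n) :: real)" for n
    using U nn_integral_lborel_minus[of "indicator U" "w n"]
    by (intro integrableI_bounded) (auto simp: ennreal_indicator)
  have eqUw: "(LINT x|lborel. indicator U (x - w n) :: real) = (LINT x|lborel. indicator U x)" for n
    using nn_integral_lborel_minus[of "indicator U" "w n"]
    by (simp add: integral_eq_nn_integral ennreal_indicator measure_def)
  have ip: "integrable lborel (p n)" for n
    by (rule Bochner_Integration.integrable_bound[OF iU]) (auto simp: p_def split: split_indicator)
  have abs: "\<bar>indicator U (x - w n) - indicator U x :: real\<bar> = 2 * p n x + indicator U (x - w n) - indicator U x" for n x
    by (auto simp: p_def split: split_indicator)
  have "(\<lambda>n. LINT x|lborel. p n x) \<longlonglongrightarrow> (LINT x::'a|lborel. 0)"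
  proof (rule integral_dominated_convergence[where w="indicator U"])
    show "AE x in lborel. (\<lambda>n. p n x) \<longlonglongrightarrow> 0"
    proof (intro AE_I2)
      fix x :: 'a
      show "(\<lambda>n. p n x) \<longlonglongrightarrow> 0"
      proof (cases "x \<in> U")
        case True
        have "(\<lambda>n. x - w n) \<longlonglongrightarrow> x - 0" by (intro tendsto_intros w)
        then have "eventually (\<lambda>n. x - w n \<in> U) sequentially"
          using U True by (intro topological_tendstoD) auto
        then have "eventually (\<lambda>n. p n x = 0) sequentially"
          by eventually_elim (simp add: p_def)
        then show ?thesis by (rule tendsto_eventually)
      qed (simp add: p_def)
    qed
  qed (use iU in \<open>auto simp: p_def split: split_indicator\<close>)
  then have "(\<lambda>n. LINT x|lborel. p n x) \<longlonglongrightarrow> 0" by simp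
  moreover have "(LINT x|lborel. \<bar>indicator U (x - w n) - indicator U x :: real\<bar>) = 2 * (LINT x|lborel. p n x)" for n
    using ip[of n] iU iUw[of n] by (simp add: abs eqUw)
  ultimately have "(\<lambda>n. LINT x|lborel. \<bar>indicator U (x - w n) - indicator U x :: real\<bar>) \<longlonglongrightarrow> 0"
    by (simp add: tendsto_mult_right_zero)
  then show ?thesis
    by (subst tendsto_nn_integral_zeroI) (use iU iUw in \<open>auto intro!: integrable_abs Bochner_Integration.integrable_diff\<close>)
qed

lemma tendsto_zero_ennrealI:
  fixes a :: "nat \<Rightarrow> ennreal"
  assumes "\<And>d::real. d > 0 \<Longrightarrow> eventually (\<lambda>n. a n \<le> ennreal d) sequentially"
  shows "a \<longlonglongrightarrow> 0"
proof (rule order_tendstoI)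
  fix e :: ennreal assume "0 < e"
  then obtain d :: real where "d > 0" "ennreal d < e"
  proof (cases e)
    case (real r)
    then show ?thesis using \<open>0 < e\<close> that[of "r / 2"] by (auto simp: ennreal_less_iff)
  next
    case top
    then show ?thesis using that[of 1] by auto
  qed
  then show "eventually (\<lambda>n. a n < e) sequentially"
    using assms[of d] by (auto elim!: eventually_mono)
qed simp

lemma tendsto_zero_ennrealD:
  fixes a :: "nat \<Rightarrow> ennreal"
  assumes "a \<longlonglongrightarrow> 0" "d > 0"
  shows "eventually (\<lambda>n. a n \<le> ennreal d) sequentially"
  using order_tendstoD(2)[OF assms(1), of "ennreal d"] assms(2) by (auto elim: eventually_mono)

text \<open>Outer regularity reduces this to an open superset \<open>U\<close> of finite measure.
  The excess \<open>U - A\<close> is paid for at \<open>x\<close> and again at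
  \<open>x - w n\<close>, hence the three shares of size \<open>d / 3\<close>.\<close>

lemma translation_continuous_indicator:
  fixes A :: "'a::euclidean_space set"
  assumes [measurable]: "A \<in> sets borel" and A: "emeasure lborel A < \<infinity>" and w: "w \<longlonglongrightarrow> 0"
  shows "(\<lambda>n. NNINT x. ennreal \<bar>indicator A (x - w n) - indicator A x\<bar>) \<longlonglongrightarrow> 0"
proof (rule tendsto_zero_ennrealI)
  fix d :: real assume d: "d > 0"
  obtain U where U: "open U" "A \<subseteq> U" "emeasure lborel (U - A) < ennreal (d / 3)"
    using outer_regular_lborel[of A "d / 3"] d by auto
  have [measurable]: "U \<in> sets borel" using U by simp
  have "emeasure lborel U \<le> emeasure lborel A + emeasure lborel (U - A)"
    using U by (intro order_trans[OF _ emeasure_subadditive] emeasure_mono) auto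
  also have "\<dots> < \<infinity>" using A U(3) by (auto simp: ennreal_add_eq_top less_top[symmetric])
  finally have fU: "emeasure lborel U < \<infinity>" .
  show "eventually (\<lambda>n. (NNINT x. ennreal \<bar>indicator A (x - w n) - indicator A x\<bar>) \<le> ennreal d) sequentially"
  proof (rule eventually_mono[OF tendsto_zero_ennrealD[OF translation_continuous_open[OF U(1) fU w]]])
    show "d / 3 > 0" using d by simp
    fix n
    assume *: "(NNINT x. ennreal \<bar>indicator U (x - w n) - indicator U x\<bar>) \<le> ennreal (d / 3)"
    have "(NNINT x. ennreal \<bar>indicator A (x - w n) - indicator A x\<bar>)
      \<le> (NNINT x. ennreal \<bar>indicator U (x - w n) - indicator U x\<bar> + (indicator (U - A) (x - w n) + indicator (U - A) x))"
      using U(2) by (intro nn_integral_mono) (auto split: split_indicator)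
    also have "\<dots> = (NNINT x. ennreal \<bar>indicator U (x - w n) - indicator U x\<bar>) + (emeasure lborel (U - A) + emeasure lborel (U - A))"
      using nn_integral_lborel_minus[of "indicator (U - A)" "w n"] by (simp add: nn_integral_add)
    also have "\<dots> \<le> ennreal (d / 3) + (ennreal (d / 3) + ennreal (d / 3))"
      using U(3) * by (intro add_mono) auto
    also have "\<dots> = ennreal d" using d by (simp flip: ennreal_plus)
    finally show "(NNINT x. ennreal \<bar>indicator A (x - w n) - indicator A x\<bar>) \<le> ennreal d" .
  qed
qed

text \<open>Induction over integrable functions: the limit step is a three-epsilon argument, where
  the error at \<open>x - w n\<close> has the same integral as the error at \<open>x\<close> by
  translation invariance.\<close>

lemma translation_continuous_L1:
  fixes f :: "'a::euclidean_space \<Rightarrow> complex"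
  assumes f: "integrable lborel f" and w: "w \<longlonglongrightarrow> 0"
  shows "(\<lambda>n. NNINT x. ennreal (norm (f (x - w n) - f x))) \<longlonglongrightarrow> 0"
  using f
proof (induction rule: integrable_induct)
  case (base A c)
  then have [measurable]: "A \<in> sets borel" by simp
  have "(\<lambda>n. ennreal (norm c) * (NNINT x. ennreal \<bar>indicator A (x - w n) - indicator A x\<bar>)) \<longlonglongrightarrow> ennreal (norm c) * 0"
    using base by (intro ennreal_tendsto_cmult translation_continuous_indicator w) auto
  moreover have "norm (indicator A (x - w n) *\<^sub>R c - indicator A x *\<^sub>R c) = norm c * \<bar>indicator A (x - w n) - indicator A x\<bar>" for x n
    by (simp flip: scaleR_diff_left)
  ultimately show ?case
    by (simp add: ennreal_mult nn_integral_cmult)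
next
  case (add f g)
  then have [measurable]: "f \<in> borel_measurable borel" "g \<in> borel_measurable borel" by auto
  let ?f = "\<lambda>n. NNINT x. ennreal (norm (f (x - w n) - f x))"
  let ?g = "\<lambda>n. NNINT x. ennreal (norm (g (x - w n) - g x))"
  let ?fg = "\<lambda>n. NNINT x. ennreal (norm (f (x - w n) + g (x - w n) - (f x + g x)))"
  show ?case
  proof (rule tendsto_sandwich[OF _ _ tendsto_const])
    show "(\<lambda>n. ?f n + ?g n) \<longlonglongrightarrow> 0"
      using tendsto_add[OF add.IH] by simp
    show "\<forall>\<^sub>F n in sequentially. ?fg n
      \<le> ?f n + ?g n"
    proof (intro always_eventually allI)
      fix n
      have "?fg n
        \<le> (NNINT x. ennreal (norm (f (x - w n) - f x)) + ennreal (norm (g (x - w n) - g x)))"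
        by (intro nn_integral_mono) (simp add: norm_diff_triangle_ineq flip: ennreal_plus)
      then show "?fg n
      \<le> ?f n + ?g n"
        by (simp add: nn_integral_add)
    qed
  qed auto
next
  case (lim f s)
  then have [measurable]: "f \<in> borel_measurable borel" "s i \<in> borel_measurable borel" for i by auto
  have "(\<lambda>i. NNINT x. ennreal (norm (f x - s i x))) \<longlonglongrightarrow> 0"
  proof (rule nn_integral_dominated_convergence_norm)
    show "AE x in lborel. norm (s j x) \<le> 2 * norm (f x)" for j using lim by auto
    show "(NNINT x. ennreal (2 * norm (f x))) < \<infinity>"
      using \<open>integrable lborel f\<close> by (simp add: integrable_iff_bounded ennreal_mult nn_integral_cmult ennreal_mult_less_top)
  qed (use lim in auto)
  note s = this
  show ?case
  proof (rule tendsto_zero_ennrealI)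
    fix d :: real assume d: "d > 0"
    then obtain i where i: "(NNINT x. ennreal (norm (f x - s i x))) \<le> ennreal (d / 3)"
      using tendsto_zero_ennrealD[OF s, of "d / 3"] by (auto simp: eventually_sequentially)
    show "eventually (\<lambda>n. (NNINT x. ennreal (norm (f (x - w n) - f x))) \<le> ennreal d) sequentially"
    proof (rule eventually_mono[OF tendsto_zero_ennrealD[OF lim.IH[of i]]])
      show "d / 3 > 0" using d by simp
      fix n
      assume *: "(NNINT x. ennreal (norm (s i (x - w n) - s i x))) \<le> ennreal (d / 3)"
      have "(NNINT x. ennreal (norm (f (x - w n) - f x)))
        \<le> (NNINT x. ennreal (norm (s i (x - w n) - s i x)) + (ennreal (norm (f (x - w n) - s i (x - w n))) + ennreal (norm (f x - s i x))))"
      proof (intro nn_integral_mono)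
        fix x
        have "f (x - w n) - f x = (s i (x - w n) - s i x) + ((f (x - w n) - s i (x - w n)) - (f x - s i x))" by simp
        also have "norm \<dots> \<le> norm (s i (x - w n) - s i x) + (norm (f (x - w n) - s i (x - w n)) + norm (f x - s i x))"
          by (intro norm_triangle_mono order_refl norm_triangle_ineq4)
        finally show "ennreal (norm (f (x - w n) - f x)) \<le> ennreal (norm (s i (x - w n) - s i x)) + (ennreal (norm (f (x - w n) - s i (x - w n))) + ennreal (norm (f x - s i x)))"
          by (simp flip: ennreal_plus)
      qed
      also have "\<dots> = (NNINT x. ennreal (norm (s i (x - w n) - s i x))) + ((NNINT x. ennreal (norm (f x - s i x))) + (NNINT x. ennreal (norm (f x - s i x))))"
        using nn_integral_lborel_minus[of "\<lambda>x. ennreal (norm (f x - s i x))" "w n"] by (simp add: nn_integral_add)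
      also have "\<dots> \<le> ennreal (d / 3) + (ennreal (d / 3) + ennreal (d / 3))"
        by (intro add_mono i *)
      also have "\<dots> = ennreal d" using d by (simp flip: ennreal_plus)
      finally show "(NNINT x. ennreal (norm (f (x - w n) - f x))) \<le> ennreal d" .
    qed
  qed
qed

lemma ennreal_times3:
  "0 \<le> a \<Longrightarrow> 0 \<le> b \<Longrightarrow> 0 \<le> c \<Longrightarrow> ennreal (3 * (a + b + c)) = 3 * (ennreal a + (ennreal b + ennreal c))"
  by (subst ennreal_mult) (simp_all add: add.assoc)

lemma norm_sum3_sq_le:
  fixes a b c :: "'a::real_normed_vector"
  shows "(norm (a + b + c))\<^sup>2 \<le> 3 * ((norm a)\<^sup>2 + (norm b)\<^sup>2 + (norm c)\<^sup>2)"
proof -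
  have "norm (a + b + c) \<le> norm a + norm b + norm c" by (meson norm_triangle_ineq norm_triangle_mono order_refl)
  then have "(norm (a + b + c))\<^sup>2 \<le> (norm a + norm b + norm c)\<^sup>2" by (intro power_mono) auto
  moreover have "(x + y + z)\<^sup>2 \<le> 3 * (x\<^sup>2 + y\<^sup>2 + z\<^sup>2)" for x y z :: real
    using sum_squares_bound[of x y] sum_squares_bound[of y z] sum_squares_bound[of x z]
    by (simp add: power2_eq_square algebra_simps)
  ultimately show ?thesis by (meson order_trans)
qed

text \<open>Cutting off both the domain and the values of \<open>v\<close> leaves
  \<open>s M\<close>, which is integrable and bounded by \<open>M\<close>. For such a function the
  squared difference is at most \<open>2 * M\<close> times the difference, so continuity in mean
  carries over.\<close>

lemma translation_continuous_L2:
  fixes v :: "'a::euclidean_space \<Rightarrow> complex"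
  assumes v: "v \<in> Lp 2" and w: "w \<longlonglongrightarrow> 0"
  shows "(\<lambda>n. NNINT x. nsq (v (x - w n) - v x)) \<longlonglongrightarrow> 0"
proof -
  have [measurable]: "v \<in> borel_measurable borel" using v by (rule Lp_measurable)
  define S where "S M = cball (0::'a) (real M) \<inter> {x. norm (v x) \<le> real M}" for M :: nat
  have [measurable]: "S M \<in> sets borel" for M unfolding S_def by measurable
  define s where "s M x = indicator (S M) x * v x" for M x
  have [measurable]: "s M \<in> borel_measurable borel" for M unfolding s_def by measurable
  have s_int: "integrable lborel (s M)" for M
  proof (rule Bochner_Integration.integrable_bound[OF integrable_truncation[OF v, of "real M"]])
    show "AE x in lborel. norm (s M x) \<le> norm (indicator (cball 0 (real M)) x * v x)"
      by (auto simp: s_def S_def split: split_indicator)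
  qed measurable
  have s_bd: "norm (s M x) \<le> real M" for M x by (auto simp: s_def S_def split: split_indicator)
  have i2: "integrable lborel (\<lambda>x. (norm (v x))\<^sup>2)" using v by (simp add: Lp_def)
  have bnd: "(norm (v x - s M x))\<^sup>2 \<le> (norm (v x))\<^sup>2" for M x by (auto simp: s_def split: split_indicator)
  have si: "integrable lborel (\<lambda>x. (norm (v x - s M x))\<^sup>2)" for M
    by (rule Bochner_Integration.integrable_bound[OF i2]) (auto simp: bnd)
  have "(\<lambda>M. LINT x|lborel. (norm (v x - s M x))\<^sup>2) \<longlonglongrightarrow> (LINT x::'a|lborel. 0)"
  proof (rule integral_dominated_convergence[OF _ _ i2])
    show "AE x in lborel. (\<lambda>M. (norm (v x - s M x))\<^sup>2) \<longlonglongrightarrow> 0"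
    proof (intro AE_I2)
      fix x
      obtain N :: nat where N: "max (norm x) (norm (v x)) \<le> real N" using real_arch_simple by blast
      have "eventually (\<lambda>M. (norm (v x - s M x))\<^sup>2 = 0) sequentially"
        using eventually_ge_at_top[of N]
      proof eventually_elim
        case (elim M)
        then have "real N \<le> real M" by simp
        then have "x \<in> S M" using N by (auto simp: S_def)
        then show ?case by (simp add: s_def)
      qed
      then show "(\<lambda>M. (norm (v x - s M x))\<^sup>2) \<longlonglongrightarrow> 0" by (rule tendsto_eventually)
    qed
  qed (auto simp: bnd)
  then have s: "(\<lambda>M. NNINT x. nsq (v x - s M x)) \<longlonglongrightarrow> 0"
    by (subst tendsto_nn_integral_zeroI) (auto simp: si)
  show ?thesis
  proof (rule tendsto_zero_ennrealI)
    fix d :: real assume d: "d > 0"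
    then obtain M where M: "(NNINT x. nsq (v x - s M x)) \<le> ennreal (d / 9)"
      using tendsto_zero_ennrealD[OF s, of "d / 9"] by (auto simp: eventually_sequentially)
    \<comment> \<open>Each of three terms may use \<open>d / 9\<close>, since
      \<open>norm_sum3_sq_le\<close> costs another factor 3, and \<open>2 * M * c\<close> is at most
      \<open>d / 9\<close>. The \<open>+ 1\<close> covers \<open>M = 0\<close>.\<close>
    define c where "c = d / (18 * (real M + 1))"
    have "c > 0" using d by (simp add: c_def)
    from tendsto_zero_ennrealD[OF translation_continuous_L1[OF s_int[of M] w] this]
    show "eventually (\<lambda>n. (NNINT x. nsq (v (x - w n) - v x)) \<le> ennreal d) sequentially"
    proof (rule eventually_mono)
      fix n
      let ?s = "\<lambda>x. s M (x - w n) - s M x"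
      assume *: "(NNINT x. ennreal (norm (?s x))) \<le> ennreal c"
      have **: "(NNINT x. nsq (?s x)) \<le> ennreal (d / 9)"
      proof -
        have "(NNINT x. nsq (?s x)) \<le> (NNINT x. ennreal (2 * real M) * ennreal (norm (?s x)))"
        proof (intro nn_integral_mono)
          fix x
          have "norm (?s x) \<le> 2 * real M"
            using norm_triangle_ineq4[of "s M (x - w n)" "s M x"] s_bd[of M x] s_bd[of M "x - w n"] by linarith
          then have "(norm (?s x))\<^sup>2 \<le> 2 * real M * norm (?s x)"
            unfolding power2_eq_square by (intro mult_right_mono) auto
          then show "nsq (?s x) \<le> ennreal (2 * real M) * ennreal (norm (?s x))"
            by (simp flip: ennreal_mult)
        qed
        also have "\<dots> = ennreal (2 * real M) * (NNINT x. ennreal (norm (?s x)))"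
          by (rule nn_integral_cmult) measurable
        also have "\<dots> \<le> ennreal (2 * real M) * ennreal c" by (intro mult_left_mono *) auto
        also have "\<dots> \<le> ennreal (d / 9)"
          using d unfolding c_def by (subst ennreal_mult[symmetric]) (auto intro!: ennreal_leI simp: field_simps)
        finally show ?thesis .
      qed
      have "(NNINT x. nsq (v (x - w n) - v x))
        \<le> (NNINT x. 3 * (nsq (?s x) + (nsq (v (x - w n) - s M (x - w n)) + nsq (v x - s M x))))"
      proof (intro nn_integral_mono)
        fix x
        have eq: "v (x - w n) - v x = (?s x) + (v (x - w n) - s M (x - w n)) + (s M x - v x)" by simp
        have "(norm (v (x - w n) - v x))\<^sup>2 \<le> 3 * ((norm (?s x))\<^sup>2 + (norm (v (x - w n) - s M (x - w n)))\<^sup>2 + (norm (v x - s M x))\<^sup>2)"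
          unfolding eq using norm_sum3_sq_le[of "s M (x - w n) - s M x" "v (x - w n) - s M (x - w n)" "s M x - v x"]
          by (simp add: norm_minus_commute)
        then show "nsq (v (x - w n) - v x) \<le> 3 * (nsq (?s x) + (nsq (v (x - w n) - s M (x - w n)) + nsq (v x - s M x)))"
          unfolding ennreal_times3[symmetric, OF zero_le_power2 zero_le_power2 zero_le_power2] by (rule ennreal_leI)
      qed
      also have "\<dots> = 3 * ((NNINT x. nsq (?s x)) + ((NNINT x. nsq (v x - s M x)) + (NNINT x. nsq (v x - s M x))))"
        using nn_integral_lborel_minus[of "\<lambda>x. nsq (v x - s M x)" "w n"] by (simp add: nn_integral_add nn_integral_cmult)
      also have "\<dots> \<le> 3 * (ennreal (d / 9) + (ennreal (d / 9) + ennreal (d / 9)))"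
        by (intro mult_left_mono add_mono M **) auto
      also have "\<dots> = ennreal d"
        using d by (subst ennreal_times3[symmetric]) auto
      finally show "(NNINT x. nsq (v (x - w n) - v x)) \<le> ennreal d" .
    qed
  qed
qed

section \<open>The heat kernel as an approximate identity\<close>

text \<open>This is the transform of \<open>gauss e\<close> divided by
  \<open>(2 * pi) ^ DIM('a)\<close>, the kernel of the heat semigroup at time \<open>e\<close>;
  averaging against it multiplies the Fourier transform by \<open>gauss e\<close>.\<close>

definition heat_kernel :: "real \<Rightarrow> 'a::euclidean_space \<Rightarrow> real" where
  "heat_kernel e z = (1 / sqrt (4 * pi * e)) ^ DIM('a) * exp (- (norm z)\<^sup>2 / (4 * e))"

definition heat :: "real \<Rightarrow> ('a::euclidean_space \<Rightarrow> complex) \<Rightarrow> 'a \<Rightarrow> complex" where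
  "heat e v x = (LINT y|lborel. complex_of_real (heat_kernel e (x - y)) * v y)"

lemma heat_kernel_measurable [measurable]: "heat_kernel e \<in> borel_measurable borel"
  unfolding heat_kernel_def by measurable

lemma heat_kernel_nonneg: "e > 0 \<Longrightarrow> heat_kernel e z \<ge> 0"
  by (simp add: heat_kernel_def)

lemma nn_integral_heat_kernel:
  assumes "e > 0" shows "(NNINT z::'a::euclidean_space. ennreal (heat_kernel e z)) = 1"
proof -
  have eq: "ennreal (heat_kernel e z) = ennreal ((1 / sqrt (4 * pi * e)) ^ DIM('a)) * ennreal (exp (- (1/(4*e)) * (norm z)\<^sup>2))" for z :: 'a
    using assms by (simp add: heat_kernel_def ennreal_mult)
  have "(NNINT z::'a. ennreal (heat_kernel e z))
      = ennreal ((1 / sqrt (4 * pi * e)) ^ DIM('a)) * (NNINT z::'a. ennreal (exp (- (1/(4*e)) * (norm z)\<^sup>2)))"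
    unfolding eq by (rule nn_integral_cmult) measurable
  also have "\<dots> = ennreal ((1 / sqrt (4 * pi * e)) ^ DIM('a) * sqrt (pi / (1/(4*e))) ^ DIM('a))"
    using assms by (subst nn_integral_gaussian) (auto simp: ennreal_mult'')
  also have "(1 / sqrt (4 * pi * e)) ^ DIM('a) * sqrt (pi / (1/(4*e))) ^ DIM('a) = (1 / sqrt (4 * pi * e) * sqrt (4 * pi * e)) ^ DIM('a)"
    by (simp only: power_mult_distrib) (simp add: mult_ac)
  also have "1 / sqrt (4 * pi * e) * sqrt (4 * pi * e) = 1" using assms by simp
  finally show ?thesis by simp
qed

lemma gaussian_L2:
  assumes "e > 0" shows "(\<lambda>w::'a::euclidean_space. gauss e w) \<in> Lp 2"
proof -
  have "integrable lborel (\<lambda>w::'a. exp (- (2 * e) * (norm w)\<^sup>2))" using assms by (intro integrable_gaussian) simp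
  moreover have "(norm (gauss e w))\<^sup>2 = exp (- (2 * e) * (norm w)\<^sup>2)" for w :: 'a
    by (simp add: power2_eq_square flip: exp_add)
  ultimately show ?thesis by (simp add: Lp_def)
qed

lemma heat_kernel_L2:
  assumes "e > 0" shows "(\<lambda>y::'a::euclidean_space. complex_of_real (heat_kernel e (x - y))) \<in> Lp 2"
proof -
  have "gauss (1 / (4 * e)) \<in> (Lp 2 :: ('a \<Rightarrow> complex) set)" using assms by (intro gaussian_L2) simp
  then have "(NNINT y. nsq (gauss (1 / (4 * e)) (x - y))) < \<infinity>"
    by (subst nn_integral_lborel_diff) (simp_all add: Lp_iff)
  moreover have "nsq (complex_of_real (heat_kernel e (x - y)))
      = ennreal (((1 / sqrt (4 * pi * e)) ^ DIM('a))\<^sup>2) * nsq (gauss (1 / (4 * e)) (x - y))" for y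
    using assms by (subst ennreal_mult[symmetric]) (simp_all add: heat_kernel_def norm_mult norm_power norm_divide power_mult_distrib)
  ultimately have "(NNINT y. nsq (complex_of_real (heat_kernel e (x - y)))) < \<infinity>"
    by (simp add: nn_integral_cmult ennreal_mult_less_top)
  then show ?thesis unfolding Lp_iff by simp
qed

lemma integrable_heat_kernel:
  assumes "e > 0" shows "integrable lborel (heat_kernel e :: 'a::euclidean_space \<Rightarrow> real)"
  using nn_integral_heat_kernel[OF assms, where 'a='a]
  by (intro integrableI_nonneg) (auto simp: heat_kernel_nonneg assms)

lemma integral_lborel_diff:
  fixes f :: "'a::euclidean_space \<Rightarrow> complex"
  assumes [measurable]: "f \<in> borel_measurable borel"
  shows "(LINT y|lborel. f (x - y)) = (LINT y|lborel. f y)"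
    and "integrable lborel (\<lambda>y. f (x - y)) \<longleftrightarrow> integrable lborel f"
proof -
  have eq: "lborel = distr lborel borel (\<lambda>y. x - y)"
    using lborel_affine[of "-1" x] by (simp add: density_1)
  have "(LINT y|lborel. f y) = (LINT y|distr lborel borel (\<lambda>y. x - y). f y)" using eq by simp
  also have "\<dots> = (LINT y|lborel. f (x - y))" by (subst integral_distr) auto
  finally show "(LINT y|lborel. f (x - y)) = (LINT y|lborel. f y)" by simp
  have "integrable lborel f \<longleftrightarrow> integrable (distr lborel borel (\<lambda>y. x - y)) f" using eq by simp
  also have "\<dots> \<longleftrightarrow> integrable lborel (\<lambda>y. f (x - y))" by (subst integrable_distr_eq) auto
  finally show "integrable lborel (\<lambda>y. f (x - y)) \<longleftrightarrow> integrable lborel f" by simp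
qed

text \<open>Jensen's inequality for the probability density \<open>heat_kernel e\<close>, obtained
  from Cauchy-Schwarz by splitting the kernel into two square roots.\<close>

lemma heat_diff_le:
  fixes v :: "'a::euclidean_space \<Rightarrow> complex"
  assumes v: "v \<in> Lp 2" and e: "e > 0"
  shows "nsq (heat e v x - v x) \<le> (NNINT z. ennreal (heat_kernel e z) * nsq (v (x - z) - v x))"
proof -
  have [measurable]: "v \<in> borel_measurable borel" using v by (rule Lp_measurable)
  have int1: "integrable lborel (\<lambda>y. complex_of_real (heat_kernel e (x - y)) * v y)"
    by (rule integrable_mult_L2[OF heat_kernel_L2[OF e] v])
  have int2: "integrable lborel (\<lambda>z. complex_of_real (heat_kernel e z) * v (x - z))"
    using integral_lborel_diff(2)[of "\<lambda>y. complex_of_real (heat_kernel e (x - y)) * v y" x] int1 by simp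
  have heat: "heat e v x = (LINT z|lborel. complex_of_real (heat_kernel e z) * v (x - z))"
    using integral_lborel_diff(1)[of "\<lambda>y. complex_of_real (heat_kernel e (x - y)) * v y" x] by (simp add: heat_def)
  have int3: "integrable lborel (\<lambda>z::'a. complex_of_real (heat_kernel e z) * v x)"
    by (intro integrable_mult_left impI integrable_of_real integrable_heat_kernel e)
  have "(LINT z|lborel. heat_kernel e (z::'a)) = 1"
    using nn_integral_heat_kernel[OF e, where 'a='a] by (subst integral_eq_nn_integral) (auto simp: heat_kernel_nonneg e)
  then have "(LINT z|lborel. complex_of_real (heat_kernel e (z::'a)) * v x) = v x" by simp
  then have diff: "heat e v x - v x = (LINT z|lborel. complex_of_real (heat_kernel e z) * (v (x - z) - v x))"
    unfolding heat using Bochner_Integration.integral_diff[OF int2 int3] by (simp only: right_diff_distrib)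
  define s where "s z = sqrt (heat_kernel e z)" for z :: 'a
  have [measurable]: "s \<in> borel_measurable borel" unfolding s_def by measurable
  have s: "s z \<ge> 0" "s z * s z = heat_kernel e z" for z using heat_kernel_nonneg[OF e, of z] by (auto simp: s_def)
  have "nsq (heat e v x - v x) = (ennreal (norm (heat e v x - v x)))\<^sup>2" by (simp add: ennreal_power)
  also have "\<dots> \<le> (NNINT z. ennreal (norm (complex_of_real (heat_kernel e z) * (v (x - z) - v x))))\<^sup>2"
    unfolding diff by (intro power_mono ennreal_norm_integral_le) auto
  also have "\<dots> = (NNINT z. ennreal (s z) * ennreal (s z * norm (v (x - z) - v x)))\<^sup>2"
  proof -
    have "ennreal (norm (complex_of_real (heat_kernel e z) * (v (x - z) - v x))) = ennreal (s z) * ennreal (s z * norm (v (x - z) - v x))" for z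
      by (subst ennreal_mult[symmetric]) (auto simp: s norm_mult heat_kernel_nonneg[OF e] simp flip: mult.assoc)
    then show ?thesis by simp
  qed
  also have "\<dots> \<le> (NNINT z. ennreal (s z) ^ 2) * (NNINT z. ennreal (s z * norm (v (x - z) - v x)) ^ 2)"
    by (rule Cauchy_Schwarz_nn_integral) measurable
  also have "(NNINT z. ennreal (s z) ^ 2) = 1"
  proof -
    have "ennreal (s z) ^ 2 = ennreal (heat_kernel e z)" for z
      using s[of z] by (simp add: power2_eq_square flip: ennreal_mult)
    then show ?thesis using nn_integral_heat_kernel[OF e, where 'a='a] by simp
  qed
  also have "(NNINT z. ennreal (s z * norm (v (x - z) - v x)) ^ 2) = (NNINT z. ennreal (heat_kernel e z) * nsq (v (x - z) - v x))"
  proof (intro nn_integral_cong)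
    fix z
    have "(s z * norm (v (x - z) - v x))\<^sup>2 = heat_kernel e z * (norm (v (x - z) - v x))\<^sup>2"
      by (simp add: power_mult_distrib power2_eq_square[of "s z"] s)
    then show "ennreal (s z * norm (v (x - z) - v x)) ^ 2 = ennreal (heat_kernel e z) * nsq (v (x - z) - v x)"
      by (subst ennreal_power, simp add: s, subst ennreal_mult[symmetric]) (simp_all add: heat_kernel_nonneg[OF e])
  qed
  finally show ?thesis by simp
qed

lemma nn_integral_lborel_scale:
  fixes g :: "'a::euclidean_space \<Rightarrow> ennreal"
  assumes [measurable]: "g \<in> borel_measurable borel" and c: "c \<noteq> 0"
  shows "(NNINT x. g x) = ennreal (\<bar>c\<bar> ^ DIM('a)) * (NNINT x. g (c *\<^sub>R x))"
  by (subst lborel_affine[OF c, of 0]) (simp add: nn_integral_density nn_integral_distr nn_integral_cmult)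

lemma nsq_diff_le: "nsq (a - b) \<le> 2 * (nsq a + nsq b)"
proof -
  have "(norm (a - b))\<^sup>2 \<le> (norm a + norm b)\<^sup>2" by (intro power_mono norm_triangle_ineq4) auto
  also have "\<dots> \<le> 2 * ((norm a)\<^sup>2 + (norm b)\<^sup>2)"
    using sum_squares_bound[of "norm a" "norm b"] by (simp add: power2_eq_square algebra_simps)
  finally have "nsq (a - b) \<le> ennreal (2 * ((norm a)\<^sup>2 + (norm b)\<^sup>2))" by (rule ennreal_leI)
  also have "\<dots> = 2 * (nsq a + nsq b)" by (subst ennreal_mult) simp_all
  finally show ?thesis .
qed

lemma nn_integral_nsq_diff_le:
  fixes f g :: "'a \<Rightarrow> complex"
  assumes [measurable]: "f \<in> borel_measurable M" "g \<in> borel_measurable M"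
  shows "(\<integral>\<^sup>+ x. nsq (f x - g x) \<partial>M) \<le> 2 * ((\<integral>\<^sup>+ x. nsq (f x) \<partial>M) + (\<integral>\<^sup>+ x. nsq (g x) \<partial>M))"
proof -
  have "(\<integral>\<^sup>+ x. nsq (f x - g x) \<partial>M) \<le> (\<integral>\<^sup>+ x. 2 * (nsq (f x) + nsq (g x)) \<partial>M)"
    by (intro nn_integral_mono nsq_diff_le)
  then show ?thesis by (simp add: nn_integral_cmult nn_integral_add)
qed

lemma heat_measurable [measurable]:
  assumes [measurable]: "v \<in> borel_measurable borel" shows "heat e v \<in> borel_measurable borel"
  unfolding heat_def by measurable

text \<open>After the substitution \<open>z = sqrt (e k) * y\<close> the kernel is the fixed one at
  time 1 and \<open>k\<close> appears only in the size of the translation. Dominated convergence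
  then applies, as translations are continuous in mean square and \<open>T\<close> is bounded by
  four times the squared norm.\<close>

lemma heat_L2_tendsto:
  fixes v :: "'a::euclidean_space \<Rightarrow> complex"
  assumes v: "v \<in> Lp 2" and e: "\<And>k. e k > 0" "e \<longlonglongrightarrow> 0"
  shows "(\<lambda>k. NNINT x. nsq (heat (e k) v x - v x)) \<longlonglongrightarrow> 0"
proof -
  have [measurable]: "v \<in> borel_measurable borel" using v by (rule Lp_measurable)
  define T where "T z = (NNINT x. nsq (v (x - z) - v x))" for z
  have [measurable]: "T \<in> borel_measurable borel" unfolding T_def by measurable
  define N where "N = (NNINT x. nsq (v x))"
  have N: "N < \<infinity>" using v by (simp add: N_def Lp_iff)
  let ?K = "\<lambda>k y. ennreal (heat_kernel 1 y) * T (sqrt (e k) *\<^sub>R y)"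
  have TN: "T z \<le> 2 * (N + N)" for z
  proof -
    have "T z \<le> 2 * ((NNINT x. nsq (v (x - z))) + N)"
      unfolding T_def N_def by (rule nn_integral_nsq_diff_le) measurable
    then show ?thesis
      using nn_integral_lborel_minus[of "\<lambda>x. nsq (v x)" z] by (simp add: N_def)
  qed
  have le: "(NNINT x. nsq (heat (e k) v x - v x)) \<le> (NNINT y. ?K k y)" for k
  proof -
    have "(NNINT x. nsq (heat (e k) v x - v x))
      \<le> (NNINT x. NNINT z. ennreal (heat_kernel (e k) z) * nsq (v (x - z) - v x))"
      by (intro nn_integral_mono heat_diff_le v e)
    also have "\<dots> = (NNINT z. NNINT x. ennreal (heat_kernel (e k) z) * nsq (v (x - z) - v x))"
      by (rule lborel_pair.Fubini') measurable
    also have "\<dots> = (NNINT z. ennreal (heat_kernel (e k) z) * T z)"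
      by (simp add: nn_integral_cmult T_def)
    also have "\<dots> = ennreal (\<bar>sqrt (e k)\<bar> ^ DIM('a)) * (NNINT y. ennreal (heat_kernel (e k) (sqrt (e k) *\<^sub>R y)) * T (sqrt (e k) *\<^sub>R y))"
      by (rule nn_integral_lborel_scale) (use e(1)[of k] in auto)
    also have "\<dots> = (NNINT y. ennreal (\<bar>sqrt (e k)\<bar> ^ DIM('a)) * (ennreal (heat_kernel (e k) (sqrt (e k) *\<^sub>R y)) * T (sqrt (e k) *\<^sub>R y)))"
      by (rule nn_integral_cmult[symmetric]) measurable
    also have "\<dots> = (NNINT y. ?K k y)"
    proof -
      have "ennreal (\<bar>sqrt (e k)\<bar> ^ DIM('a)) * ennreal (heat_kernel (e k) (sqrt (e k) *\<^sub>R y)) = ennreal (heat_kernel 1 y)" for y :: 'a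
      proof -
        have 1: "\<bar>sqrt (e k)\<bar> ^ DIM('a) * (1 / sqrt (4 * pi * e k)) ^ DIM('a) = (1 / sqrt (4 * pi * 1)) ^ DIM('a)"
          using e(1)[of k] by (subst power_mult_distrib[symmetric]) (simp add: real_sqrt_mult)
        have 2: "- (norm (sqrt (e k) *\<^sub>R y))\<^sup>2 / (4 * e k) = - (norm y)\<^sup>2 / (4 * 1)"
          using e(1)[of k] by (simp add: power_mult_distrib)
        show ?thesis
          using e(1)[of k] unfolding heat_kernel_def 2 
          by (subst ennreal_mult[symmetric]) (simp_all only: mult.assoc[symmetric] 1, auto)
      qed
      then show ?thesis by (simp flip: mult.assoc)
    qed
    finally show ?thesis .
  qed
  have "(\<lambda>k. NNINT y. ?K k y) \<longlonglongrightarrow> (NNINT y::'a. 0)"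
  proof (rule nn_integral_dominated_convergence[where w="\<lambda>y. ennreal (heat_kernel 1 y) * (2 * (N + N))"])
    show "AE y in lborel. ?K k y \<le> ennreal (heat_kernel 1 y) * (2 * (N + N))" for k
      by (intro AE_I2 mult_left_mono TN) auto
    show "(NNINT y::'a. ennreal (heat_kernel 1 y) * (2 * (N + N))) < \<infinity>"
      using N by (subst nn_integral_multc) (auto simp: nn_integral_heat_kernel ennreal_mult_less_top)
    show "AE y in (lborel :: 'a measure). (\<lambda>k. ?K k y) \<longlonglongrightarrow> 0"
    proof (intro AE_I2)
      fix y :: 'a
      have "(\<lambda>k. sqrt (e k) *\<^sub>R y) \<longlonglongrightarrow> sqrt 0 *\<^sub>R y" by (intro tendsto_intros e)
      then have "(\<lambda>k. T (sqrt (e k) *\<^sub>R y)) \<longlonglongrightarrow> 0"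
        unfolding T_def by (intro translation_continuous_L2 v) simp
      then have "(\<lambda>k. ?K k y) \<longlonglongrightarrow> ennreal (heat_kernel 1 y) * 0"
        by (intro ennreal_tendsto_cmult) auto
      then show "(\<lambda>k. ?K k y) \<longlonglongrightarrow> 0" by simp
    qed
  qed measurable
  then have "(\<lambda>k. NNINT y. ?K k y) \<longlonglongrightarrow> 0" by simp
  then show ?thesis
    by (rule tendsto_sandwich[OF _ _ tendsto_const, rotated 2]) (auto simp: le intro!: always_eventually)
qed

lemma L2_pairing_tendsto:
  fixes d :: "nat \<Rightarrow> 'a::euclidean_space \<Rightarrow> complex"
  assumes d: "\<And>n. d n \<in> Lp 2" and w: "w \<in> Lp 2" and p: "p \<in> Lp 2"
    and lim: "(\<lambda>n. NNINT x. nsq (d n x - w x)) \<longlonglongrightarrow> 0"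
  shows "(\<lambda>n. LINT x|lborel. d n x * p x) \<longlonglongrightarrow> (LINT x|lborel. w x * p x)"
proof -
  have [measurable]: "d n \<in> borel_measurable borel" "w \<in> borel_measurable borel" "p \<in> borel_measurable borel" for n
    using d w p by (auto intro: Lp_measurable)
  define P where "P = (NNINT x. nsq (p x))"
  have P: "P < \<infinity>" using p by (simp add: P_def Lp_iff)
  have le: "nsq ((LINT x|lborel. d n x * p x) - (LINT x|lborel. w x * p x)) \<le> P * (NNINT x. nsq (d n x - w x))" for n
  proof -
    have eq: "(LINT x|lborel. d n x * p x) - (LINT x|lborel. w x * p x) = (LINT x|lborel. p x * (d n x - w x))"
      using Bochner_Integration.integral_diff[OF integrable_mult_L2[OF d[of n] p] integrable_mult_L2[OF w p]]
      by (simp only: left_diff_distrib[symmetric] mult.commute[of "p _"])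
    have "nsq ((LINT x|lborel. d n x * p x) - (LINT x|lborel. w x * p x)) = (ennreal (norm (LINT x|lborel. p x * (d n x - w x))))\<^sup>2"
      by (simp add: ennreal_power eq)
    also have "\<dots> \<le> (NNINT x. ennreal (norm (p x * (d n x - w x))))\<^sup>2"
      by (intro power_mono ennreal_norm_integral_le) auto
    also have "\<dots> = (NNINT x. ennreal (norm (p x)) * ennreal (norm (d n x - w x)))\<^sup>2"
      by (simp add: norm_mult ennreal_mult)
    also have "\<dots> \<le> (NNINT x. ennreal (norm (p x)) ^ 2) * (NNINT x. ennreal (norm (d n x - w x)) ^ 2)"
      by (rule Cauchy_Schwarz_nn_integral) measurable
    finally show ?thesis by (simp add: ennreal_power P_def)
  qed
  have "(\<lambda>n. P * (NNINT x. nsq (d n x - w x))) \<longlonglongrightarrow> P * 0"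
    using P by (intro ennreal_tendsto_cmult lim) auto
  then have "(\<lambda>n. P * (NNINT x. nsq (d n x - w x))) \<longlonglongrightarrow> 0" by simp
  then have "(\<lambda>n. nsq ((LINT x|lborel. d n x * p x) - (LINT x|lborel. w x * p x))) \<longlonglongrightarrow> ennreal 0"
    unfolding ennreal_0
    by (rule tendsto_sandwich[OF _ _ tendsto_const, rotated 2]) (auto simp: le intro!: always_eventually)
  then have "(\<lambda>n. (norm ((LINT x|lborel. d n x * p x) - (LINT x|lborel. w x * p x)))\<^sup>2) \<longlonglongrightarrow> 0"
    by (subst (asm) tendsto_ennreal_iff) auto
  from tendsto_real_sqrt[OF this] show ?thesis
    by (simp add: tendsto_norm_zero_iff LIM_zero_iff)
qed

text \<open>The multiplication formula moves the transform from the truncations of \<open>v\<close>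
  to the modulated Gaussian \<open>p\<close>, whose transform is a multiple of the heat kernel
  centred at \<open>x\<close>. On the frequency side the limit is the mean square limit defining
  \<open>V\<close>, on the other side it is dominated. This replaces the inversion theorem and holds
  at every \<open>x\<close>.\<close>

lemma heat_eq_fourier:
  fixes v V :: "'a::euclidean_space \<Rightarrow> complex"
  assumes vV: "is_L2_fourier v V" and e: "e > 0"
  shows "heat e v x = (1 / (2 * pi)) ^ DIM('a) * fourier (\<lambda>w. gauss e w * V w) (- x)"
proof -
  have v: "v \<in> Lp 2" and V: "V \<in> Lp 2"
    and lim: "(\<lambda>n. NNINT w. nsq (fourier (trunc (real n) v) w - V w)) \<longlonglongrightarrow> 0"
    using vV by (auto simp: is_L2_fourier_def)
  have [measurable]: "v \<in> borel_measurable borel" "V \<in> borel_measurable borel" using v V by (auto intro: Lp_measurable)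
  define g where "g w = gauss e w" for w :: 'a
  have [measurable]: "g \<in> borel_measurable borel" unfolding g_def by measurable
  define p where "p w = expi (w \<bullet> (- x)) * g w" for w
  have [measurable]: "p \<in> borel_measurable borel" unfolding p_def by measurable
  have ip: "integrable lborel p"
    unfolding p_def g_def by (rule integrable_gaussian_fourier[OF e])
  have "norm (p w) = norm (g w)" for w by (simp add: p_def norm_mult)
  then have p: "p \<in> Lp 2" using gaussian_L2[OF e, where 'a='a] by (simp add: Lp_def g_def)
  define K where "K y = complex_of_real ((2 * pi) ^ DIM('a) * heat_kernel e (x - y))" for y
  have [measurable]: "K \<in> borel_measurable borel" unfolding K_def by measurable
  have K: "fourier g (y - x) = K y" for y
  proof -
    have 1: "sqrt (pi / e) = 2 * pi * (1 / sqrt (4 * pi * e))"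
      using e by (simp add: real_sqrt_divide real_sqrt_mult field_simps)
    have "fourier g (y - x) = complex_of_real (sqrt (pi / e) ^ DIM('a) * exp (- (norm (y - x))\<^sup>2 / (4 * e)))"
      unfolding g_def by (rule fourier_gaussian[OF e])
    also have "sqrt (pi / e) ^ DIM('a) * exp (- (norm (y - x))\<^sup>2 / (4 * e)) = (2 * pi) ^ DIM('a) * heat_kernel e (x - y)"
      unfolding 1 heat_kernel_def power_mult_distrib by (simp add: norm_minus_commute)
    finally show ?thesis by (simp add: K_def)
  qed
  define vn where "vn n = (trunc (real n) v)" for n
  have [measurable]: "vn n \<in> borel_measurable borel" for n unfolding vn_def by (rule fourier_truncation_measurable) measurable
  have ivn: "integrable lborel (vn n)" for n unfolding vn_def by (rule integrable_truncation[OF v])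
  have mult: "(LINT w|lborel. fourier (vn n) w * p w) = (LINT y|lborel. vn n y * K y)" for n
  proof -
    have int: "integrable (lborel \<Otimes>\<^sub>M lborel) (\<lambda>(w, y). expi (y \<bullet> w) * vn n y * p w)"
    proof (rule lborel_pair.Fubini_integrable)
      show "integrable lborel (\<lambda>w. LINT y|lborel. norm (case (w, y) of (w, y) \<Rightarrow> expi (y \<bullet> w) * vn n y * p w))"
        using integrable_norm[OF ip] by (simp add: norm_mult)
      show "AE w in lborel. integrable lborel (\<lambda>y. case (w, y) of (w, y) \<Rightarrow> expi (y \<bullet> w) * vn n y * p w)"
        unfolding prod.case
        by (intro AE_I2 integrable_mult_left impI integrable_exp_mult[OF ivn]) measurable
    qed measurable
    have "(LINT w|lborel. fourier (vn n) w * p w) = (LINT w|lborel. LINT y|lborel. expi (y \<bullet> w) * vn n y * p w)"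
      by (simp add: fourier_def)
    also have "\<dots> = (LINT y|lborel. LINT w|lborel. expi (y \<bullet> w) * vn n y * p w)"
      using lborel_pair.Fubini_integral[OF int] by simp
    also have "\<dots> = (LINT y|lborel. vn n y * fourier g (y - x))"
    proof (rule Bochner_Integration.integral_cong[OF refl])
      fix y :: 'a
      have "(LINT w|lborel. expi (y \<bullet> w) * vn n y * p w)
        = (LINT w|lborel. vn n y * (expi (w \<bullet> (y - x)) * g w))"
        by (intro Bochner_Integration.integral_cong refl)
           (simp add: p_def inner_diff_right inner_commute exp_diff exp_minus algebra_simps divide_inverse)
      then show "(LINT w|lborel. expi (y \<bullet> w) * vn n y * p w) = vn n y * fourier g (y - x)"
        by (simp add: fourier_def)
    qed
    finally show ?thesis by (simp add: K)
  qed
  have L2n: "fourier (vn n) \<in> Lp 2" for n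
  proof -
    have "(NNINT w. nsq (fourier (vn n) w)) \<le> ennreal ((2 * pi) ^ DIM('a)) * (NNINT x. nsq (vn n x))"
      by (rule plancherel_le[OF ivn])
    also have "\<dots> \<le> ennreal ((2 * pi) ^ DIM('a)) * (NNINT x. nsq (v x))"
      by (intro mult_left_mono nn_integral_mono) (auto simp: vn_def split: split_indicator)
    also have "\<dots> < \<infinity>" using v by (simp add: Lp_iff ennreal_mult_less_top)
    finally show ?thesis by (simp add: Lp_iff)
  qed
  have "(\<lambda>n. LINT w|lborel. fourier (vn n) w * p w) \<longlonglongrightarrow> (LINT w|lborel. V w * p w)"
    using lim unfolding vn_def[symmetric] by (intro L2_pairing_tendsto L2n V p)
  moreover have "(\<lambda>n. LINT y|lborel. vn n y * K y) \<longlonglongrightarrow> (LINT y|lborel. v y * K y)"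
  proof (rule integral_dominated_convergence[where w="\<lambda>y. norm (v y * K y)"])
    have "integrable lborel (\<lambda>y. (2 * pi) ^ DIM('a) * (v y * complex_of_real (heat_kernel e (x - y))))"
      by (intro integrable_mult_right integrable_mult_L2 v heat_kernel_L2 e)
    then show "integrable lborel (\<lambda>y. norm (v y * K y))"
      by (intro integrable_norm) (simp add: K_def mult_ac)
    show "AE y in lborel. (\<lambda>n. vn n y * K y) \<longlonglongrightarrow> v y * K y"
    proof (intro AE_I2)
      fix y :: 'a
      obtain N :: nat where N: "norm y \<le> real N" using real_arch_simple by blast
      have "eventually (\<lambda>n. vn n y * K y = v y * K y) sequentially"
        using eventually_ge_at_top[of N] by eventually_elim (use N in \<open>auto simp: vn_def\<close>)
      then show "(\<lambda>n. vn n y * K y) \<longlonglongrightarrow> v y * K y" by (rule tendsto_eventually)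
    qed
  qed (auto simp: vn_def norm_mult split: split_indicator)
  ultimately have "(LINT w|lborel. V w * p w) = (LINT y|lborel. v y * K y)"
    unfolding mult by (rule LIMSEQ_unique)
  moreover have "(LINT w|lborel. V w * p w) = fourier (\<lambda>w. gauss e w * V w) (- x)"
    unfolding fourier_def p_def g_def by (simp add: mult_ac)
  moreover have "(LINT y|lborel. v y * K y) = (2 * pi) ^ DIM('a) * heat e v x"
    unfolding heat_def integral_mult_right_zero[symmetric] by (simp add: K_def mult_ac)
  ultimately show ?thesis by (simp add: field_simps)
qed

subsection \<open>Push-forward under sum and energy\<close>

lemma nn_integral_lborel_vec2:
  fixes g :: "plane \<Rightarrow> ennreal"
  assumes [measurable]: "g \<in> borel_measurable borel"
  shows "(NNINT w. g w) = (NNINT x. NNINT y. g (vector [x, y]))"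
proof -
  let ?v = "\<lambda>z::real \<times> real. vector [fst z, snd z] :: plane"
  have m: "(?v) \<in> borel_measurable borel"
  proof (rule borel_measurable_continuous_onI)
    show "continuous_on UNIV (?v)"
    proof (subst continuous_on_componentwise, intro ballI)
      fix i :: "plane" assume "i \<in> Basis"
      then have "i = axis 1 1 \<or> i = axis 2 1" by (auto simp: Basis_vec_def UNIV_2)
      then show "continuous_on UNIV (\<lambda>z::real \<times> real. (vector [fst z, snd z] :: plane) \<bullet> i)"
        by (elim disjE) (simp_all add: inner_axis vector_2 continuous_on_fst continuous_on_snd continuous_on_id)
    qed
  qed
  have m': "(?v) \<in> lborel \<rightarrow>\<^sub>M borel"
    using m by simp
  have "lborel = distr lborel borel (?v)"
  proof (rule lborel_eqI)
    fix l u :: "plane" assume le: "\<And>b. b \<in> Basis \<Longrightarrow> l \<bullet> b \<le> u \<bullet> b"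
    have le': "l $ 1 \<le> u $ 1" "l $ 2 \<le> u $ 2"
      using le[of "axis 1 1"] le[of "axis 2 1"] by (auto simp: inner_axis Basis_vec_def)
    have vim: "(?v) -` box l u = box (l $ 1, l $ 2) (u $ 1, u $ 2)"
      by (auto simp: mem_box_cart forall_2 vector_2 box_prod)
    have ne: "axis 1 (1::real) \<noteq> (axis 2 1 :: plane)" by (simp add: axis_eq_axis)
    have "(\<Prod>b\<in>Basis. (u - l) \<bullet> b) = (u $ 1 - l $ 1) * (u $ 2 - l $ 2)"
      using ne by (simp add: Basis_vec_def UNIV_2 inner_axis)
    moreover have "emeasure lborel (box (l $ 1, l $ 2) (u $ 1, u $ 2)) = ennreal ((u $ 1 - l $ 1) * (u $ 2 - l $ 2))"
      using le' by (simp add: box_prod box_real lborel_prod[symmetric] lborel.emeasure_pair_measure_Times ennreal_mult)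
    ultimately show "emeasure (distr lborel borel (?v)) (box l u) = ennreal (\<Prod>b\<in>Basis. (u - l) \<bullet> b)"
      using m by (simp add: emeasure_distr vim)
  qed simp
  then have "(NNINT w. g w) = (\<integral>\<^sup>+ w. g w \<partial>distr lborel borel (\<lambda>z::real \<times> real. vector [fst z, snd z]))" by simp
  also have "\<dots> = (NNINT z::(real \<times> real). g (vector [fst z, snd z]))"
    by (rule nn_integral_distr[OF m']) measurable
  also have "\<dots> = (NNINT x. NNINT y. g (vector [x, y]))"
    using measurable_compose[OF m' assms]
    by (subst lborel_prod[symmetric], subst lborel.nn_integral_fst[symmetric]) (simp_all add: lborel_prod)
  finally show ?thesis .
qed

lemma measure_eqI_atMost:
  fixes M N :: "real measure"
  assumes sets: "sets M = sets borel" "sets N = sets borel"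
    and eq: "\<And>b. emeasure M {..b} = emeasure N {..b}" and fin: "\<And>b. emeasure M {..b} < \<infinity>"
  shows "M = N"
proof (rule measure_eqI_generator_eq[where E="range atMost" and A="\<lambda>i::nat. {..real i}" and \<Omega>=UNIV])
  show "Int_stable (range atMost :: real set set)"
    by (auto simp: Int_stable_def Int_atMost)
  show "sets M = sigma_sets UNIV (range atMost)" "sets N = sigma_sets UNIV (range atMost)"
    unfolding sets by (simp_all add: borel_eq_atMost)
  show "(\<Union>i::nat. {..real i}) = UNIV" using real_arch_simple by auto
  show "emeasure M {..real i} \<noteq> \<infinity>" for i using fin[of "real i"] by auto
qed (auto simp: eq)

text \<open>A measure on the line with finite distribution function is determined by it, so matching
  the measures of the sublevel sets identifies \<open>k\<close> as the density of
  \<open>f\<close>.\<close>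

lemma nn_integral_sublevels:
  fixes f :: "'a::euclidean_space \<Rightarrow> real"
  assumes [measurable]: "f \<in> borel_measurable borel" "k \<in> borel_measurable borel" "G \<in> borel_measurable borel"
    and f: "\<And>b. emeasure lborel {x. f x \<le> b} = ennreal (c b)"
    and k: "\<And>b. (NNINT s. k s * indicator {..b} s) = ennreal (c b)"
  shows "(NNINT x. G (f x)) = (NNINT s. k s * G s)"
proof -
  have "f -` {..b} = {x. f x \<le> b}" for b by auto
  then have eq: "distr lborel borel f = density lborel k"
    by (intro measure_eqI_atMost) (simp_all add: emeasure_distr emeasure_density f k)
  have "(NNINT x. G (f x)) = (\<integral>\<^sup>+ s. G s \<partial>distr lborel borel f)" by (simp add: nn_integral_distr)
  also have "\<dots> = (NNINT s. k s * G s)" unfolding eq by (rule nn_integral_density) measurable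
  finally show ?thesis .
qed

text \<open>The density \<open>1 / sqrt s\<close> collects \<open>1 / (2 * sqrt s)\<close> from each
  of the two square roots of \<open>s\<close>.\<close>

lemma nn_integral_sq:
  fixes G :: "real \<Rightarrow> ennreal"
  assumes [measurable]: "G \<in> borel_measurable borel"
  shows "(NNINT y. G (y\<^sup>2)) = (NNINT s. ennreal (if s > 0 then 1 / sqrt s else 0) * G s)"
proof (rule nn_integral_sublevels)
  fix b :: real
  let ?k = "\<lambda>s::real. if s > 0 then 1 / sqrt s else 0"
  have iff: "y\<^sup>2 \<le> b \<longleftrightarrow> \<bar>y\<bar> \<le> sqrt b" for y using real_sqrt_le_iff[of "y\<^sup>2" b] by simp
  show "emeasure lborel {y. y\<^sup>2 \<le> b} = ennreal (2 * sqrt b)"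
  proof (cases "b \<ge> 0")
    case True
    have "{y. y\<^sup>2 \<le> b} = {- sqrt b .. sqrt b}" unfolding iff by auto
    then show ?thesis using True by simp
  next
    case False
    then have "{y. y\<^sup>2 \<le> b} = {}" using order_trans[OF zero_le_power2] by auto
    then show ?thesis using False by (simp add: ennreal_neg)
  qed
  show "(NNINT s. ennreal (?k s) * indicator {..b} s) = ennreal (2 * sqrt b)"
  proof (cases "b \<ge> 0")
    case True
    have "(NNINT s. ennreal (?k s) * indicator {..b} s) = (NNINT s. ennreal (?k s * indicator {0\<^sup>2..(sqrt b)\<^sup>2} s))"
      using True by (intro nn_integral_cong) (auto split: split_indicator)
    also have "\<dots> = (NNINT y. ennreal (?k (y\<^sup>2) * (2 * y) * indicator {0..sqrt b} y))"
      using True by (intro nn_integral_substitution)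
        (auto intro!: derivative_eq_intros continuous_intros simp: set_borel_measurable_def)
    also have "\<dots> = (NNINT y. ennreal 2 * indicator {0<..sqrt b} y)"
      by (intro nn_integral_cong) (auto split: split_indicator)
    also have "\<dots> = ennreal (2 * sqrt b)"
      using True by (subst nn_integral_cmult) (auto simp: ennreal_mult)
    finally show ?thesis .
  next
    case False
    then have "(NNINT s. ennreal (?k s) * indicator {..b} s) = (NNINT s::real. 0)"
      by (intro nn_integral_cong) (auto split: split_indicator)
    then show ?thesis using False by (simp add: ennreal_neg)
  qed
qed measurable

text \<open>The area of a disc is \<open>pi\<close> times its squared radius. A constant density of
  the squared norm is peculiar to dimension two.\<close>

lemma nn_integral_norm_sq:
  fixes G :: "real \<Rightarrow> ennreal"
  assumes [measurable]: "G \<in> borel_measurable borel"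
  shows "(NNINT w::plane. G ((norm w)\<^sup>2)) = ennreal pi * (NNINT s. indicator {0<..} s * G s)"
proof -
  have "(NNINT w::plane. G ((norm w)\<^sup>2)) = (NNINT s. ennreal pi * indicator {0<..} s * G s)"
  proof (rule nn_integral_sublevels)
    fix b :: real
    have iff: "(norm w)\<^sup>2 \<le> b \<longleftrightarrow> norm w \<le> sqrt b" for w :: plane
      using real_sqrt_le_iff[of "(norm w)\<^sup>2" b] by simp
    show "emeasure lborel {w::plane. (norm w)\<^sup>2 \<le> b} = ennreal (pi * b)"
    proof (cases "b \<ge> 0")
      case True
      have "{w::plane. (norm w)\<^sup>2 \<le> b} = cball 0 (sqrt b)" unfolding iff by auto
      then show ?thesis using True by (simp add: emeasure_cball unit_ball_vol_2)
    next
      case False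
      then have "{w::plane. (norm w)\<^sup>2 \<le> b} = {}" using order_trans[OF zero_le_power2] by auto
      then show ?thesis using False by (simp add: ennreal_neg mult_nonneg_nonpos)
    qed
    have "(NNINT s. ennreal pi * indicator {0<..} s * indicator {..b} s) = (NNINT s. ennreal pi * indicator {0<..b} s)"
      by (intro nn_integral_cong) (auto split: split_indicator)
    also have "\<dots> = ennreal (pi * b)"
      by (cases "b \<ge> 0") (auto simp: nn_integral_cmult ennreal_mult ennreal_neg mult_le_0_iff)
    finally show "(NNINT s. ennreal pi * indicator {0<..} s * indicator {..b} s) = ennreal (pi * b)" .
  qed measurable
  then show ?thesis by (simp add: nn_integral_cmult mult.assoc)
qed

text \<open>Sixteen times the squared area of a triangle with squared sides \<open>A\<close>, \<open>p\<close> and \<open>T - p\<close>.\<close>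

definition heron :: "real \<Rightarrow> real \<Rightarrow> real \<Rightarrow> real" where
  "heron A T p = 2 * A * T - A\<^sup>2 - (2 * p - T)\<^sup>2"

text \<open>Up to the factor \<open>pi / 2\<close>, for \<open>0 < A < 2 * T\<close>, this is the
  arcsine law on \<open>|2 * p - T| < sqrt (2 * A * T - A^2)\<close>. It arises because the fibre is
  a circle on which \<open>p\<close> is an affine function of one coordinate.\<close>

definition kappa :: "real \<Rightarrow> real \<Rightarrow> real \<Rightarrow> real" where
  "kappa A T p = (if heron A T p > 0 then 1 / sqrt (heron A T p) else 0)"

lemma kappa_nonneg: "kappa A T p \<ge> 0" by (simp add: kappa_def)

lemma kappa_measurable [measurable (raw)]:
  assumes [measurable]: "f \<in> borel_measurable M" "g \<in> borel_measurable M" "h \<in> borel_measurable M"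
  shows "(\<lambda>x. kappa (f x) (g x) (h x)) \<in> borel_measurable M"
  unfolding kappa_def heron_def by measurable

text \<open>After rotating \<open>a\<close> to \<open>(c, 0)\<close>, the coordinate
  \<open>y\<close> of \<open>w = (x, y)\<close> occurs only as \<open>y^2\<close>. Then
  \<open>p = x^2 + y^2\<close> has density \<open>1 / sqrt (p - x^2)\<close> for fixed
  \<open>x\<close>, and for fixed \<open>p\<close> the other squared side
  \<open>q = c^2 - 2 * c * x + p\<close> is affine in \<open>x\<close>. The product of the two
  densities is \<open>kappa\<close>, because \<open>4 * c^2 * (p - x^2)\<close> is Heron's
  expression.\<close>

lemma nn_integral_triangle:
  fixes a :: "plane" and J :: "real \<Rightarrow> real \<Rightarrow> ennreal"
  assumes [measurable]: "case_prod J \<in> borel_measurable borel" and a: "a \<noteq> 0"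
  shows "(NNINT w. J ((norm w)\<^sup>2) ((norm (a - w))\<^sup>2))
    = (NNINT p. NNINT q. ennreal (kappa ((norm a)\<^sup>2) (p + q) p) * J p q)"
proof -
  have Jm [measurable (raw)]: "(\<lambda>x. J (f x) (g x)) \<in> borel_measurable M"
    if [measurable]: "f \<in> borel_measurable M" "g \<in> borel_measurable M" for f g and M :: "'b measure"
    using measurable_compose[of "\<lambda>x. (f x, g x)" M borel "case_prod J" borel] assms(1) by simp
  define c where "c = norm a"
  have c: "c > 0" using a by (simp add: c_def)
  let ?y = "\<lambda>p q. ((c\<^sup>2 + p) / (2 * c) + (- 1 / (2 * c)) * q)"
  let ?w = "\<lambda>x p. ennreal (if p - x\<^sup>2 > 0 then 1 / sqrt (p - x\<^sup>2) else 0) * J p (c\<^sup>2 - 2 * c * x + p)"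
  define a0 :: "plane" where "a0 = vector [c, 0]"
  have nv: "(norm (vector [x, y] :: plane))\<^sup>2 = x\<^sup>2 + y\<^sup>2" for x y
    unfolding power2_norm_eq_inner by (simp add: inner_vec_def sum_2 vector_2 power2_eq_square)
  have "(norm a0)\<^sup>2 = c\<^sup>2" by (simp add: a0_def nv)
  then have "norm a0 = norm a" using c by (simp add: c_def)
  then obtain T where T: "orthogonal_transformation T" "T a0 = a"
    using ex_orthogonal_transformation_swap by blast
  have lin: "linear T" using T(1) by (rule orthogonal_transformation_linear)
  have [measurable]: "T \<in> borel_measurable borel"
    using T(1) by (rule orthogonal_transformation_measurable)
  have "(NNINT w. J ((norm w)\<^sup>2) ((norm (a - w))\<^sup>2)) = (\<integral>\<^sup>+ w. J ((norm w)\<^sup>2) ((norm (a - w))\<^sup>2) \<partial>distr lborel borel T)"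
    by (simp only: lborel_distr_orthogonal[OF T(1)])
  also have "\<dots> = (NNINT w. J ((norm (T w))\<^sup>2) ((norm (T a0 - T w))\<^sup>2))"
    by (subst nn_integral_distr) (simp_all add: T(2))
  also have "\<dots> = (NNINT w. J ((norm w)\<^sup>2) ((norm (a0 - w))\<^sup>2))"
    by (simp add: orthogonal_transformation_norm[OF T(1)] flip: linear_diff[OF lin])
  also have "\<dots> = (NNINT x. NNINT y. J ((norm (vector [x, y] :: plane))\<^sup>2) ((norm (a0 - vector [x, y]))\<^sup>2))"
    by (rule nn_integral_lborel_vec2) measurable
  also have "\<dots> = (NNINT x. NNINT y. J (x\<^sup>2 + y\<^sup>2) ((c - x)\<^sup>2 + y\<^sup>2))"
  proof -
    have "a0 - vector [x, y] = vector [c - x, - y]" for x y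
      by (simp add: a0_def vec_eq_iff forall_2 vector_2)
    then show ?thesis by (simp add: nv)
  qed
  also have "\<dots> = (NNINT x. NNINT s. ennreal (if s > 0 then 1 / sqrt s else 0) * J (x\<^sup>2 + s) ((c - x)\<^sup>2 + s))"
    by (intro nn_integral_cong nn_integral_sq) measurable
  also have "\<dots> = (NNINT x. NNINT p. ?w x p)"
  proof (rule nn_integral_cong)
    fix x :: real
    have *: "(c - x)\<^sup>2 + s = c\<^sup>2 - 2 * c * x + (x\<^sup>2 + s)" for s by (simp add: power2_diff)
    have "(NNINT s. ennreal (if x\<^sup>2 + s - x\<^sup>2 > 0 then 1 / sqrt (x\<^sup>2 + s - x\<^sup>2) else 0) * J (x\<^sup>2 + s) (c\<^sup>2 - 2 * c * x + (x\<^sup>2 + s)))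
      = (NNINT p. ?w x p)"
      by (rule nn_integral_lborel_plus) measurable
    then show "(NNINT s. ennreal (if s > 0 then 1 / sqrt s else 0) * J (x\<^sup>2 + s) ((c - x)\<^sup>2 + s))
      = (NNINT p. ?w x p)"
      by (simp only: * add_diff_cancel_left')
  qed
  also have "\<dots> = (NNINT p. NNINT x. ?w x p)"
    by (rule lborel_pair.Fubini') measurable
  also have "\<dots> = (NNINT p. NNINT q. ennreal (kappa (c\<^sup>2) (p + q) p) * J p q)"
  proof (rule nn_integral_cong)
    fix p :: real
    have "(NNINT x. ?w x p)
      = ennreal \<bar>- 1 / (2 * c)\<bar> * (NNINT q. ?w (?y p q) p)"
      by (rule nn_integral_real_affine) (use c in \<open>auto\<close>)
    also have "\<dots> = (NNINT q. ennreal \<bar>- 1 / (2 * c)\<bar> * (?w (?y p q) p))"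
      by (rule nn_integral_cmult[symmetric]) measurable
    also have "\<dots> = (NNINT q. ennreal (kappa (c\<^sup>2) (p + q) p) * J p q)"
    proof (intro nn_integral_cong)
      fix q :: real
      define x where "x = (c\<^sup>2 + p) / (2 * c) + (- 1 / (2 * c)) * q"
      have x: "2 * c * x = c\<^sup>2 + p - q" using c by (simp add: x_def field_simps)
      have "4 * c\<^sup>2 * (p - x\<^sup>2) = 4 * c\<^sup>2 * p - (2 * c * x)\<^sup>2" by (simp add: power2_eq_square algebra_simps)
      also have "\<dots> = heron (c\<^sup>2) (p + q) p" unfolding x heron_def by (simp add: power2_eq_square algebra_simps)
      finally have h: "heron (c\<^sup>2) (p + q) p = (2 * c)\<^sup>2 * (p - x\<^sup>2)" by (simp add: power_mult_distrib)
      have pos: "heron (c\<^sup>2) (p + q) p > 0 \<longleftrightarrow> p - x\<^sup>2 > 0" unfolding h using c by (simp add: zero_less_mult_iff)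
      have "1 / (2 * c) * (1 / sqrt (p - x\<^sup>2)) = 1 / sqrt (heron (c\<^sup>2) (p + q) p)"
      proof -
        have "sqrt ((2 * c)\<^sup>2) = 2 * c" using c by (simp only: real_sqrt_abs abs_of_pos)
        then show ?thesis unfolding h real_sqrt_mult by simp
      qed
      then have "\<bar>- 1 / (2 * c)\<bar> * (if p - x\<^sup>2 > 0 then 1 / sqrt (p - x\<^sup>2) else 0) = kappa (c\<^sup>2) (p + q) p"
        using c pos by (auto simp: kappa_def mult_ac)
      moreover have "c\<^sup>2 - 2 * c * x + p = q" unfolding x by simp
      ultimately show "ennreal \<bar>- 1 / (2 * c)\<bar> * (?w (?y p q) p) = ennreal (kappa (c\<^sup>2) (p + q) p) * J p q"
        unfolding x_def[symmetric] mult.assoc[symmetric] by (subst ennreal_mult[symmetric]) auto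
    qed
    finally show "(NNINT x. ?w x p) = (NNINT q. ennreal (kappa (c\<^sup>2) (p + q) p) * J p q)" .
  qed
  finally show ?thesis by (simp add: c_def)
qed

text \<open>With \<open>p = (T + d * sin t) / 2\<close> the root of Heron's expression becomes
  \<open>d * cos t\<close> and cancels against the derivative, leaving the constant 1/2 on an
  interval of length \<open>pi\<close>.\<close>

lemma nn_integral_kappa_le: "(NNINT p. ennreal (kappa A T p)) \<le> ennreal (pi / 2)"
proof (cases "2 * A * T - A\<^sup>2 > 0")
  case False
  have "kappa A T p = 0" for p
  proof -
    have "heron A T p \<le> 0" using False zero_le_power2[of "2 * p - T"] unfolding heron_def by linarith
    then show ?thesis by (simp add: kappa_def)
  qed
  then show ?thesis by simp
next
  case True
  define d where "d = sqrt (2 * A * T - A\<^sup>2)"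
  have d: "d > 0" "d\<^sup>2 = 2 * A * T - A\<^sup>2" using True by (auto simp: d_def)
  define g where "g t = (T + d * sin t) / 2" for t
  have "(NNINT p. ennreal (kappa A T p)) = (NNINT p. ennreal (kappa A T p * indicator {g (- pi / 2)..g (pi / 2)} p))"
  proof (intro nn_integral_cong)
    fix p
    have "p \<in> {g (- pi / 2)..g (pi / 2)}" if "heron A T p > 0"
    proof -
      have "(2 * p - T)\<^sup>2 < d\<^sup>2" using that by (simp add: heron_def d)
      then have "\<bar>2 * p - T\<bar> < d" using d(1) by (metis abs_of_pos abs_le_square_iff not_le)
      then show ?thesis by (auto simp: g_def)
    qed
    then show "ennreal (kappa A T p) = ennreal (kappa A T p * indicator {g (- pi / 2)..g (pi / 2)} p)"
      by (auto simp: kappa_def split: split_indicator)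
  qed
  also have "\<dots> = (NNINT t. ennreal (kappa A T (g t) * (d * cos t / 2) * indicator {- pi / 2..pi / 2} t))"
    using d(1) by (intro nn_integral_substitution)
      (auto intro!: derivative_eq_intros continuous_intros mult_nonneg_nonneg cos_ge_zero simp: g_def set_borel_measurable_def)
  also have "\<dots> \<le> (NNINT t. ennreal (1 / 2) * indicator {- pi / 2..pi / 2} t)"
  proof (intro nn_integral_mono)
    fix t
    have h: "heron A T (g t) = (d * cos t)\<^sup>2"
    proof -
      have "2 * g t - T = d * sin t" by (simp add: g_def field_simps)
      then show ?thesis
        unfolding heron_def d(2)[symmetric] by (simp add: power_mult_distrib cos_squared_eq algebra_simps)
    qed
    have "kappa A T (g t) * (d * cos t / 2) \<le> 1 / 2" if "t \<in> {- pi / 2..pi / 2}"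
    proof -
      have "cos t \<ge> 0" using that by (intro cos_ge_zero) auto
      then have "sqrt (heron A T (g t)) = d * cos t" using d(1) unfolding h by simp
      then show ?thesis by (simp add: kappa_def)
    qed
    then show "ennreal (kappa A T (g t) * (d * cos t / 2) * indicator {- pi / 2..pi / 2} t) \<le> ennreal (1 / 2) * indicator {- pi / 2..pi / 2} t"
      by (auto intro!: ennreal_leI split: split_indicator simp del: ennreal_half)
  qed
  also have "\<dots> = ennreal (1 / 2) * ennreal pi"
    by (subst nn_integral_cmult) auto
  also have "\<dots> = ennreal (pi / 2)"
    by (subst ennreal_mult[symmetric]) auto
  finally show ?thesis .
qed

lemma nn_integral_lborel_pair:
  fixes f :: "'a::euclidean_space \<times> 'b::euclidean_space \<Rightarrow> ennreal"
  assumes [measurable]: "f \<in> borel_measurable borel"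
  shows "(NNINT z. f z) = (NNINT x. NNINT y. f (x, y))"
  by (subst lborel_prod[symmetric], subst lborel.nn_integral_fst[symmetric]) (simp_all add: lborel_prod)

text \<open>The last entry is the coordinate along the fibre of sum and energy. With it, source and
  target both have dimension four, so the image of Lebesgue measure has a density. Reflecting
  \<open>fst z\<close> in the line of the sum gives the second preimage.\<close>

definition sum_coords :: "plane \<times> plane \<Rightarrow> (plane \<times> real) \<times> real" where
  "sum_coords z = ((fst z + snd z, (norm z)\<^sup>2), (norm (fst z))\<^sup>2)"

abbreviation fiber_weight :: "(plane \<times> real) \<times> real \<Rightarrow> real" where
  "fiber_weight w \<equiv> kappa ((norm (fst (fst w)))\<^sup>2) (snd (fst w)) (snd w)"

lemma norm_prod_sq: "(norm z)\<^sup>2 = (norm (fst z))\<^sup>2 + (norm (snd z))\<^sup>2"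
  by (cases z) (simp add: norm_Pair)

lemma sum_coords_measurable [measurable]: "sum_coords \<in> borel_measurable borel"
  unfolding sum_coords_def by measurable

lemma nn_integral_sum_coords:
  fixes g :: "(plane \<times> real) \<times> real \<Rightarrow> ennreal"
  assumes [measurable]: "g \<in> borel_measurable borel"
  shows "(NNINT z. g (sum_coords z))
    = (NNINT w. ennreal (fiber_weight w) * g w)"
proof -
  let ?g = "\<lambda>x a. g ((a, (norm x)\<^sup>2 + (norm (a - x))\<^sup>2), (norm x)\<^sup>2)"
  let ?k = "\<lambda>a T p. ennreal (kappa ((norm a)\<^sup>2) T p) * g ((a, T), p)"
  have "(NNINT z. g (sum_coords z))
    = (NNINT x. NNINT y. g ((x + y, (norm x)\<^sup>2 + (norm y)\<^sup>2), (norm x)\<^sup>2))"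
    by (subst nn_integral_lborel_pair) (simp_all add: sum_coords_def norm_prod_sq)
  also have "\<dots> = (NNINT x. NNINT a. ?g x a)"
  proof (rule nn_integral_cong)
    fix x :: "plane"
    show "(NNINT y. g ((x + y, (norm x)\<^sup>2 + (norm y)\<^sup>2), (norm x)\<^sup>2)) = (NNINT a. ?g x a)"
      using nn_integral_lborel_minus[of "\<lambda>y. g ((x + y, (norm x)\<^sup>2 + (norm y)\<^sup>2), (norm x)\<^sup>2)" x] by simp
  qed
  also have "\<dots> = (NNINT a. NNINT x. ?g x a)"
    by (rule lborel_pair.Fubini') measurable
  also have "\<dots> = (NNINT a. NNINT T. NNINT p. ?k a T p)"
  proof (rule nn_integral_cong_AE)
    have "AE a in lborel. a \<noteq> (0 :: plane)" by (rule AE_lborel_singleton)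
    then show "AE a in lborel. (NNINT x. ?g x a)
      = (NNINT T. NNINT p. ?k a T p)"
    proof eventually_elim
      case (elim a)
      have "(NNINT x. ?g x a)
        = (NNINT p. NNINT q. ennreal (kappa ((norm a)\<^sup>2) (p + q) p) * g ((a, p + q), p))"
        by (rule nn_integral_triangle[OF _ elim, where J="\<lambda>p q. g ((a, p + q), p)"]) measurable
      also have "\<dots> = (NNINT p. NNINT T. ?k a T p)"
      proof (rule nn_integral_cong)
        fix p :: real
        show "(NNINT q. ennreal (kappa ((norm a)\<^sup>2) (p + q) p) * g ((a, p + q), p)) = (NNINT T. ?k a T p)"
          by (rule nn_integral_lborel_plus[of "\<lambda>T. ?k a T p" p]) measurable
      qed
      also have "\<dots> = (NNINT T. NNINT p. ?k a T p)"
        by (rule lborel_pair.Fubini') measurable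
      finally show ?case .
    qed
  qed
  also have "\<dots> = (NNINT w. ennreal (fiber_weight w) * g w)"
  proof -
    define F where "F w = ennreal (fiber_weight w) * g w" for w :: "(plane \<times> real) \<times> real"
    have [measurable]: "F \<in> borel_measurable borel" unfolding F_def by measurable
    have "(NNINT w. F w) = (NNINT x. NNINT p. F (x, p))"
      by (rule nn_integral_lborel_pair) simp
    also have "\<dots> = (NNINT a. NNINT T. NNINT p. F ((a, T), p))"
      by (rule nn_integral_lborel_pair) simp
    finally show ?thesis by (simp add: F_def)
  qed
  finally show ?thesis .
qed

text \<open>As an identity of measures the change of variables also serves the Bochner integrals of
  complex functions in \<open>evolution_square\<close>.\<close>

lemma distr_sum_coords:
  "distr lborel borel sum_coords = density lborel (\<lambda>w. ennreal (fiber_weight w))"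
proof (rule measure_eqI)
  fix X assume "X \<in> sets (distr lborel borel sum_coords)"
  then have [measurable]: "X \<in> sets borel" by simp
  have "emeasure (distr lborel borel sum_coords) X = (\<integral>\<^sup>+ w. indicator X w \<partial>distr lborel borel sum_coords)" by simp
  also have "\<dots> = (NNINT z. indicator X (sum_coords z))"
    by (rule nn_integral_distr) simp_all
  also have "\<dots> = (NNINT w. ennreal (fiber_weight w) * indicator X w)"
    by (rule nn_integral_sum_coords) simp
  also have "\<dots> = emeasure (density lborel (\<lambda>w. ennreal (fiber_weight w))) X"
    by (rule emeasure_density[symmetric]) simp_all
  finally show "emeasure (distr lborel borel sum_coords) X = emeasure (density lborel (\<lambda>w. ennreal (fiber_weight w))) X" .
qed simp

text \<open>Each plane contributes \<open>pi\<close> through its squared norm; the two squared norms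
  are then replaced by the first one and their sum \<open>T\<close>.\<close>

lemma nn_integral_norm_coords:
  fixes g :: "real \<Rightarrow> real \<Rightarrow> ennreal"
  assumes [measurable]: "case_prod g \<in> borel_measurable borel"
  shows "(NNINT z::plane \<times> plane. g ((norm z)\<^sup>2) ((norm (fst z))\<^sup>2))
    = ennreal (pi\<^sup>2) * (NNINT T. NNINT p. indicator {0<..<T} p * g T p)"
proof -
  have gm [measurable (raw)]: "(\<lambda>x. g (f x) (h x)) \<in> borel_measurable M"
    if [measurable]: "f \<in> borel_measurable M" "h \<in> borel_measurable M" for f h and M :: "'b measure"
    using measurable_compose[of "\<lambda>x. (f x, h x)" M borel "case_prod g" borel] assms by simp
  have ind [measurable]: "Measurable.pred (borel :: (real \<times> real) measure) (\<lambda>x. snd x \<in> {0<..<fst x})"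
    by simp
  have "(NNINT z::plane \<times> plane. g ((norm z)\<^sup>2) ((norm (fst z))\<^sup>2))
    = (NNINT x::plane. NNINT y::plane. g ((norm x)\<^sup>2 + (norm y)\<^sup>2) ((norm x)\<^sup>2))"
    by (subst nn_integral_lborel_pair) (measurable, simp add: norm_prod_sq)
  also have "\<dots> = (NNINT x::plane. ennreal pi * (NNINT q. indicator {0<..} q * g ((norm x)\<^sup>2 + q) ((norm x)\<^sup>2)))"
    by (rule nn_integral_cong, rule nn_integral_norm_sq) measurable
  also have "\<dots> = ennreal pi * (NNINT p. indicator {0<..} p * (ennreal pi * (NNINT q. indicator {0<..} q * g (p + q) p)))"
    by (rule nn_integral_norm_sq[where G="\<lambda>p. ennreal pi * (NNINT q. indicator {0<..} q * g (p + q) p)"]) measurable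
  also have "\<dots> = ennreal pi * (ennreal pi * (NNINT p. indicator {0<..} p * (NNINT q. indicator {0<..} q * g (p + q) p)))"
    by (subst nn_integral_cmult[symmetric]) (simp_all add: mult_ac)
  also have "\<dots> = ennreal (pi\<^sup>2) * (NNINT p. NNINT q. indicator {0<..} p * (indicator {0<..} q * g (p + q) p))"
    by (simp add: power2_eq_square ennreal_mult mult.assoc nn_integral_cmult)
  also have "(NNINT p. NNINT q. indicator {0<..} p * (indicator {0<..} q * g (p + q) p))
    = (NNINT p. NNINT T. indicator {0<..<T} p * g T p)"
  proof (rule nn_integral_cong)
    fix p :: real
    have m: "(\<lambda>T. g T p) \<in> borel_measurable borel" by (rule gm) simp_all
    have "(\<lambda>T. indicator {p<..} T * (indicator {0<..} p * g T p)) \<in> borel_measurable borel"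
      by (intro borel_measurable_times_ennreal borel_measurable_indicator borel_measurable_const m) simp
    moreover have "indicator {p<..} T * (indicator {0<..} p * g T p) = indicator {0<..<T} p * g T p" for T
      by (auto split: split_indicator)
    ultimately have m': "(\<lambda>T. indicator {0<..<T} p * g T p) \<in> borel_measurable borel" by simp
    have "(NNINT q. indicator {0<..<p + q} p * g (p + q) p) = (NNINT T. indicator {0<..<T} p * g T p)"
      by (rule nn_integral_lborel_plus[of "\<lambda>T. indicator {0<..<T} p * g T p" p]) (rule m')
    moreover have "indicator {0<..} p * (indicator {0<..} q * g (p + q) p) = indicator {0<..<p + q} p * g (p + q) p" for q
      by (auto split: split_indicator)
    ultimately show "(NNINT q. indicator {0<..} p * (indicator {0<..} q * g (p + q) p)) = (NNINT T. indicator {0<..<T} p * g T p)"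
      by simp
  qed
  also have "\<dots> = (NNINT T. NNINT p. indicator {0<..<T} p * g T p)"
  proof (rule lborel_pair.Fubini')
    have "{z :: real \<times> real. 0 < snd z \<and> snd z < fst z} \<in> sets borel" by measurable
    then have "(\<lambda>z. indicator {z. 0 < snd z \<and> snd z < fst z} z * case_prod g z) \<in> borel_measurable borel"
      by (intro borel_measurable_times_ennreal borel_measurable_indicator assms)
    also have "(\<lambda>z. indicator {z. 0 < snd z \<and> snd z < fst z} z * case_prod g z) = (\<lambda>(T, p). indicator {0<..<T} p * g T p)"
      by (auto simp: fun_eq_iff split: split_indicator)
    finally show "(\<lambda>(T, p). indicator {0<..<T} p * g T p) \<in> borel_measurable (lborel \<Otimes>\<^sub>M lborel)"
      by (simp add: lborel_prod)
  qed
  finally show ?thesis .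
qed

subsection \<open>The deficit on the fibres\<close>

text \<open>For a measure of mass \<open>m\<close>, half the double integral of
  \<open>|f x - f y|^2\<close> is exactly \<open>m\<close> times the integral of
  \<open>|f|^2\<close> minus the square of the modulus of the integral of \<open>f\<close>.
  Enlarging \<open>m\<close> to \<open>c\<close> gives the claim, and if \<open>f\<close> is not
  square integrable the right side is infinite.\<close>

lemma variance_bound:
  fixes f :: "'a \<Rightarrow> complex"
  assumes fin: "emeasure M (space M) \<le> ennreal c" and c: "c > 0" and [measurable]: "f \<in> borel_measurable M"
  shows "nsq (integral\<^sup>L M f) + ennreal (1 / 2) * (\<integral>\<^sup>+ x. \<integral>\<^sup>+ y. nsq (f x - f y) \<partial>M \<partial>M)
    \<le> ennreal c * (\<integral>\<^sup>+ x. nsq (f x) \<partial>M)"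
proof (cases "(\<integral>\<^sup>+ x. nsq (f x) \<partial>M) = \<infinity>")
  case True
  then show ?thesis using c by (simp add: ennreal_mult_top)
next
  case False
  interpret finite_measure M
    by (rule finite_measureI) (use fin in \<open>auto simp: top_unique\<close>)
  define m where "m = measure M (space M)"
  have m: "0 \<le> m" "m \<le> c"
    using fin c by (auto simp: m_def emeasure_eq_measure)
  have i2: "integrable M (\<lambda>x. (norm (f x))\<^sup>2)"
    using False by (intro integrableI_nonneg) (auto simp: less_top)
  have i1: "integrable M f"
  proof (rule Bochner_Integration.integrable_bound[where f="\<lambda>x. 1 + (norm (f x))\<^sup>2"])
    show "integrable M (\<lambda>x. 1 + (norm (f x))\<^sup>2)" using i2 by simp
    show "AE x in M. norm (f x) \<le> norm (1 + (norm (f x))\<^sup>2)"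
    proof (intro AE_I2)
      fix x
      have "2 * norm (f x) * 1 \<le> (norm (f x))\<^sup>2 + 1\<^sup>2" by (rule sum_squares_bound)
      moreover have "norm (1 + (norm (f x))\<^sup>2) = 1 + (norm (f x))\<^sup>2" by simp
      ultimately show "norm (f x) \<le> norm (1 + (norm (f x))\<^sup>2)" using norm_ge_zero[of "f x"] unfolding power_one mult_1_right by linarith
    qed
  qed simp
  define S where "S = (LINT x|M. (norm (f x))\<^sup>2)"
  define J where "J = integral\<^sup>L M f"
  let ?v = "\<lambda>x. m * (norm (f x))\<^sup>2 + S - 2 * Re (cnj (f x) * J)"
  have ex: "(norm (a - b))\<^sup>2 = (norm a)\<^sup>2 + (norm b)\<^sup>2 - 2 * Re (cnj a * b)" for a b :: complex
    by (simp add: cmod_power2 power2_diff algebra_simps)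
  have iy: "integrable M (\<lambda>y. (norm (f x - f y))\<^sup>2)" for x
    unfolding ex using i1 i2 by (intro Bochner_Integration.integrable_diff Bochner_Integration.integrable_add integrable_mult_right integrable_Re) auto
  have inner: "(LINT y|M. (norm (f x - f y))\<^sup>2) = ?v x" for x
  proof -
    have "(LINT y|M. Re (cnj (f x) * f y)) = Re (LINT y|M. cnj (f x) * f y)"
      using i1 by (intro integral_Re) auto
    also have "\<dots> = Re (cnj (f x) * J)" by (simp add: J_def)
    finally have "(LINT y|M. 2 * Re (cnj (f x) * f y)) = 2 * Re (cnj (f x) * J)"
      by (simp only: integral_mult_right_zero)
    moreover have "(LINT y|M. (norm (f x - f y))\<^sup>2) = (LINT y|M. (norm (f x))\<^sup>2 + (norm (f y))\<^sup>2) - (LINT y|M. 2 * Re (cnj (f x) * f y))"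
      unfolding ex using i1 i2 by (intro Bochner_Integration.integral_diff Bochner_Integration.integrable_add integrable_mult_right integrable_Re) auto
    moreover have "(LINT y|M. (norm (f x))\<^sup>2 + (norm (f y))\<^sup>2) = m * (norm (f x))\<^sup>2 + S"
      using i2 by (simp add: m_def S_def)
    ultimately show ?thesis by simp
  qed
  have ix: "integrable M (\<lambda>x. ?v x)"
    using i1 i2 by (intro Bochner_Integration.integrable_diff Bochner_Integration.integrable_add integrable_mult_right integrable_Re integrable_mult_left integrable_cnj) auto
  have outer: "(LINT x|M. ?v x) = 2 * m * S - 2 * (norm J)\<^sup>2"
  proof -
    have "(LINT x|M. Re (cnj (f x) * J)) = Re (LINT x|M. cnj (f x) * J)"
      using i1 by (intro integral_Re) auto
    also have "\<dots> = Re (cnj J * J)" by (simp add: J_def)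
    also have "\<dots> = (norm J)\<^sup>2" by (subst cmod_power2) (simp add: power2_eq_square)
    finally have "(LINT x|M. 2 * Re (cnj (f x) * J)) = 2 * (norm J)\<^sup>2"
      by (simp only: integral_mult_right_zero)
    moreover have "(LINT x|M. ?v x) = (LINT x|M. m * (norm (f x))\<^sup>2 + S) - (LINT x|M. 2 * Re (cnj (f x) * J))"
      using i1 i2 by (intro Bochner_Integration.integral_diff Bochner_Integration.integrable_add integrable_mult_right integrable_Re integrable_mult_left integrable_cnj) auto
    moreover have "(LINT x|M. m * (norm (f x))\<^sup>2 + S) = 2 * m * S"
      using i2 by (simp add: m_def S_def)
    ultimately show ?thesis by simp
  qed
  have nn: "0 \<le> ?v x" for x
    unfolding inner[symmetric] by simp
  have "(\<integral>\<^sup>+ x. \<integral>\<^sup>+ y. nsq (f x - f y) \<partial>M \<partial>M) = (\<integral>\<^sup>+ x. ennreal (?v x) \<partial>M)"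
    by (intro nn_integral_cong, subst nn_integral_eq_integral[OF iy]) (simp_all only: inner[symmetric] zero_le_power2 AE_I2)
  also have "\<dots> = ennreal (2 * m * S - 2 * (norm J)\<^sup>2)"
    by (subst nn_integral_eq_integral[OF ix]) (simp_all only: nn outer AE_I2)
  finally have D: "(\<integral>\<^sup>+ x. \<integral>\<^sup>+ y. nsq (f x - f y) \<partial>M \<partial>M) = ennreal (2 * m * S - 2 * (norm J)\<^sup>2)" .
  have nnD: "0 \<le> 2 * m * S - 2 * (norm J)\<^sup>2"
    unfolding outer[symmetric] by (intro integral_nonneg_AE AE_I2 nn)
  have S: "S \<ge> 0" by (simp add: S_def)
  have "nsq J + ennreal (1 / 2) * ennreal (2 * m * S - 2 * (norm J)\<^sup>2) = ennreal ((norm J)\<^sup>2 + 1 / 2 * (2 * m * S - 2 * (norm J)\<^sup>2))"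
    using nnD by (subst ennreal_mult[symmetric], simp, simp, subst ennreal_plus) simp_all
  also have "(norm J)\<^sup>2 + 1 / 2 * (2 * m * S - 2 * (norm J)\<^sup>2) = m * S" by (simp add: field_simps)
  also have "ennreal (m * S) \<le> ennreal (c * S)" using m S by (intro ennreal_leI mult_right_mono)
  also have "\<dots> = ennreal c * (\<integral>\<^sup>+ x. nsq (f x) \<partial>M)"
    using c S by (subst nn_integral_eq_integral[OF i2]) (auto simp: S_def ennreal_mult)
  finally show ?thesis by (simp only: D J_def)
qed

text \<open>With \<open>c\<^sup>2\<close> the smaller of \<open>T\<^sup>2 - (2p - T)\<^sup>2\<close> and \<open>T\<^sup>2 - (2q - T)\<^sup>2\<close>, only the part \<open>|A - T| < c\<close> of the
  integral is used, where one factor is at least \<open>1 / c\<close>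
  and the other at least \<open>1 / T\<close>.\<close>

lemma kappa_overlap:
  assumes p: "0 < p" "p < T" and q: "0 < q" "q < T"
  shows "ennreal (2 / T) \<le> (NNINT A. indicator {0<..} A * (ennreal (kappa A T p) * ennreal (kappa A T q)))"
proof -
  let ?k = "\<lambda>A p q. indicator {0<..} A * (ennreal (kappa A T p) * ennreal (kappa A T q))"
  have main: "ennreal (2 / T) \<le> (NNINT A. ?k A p q)"
    if p: "0 < p" "p < T" and le: "(2 * q - T)\<^sup>2 \<le> (2 * p - T)\<^sup>2" for p q
  proof -
    have T: "T > 0" using p by simp
    define c where "c = sqrt (T\<^sup>2 - (2 * p - T)\<^sup>2)"
    have pos: "T\<^sup>2 - (2 * p - T)\<^sup>2 > 0"
    proof -
      have "T\<^sup>2 - (2 * p - T)\<^sup>2 = 4 * p * (T - p)" by (simp add: power2_eq_square algebra_simps)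
      then show ?thesis using p by simp
    qed
    then have c: "c > 0" "c\<^sup>2 = T\<^sup>2 - (2 * p - T)\<^sup>2" by (auto simp: c_def)
    have cT: "c \<le> T"
    proof (rule power2_le_imp_le)
      show "c\<^sup>2 \<le> T\<^sup>2" using c(2) by simp
    qed (use T in simp)
    have "ennreal (1 / (c * T)) * indicator {T - c<..<T + c} A \<le> ?k A p q" for A
    proof (cases "A \<in> {T - c<..<T + c}")
      case True
      then have A0: "A > 0" using cT by simp
      have "\<bar>A - T\<bar> < c" using True by auto
      then have lt: "(A - T)\<^sup>2 < c\<^sup>2" using power_strict_mono[of "\<bar>A - T\<bar>" c 2] by simp
      have h: "heron A T s = T\<^sup>2 - (A - T)\<^sup>2 - (2 * s - T)\<^sup>2" for s
        unfolding heron_def by (simp add: power2_eq_square algebra_simps)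
      have hp: "0 < heron A T p" "heron A T p \<le> c\<^sup>2" unfolding h using lt c(2) by auto
      have hq: "0 < heron A T q" "heron A T q \<le> T\<^sup>2" unfolding h using lt c(2) le
        using zero_le_power2[of "A - T"] zero_le_power2[of "2 * q - T"] by linarith+
      have "sqrt (heron A T p) \<le> c" using hp c(1) real_sqrt_le_iff[of "heron A T p" "c\<^sup>2"] by simp
      then have 1: "1 / c \<le> kappa A T p" using hp c(1) by (simp add: kappa_def frac_le)
      have "sqrt (heron A T q) \<le> T" using hq T real_sqrt_le_iff[of "heron A T q" "T\<^sup>2"] by simp
      then have 2: "1 / T \<le> kappa A T q" using hq T by (simp add: kappa_def frac_le)
      have "1 / (c * T) = 1 / c * (1 / T)" by simp
      also have "\<dots> \<le> kappa A T p * kappa A T q"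
        using c(1) T by (intro mult_mono 1 2) (auto simp: kappa_nonneg)
      finally have "ennreal (1 / (c * T)) \<le> ennreal (kappa A T p * kappa A T q)" by (rule ennreal_leI)
      then show ?thesis using True A0 by (simp add: ennreal_mult kappa_nonneg)
    qed simp
    then have "(NNINT A. ennreal (1 / (c * T)) * indicator {T - c<..<T + c} A) \<le> (NNINT A. ?k A p q)"
      by (rule nn_integral_mono)
    \<comment> \<open>The length \<open>2 * c\<close> of the interval cancels the factor
      \<open>1 / c\<close>, which makes the bound independent of \<open>p\<close> and
      \<open>q\<close>.\<close>
    moreover have "(NNINT A. ennreal (1 / (c * T)) * indicator {T - c<..<T + c} A) = ennreal (2 / T)"
      using c(1) T by (subst nn_integral_cmult) (auto simp: ennreal_mult[symmetric])
    ultimately show ?thesis by simp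
  qed
  show ?thesis
  proof (cases "(2 * q - T)\<^sup>2 \<le> (2 * p - T)\<^sup>2")
    case True
    then show ?thesis using main[of p q] p by simp
  next
    case False
    then show ?thesis using main[of q p] q by (simp add: mult.commute)
  qed
qed

definition fiber :: "(real \<Rightarrow> complex) \<Rightarrow> real \<Rightarrow> real \<Rightarrow> complex" where
  "fiber \<phi> T p = \<phi> p * \<phi> (T - p)"

lemma fiber_measurable [measurable (raw)]:
  assumes [measurable]: "\<phi> \<in> borel_measurable borel" "f \<in> borel_measurable M" "g \<in> borel_measurable M"
  shows "(\<lambda>x. fiber \<phi> (f x) (g x)) \<in> borel_measurable M"
  unfolding fiber_def by measurable

text \<open>This is the push-forward \<open>H\<close> of the overview, at
  \<open>y = (a, T)\<close>.\<close>

definition fiber_integral :: "(real \<Rightarrow> complex) \<Rightarrow> plane \<times> real \<Rightarrow> complex" where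
  "fiber_integral \<phi> y = (LINT p|lborel. complex_of_real (kappa ((norm (fst y))\<^sup>2) (snd y) p) * fiber \<phi> (snd y) p)"

lemma fiber_integral_measurable [measurable]:
  assumes [measurable]: "\<phi> \<in> borel_measurable borel"
  shows "fiber_integral \<phi> \<in> borel_measurable borel"
  unfolding fiber_integral_def by measurable

text \<open>If \<open>fiber \<phi> T\<close> is square integrable on \<open>(0, T)\<close>, the two
  inner integrals are twice its squared distance from the constants. So the gap measures how far
  \<open>\<phi> p * \<phi> (T - p)\<close> is from a function of \<open>T\<close> alone.\<close>

definition fiber_gap :: "(real \<Rightarrow> complex) \<Rightarrow> ennreal" where
  "fiber_gap \<phi> = (NNINT T. NNINT p. NNINT q. indicator {0<..<T} p * (indicator {0<..<T} q *
     (ennreal (1 / T) * nsq (fiber \<phi> T p - fiber \<phi> T q))))"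

lemma norm_sq_snd: "(norm z)\<^sup>2 - (norm (fst z))\<^sup>2 = (norm (snd z))\<^sup>2"
  by (simp add: norm_prod_sq)

lemma indicator_interval_measurable [measurable (raw)]:
  fixes f g :: "'a \<Rightarrow> real"
  assumes [measurable]: "f \<in> borel_measurable M" "g \<in> borel_measurable M"
  shows "(\<lambda>x. indicator {0<..<f x} (g x) :: ennreal) \<in> borel_measurable M"
proof -
  have "(\<lambda>x. indicator {0<..<f x} (g x) :: ennreal) = (\<lambda>x. if 0 < g x \<and> g x < f x then 1 else 0)"
    by (auto simp: fun_eq_iff)
  then show ?thesis by simp
qed

text \<open>\<open>variance_bound\<close> is applied on each fibre with the measure of density
  \<open>kappa\<close>, whose mass is at most \<open>pi / 2\<close>, and then integrated over all
  fibres. On the right, the change of variables \<open>sum_coords\<close> reassembles the fibres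
  into the full norm.\<close>

lemma fiber_integral_gap:
  assumes [measurable]: "\<phi> \<in> borel_measurable borel"
  shows "(NNINT y. nsq (fiber_integral \<phi> y)) + ennreal pi * fiber_gap \<phi>
    \<le> ennreal (pi / 2) * (NNINT z::plane \<times> plane. nsq (\<phi> ((norm (fst z))\<^sup>2) * \<phi> ((norm (snd z))\<^sup>2)))"
proof -
  define k where "k y p = ennreal (kappa ((norm (fst y))\<^sup>2) (snd y) p)" for y :: "plane \<times> real" and p
  define D where "D T p q = nsq (fiber \<phi> T p - fiber \<phi> T q)" for T p q
  have Dm [measurable (raw)]: "(\<lambda>x. D (f x) (g x) (h x)) \<in> borel_measurable M"
    if [measurable]: "f \<in> borel_measurable M" "g \<in> borel_measurable M" "h \<in> borel_measurable M" for f g h and M :: "'b measure"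
    unfolding D_def by measurable
  have km [measurable (raw)]: "(\<lambda>x. k (f x) (g x)) \<in> borel_measurable M"
    if [measurable]: "f \<in> borel_measurable M" "g \<in> borel_measurable M" for f g and M :: "'b measure"
    unfolding k_def by measurable
  let ?E = "\<lambda>y. NNINT p. NNINT q. k y p * (k y q * D (snd y) p q)"
  let ?Q = "\<lambda>y. NNINT p. k y p * nsq (fiber \<phi> (snd y) p)"
  let ?I = "NNINT y. nsq (fiber_integral \<phi> y)"
  let ?F = "NNINT z::plane \<times> plane. nsq (\<phi> ((norm (fst z))\<^sup>2) * \<phi> ((norm (snd z))\<^sup>2))"
  let ?K = "\<lambda>a T p q. k (a, T) p * (k (a, T) q * D T p q)"
  have pt: "nsq (fiber_integral \<phi> y) + ennreal (1 / 2) * (?E y)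
    \<le> ennreal (pi / 2) * (?Q y)" for y
  proof -
    define M where "M = density lborel (k y)"
    have [measurable]: "k y \<in> borel_measurable borel" by measurable
    have [measurable]: "fiber \<phi> (snd y) \<in> borel_measurable borel" by measurable
    have "emeasure M (space M) \<le> ennreal (pi / 2)"
      using nn_integral_kappa_le[of "(norm (fst y))\<^sup>2" "snd y"] by (simp add: M_def emeasure_density k_def)
    from variance_bound[OF this, of "fiber \<phi> (snd y)"]
    have "nsq (integral\<^sup>L M (fiber \<phi> (snd y))) + ennreal (1 / 2) * (\<integral>\<^sup>+ p. \<integral>\<^sup>+ q. D (snd y) p q \<partial>M \<partial>M)
      \<le> ennreal (pi / 2) * (\<integral>\<^sup>+ p. nsq (fiber \<phi> (snd y) p) \<partial>M)"
      by (simp add: M_def D_def)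
    moreover have "integral\<^sup>L M (fiber \<phi> (snd y)) = fiber_integral \<phi> y"
      unfolding M_def fiber_integral_def k_def
      by (subst integral_density) (auto simp: kappa_nonneg scaleR_conv_of_real)
    moreover have "(\<integral>\<^sup>+ p. nsq (fiber \<phi> (snd y) p) \<partial>M) = (?Q y)"
      unfolding M_def by (rule nn_integral_density) measurable
    moreover have "(\<integral>\<^sup>+ p. \<integral>\<^sup>+ q. D (snd y) p q \<partial>M \<partial>M) = (?E y)"
    proof -
      have "(\<integral>\<^sup>+ q. D (snd y) p q \<partial>M) = (NNINT q. k y q * D (snd y) p q)" for p
        unfolding M_def by (rule nn_integral_density) measurable
      then have "(\<integral>\<^sup>+ p. \<integral>\<^sup>+ q. D (snd y) p q \<partial>M \<partial>M) = (NNINT p. k y p * (NNINT q. k y q * D (snd y) p q))"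
        unfolding M_def by (simp add: nn_integral_density)
      then show ?thesis by (simp add: nn_integral_cmult)
    qed
    ultimately show ?thesis by simp
  qed
  have lhs: "ennreal pi * fiber_gap \<phi> \<le> (NNINT y. ennreal (1 / 2) * (?E y))"
  proof -
    have m: "(\<lambda>y. NNINT p. NNINT q. k y p * (k y q * D (snd y) p q)) \<in> borel_measurable borel"
      by measurable
    have "(NNINT y. (?E y))
      = (NNINT a. NNINT T. NNINT p. NNINT q. ?K a T p q)"
      using nn_integral_lborel_pair[OF m] by simp
    also have "\<dots> = (NNINT T. NNINT a. NNINT p. NNINT q. ?K a T p q)"
      by (rule lborel_pair.Fubini') measurable
    also have "\<dots> = (NNINT T. NNINT p. NNINT a. NNINT q. ?K a T p q)"
      by (rule nn_integral_cong, rule lborel_pair.Fubini') measurable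
    also have "\<dots> = (NNINT T. NNINT p. NNINT q. NNINT a. ?K a T p q)"
      by (rule nn_integral_cong, rule nn_integral_cong, rule lborel_pair.Fubini') measurable
    finally have eq: "(NNINT y. (?E y))
      = (NNINT T. NNINT p. NNINT q. NNINT a. ?K a T p q)" .
    \<comment> \<open>\<open>D T p q\<close> does not involve \<open>a\<close>. Integrating over
      \<open>a\<close> first therefore leaves only the overlap of two weights: \<open>pi\<close>
      comes from the squared norm of \<open>a\<close> and \<open>2 / T\<close> from
      \<open>kappa_overlap\<close>. The 1/2 in \<open>variance_bound\<close> turns
      \<open>2 * pi\<close> into the coefficient \<open>pi\<close> of the gap.\<close>
    have low: "ennreal (2 * pi) * (indicator {0<..<T} p * (indicator {0<..<T} q * (ennreal (1 / T) * D T p q)))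
      \<le> (NNINT a. ?K a T p q)" for T p q
    proof (cases "p \<in> {0<..<T} \<and> q \<in> {0<..<T}")
      case True
      have "ennreal (2 * pi) * (ennreal (1 / T) * D T p q) = ennreal pi * ennreal (2 / T) * D T p q"
      proof -
        have "ennreal (2 * pi) * ennreal (1 / T) = ennreal (2 * pi * (1 / T))" using True by (intro ennreal_mult[symmetric]) auto
        also have "2 * pi * (1 / T) = pi * (2 / T)" by simp
        also have "ennreal \<dots> = ennreal pi * ennreal (2 / T)" using True by (intro ennreal_mult) auto
        finally show ?thesis by (simp only: mult.assoc[symmetric])
      qed
      also have "\<dots> \<le> ennreal pi * (NNINT A. indicator {0<..} A * (ennreal (kappa A T p) * ennreal (kappa A T q))) * D T p q"
        using True by (intro mult_right_mono mult_left_mono kappa_overlap) auto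
      also have "ennreal pi * (NNINT A. indicator {0<..} A * (ennreal (kappa A T p) * ennreal (kappa A T q)))
        = (NNINT a::plane. ennreal (kappa ((norm a)\<^sup>2) T p) * ennreal (kappa ((norm a)\<^sup>2) T q))"
        by (rule nn_integral_norm_sq[symmetric]) measurable
      also have "\<dots> * D T p q = (NNINT a. ?K a T p q)"
        by (subst nn_integral_multc[symmetric]) (simp_all add: k_def mult.assoc)
      finally show ?thesis using True by simp
    qed auto
    have gap: "ennreal (2 * pi) * fiber_gap \<phi> = (NNINT T. NNINT p. NNINT q. ennreal (2 * pi) * (indicator {0<..<T} p * (indicator {0<..<T} q * (ennreal (1 / T) * D T p q))))"
      unfolding fiber_gap_def D_def[symmetric] by (simp add: nn_integral_cmult)
    have "ennreal (2 * pi) * fiber_gap \<phi> \<le> (NNINT y. (?E y))"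
      unfolding eq gap by (intro nn_integral_mono low)
    then have "ennreal (1 / 2) * (ennreal (2 * pi) * fiber_gap \<phi>) \<le> ennreal (1 / 2) * (NNINT y. (?E y))"
      by (rule mult_left_mono) simp
    moreover have "ennreal (1 / 2) * (ennreal (2 * pi) * fiber_gap \<phi>) = ennreal pi * fiber_gap \<phi>"
      by (simp only: mult.assoc[symmetric], subst ennreal_mult[symmetric]) auto
    moreover have "ennreal (1 / 2) * (NNINT y. (?E y))
      = (NNINT y. ennreal (1 / 2) * (?E y))"
      by (rule nn_integral_cmult[symmetric]) measurable
    ultimately show ?thesis by simp
  qed
  have rhs: "?F
    = (NNINT y. NNINT p. k y p * nsq (fiber \<phi> (snd y) p))"
  proof -
    have "?F
      = (NNINT z. (\<lambda>w. nsq (fiber \<phi> (snd (fst w)) (snd w))) (sum_coords z))"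
      by (simp add: sum_coords_def fiber_def norm_sq_snd)
    also have "\<dots> = (NNINT w. k (fst w) (snd w) * nsq (fiber \<phi> (snd (fst w)) (snd w)))"
      unfolding k_def by (rule nn_integral_sum_coords) measurable
    also have "\<dots> = (NNINT y. NNINT p. k y p * nsq (fiber \<phi> (snd y) p))"
    proof -
      have "(\<lambda>w. k (fst w) (snd w) * nsq (fiber \<phi> (snd (fst w)) (snd w))) \<in> borel_measurable borel"
        by measurable
      from nn_integral_lborel_pair[OF this] show ?thesis by simp
    qed
    finally show ?thesis .
  qed
  have "?I + ennreal pi * fiber_gap \<phi>
    \<le> ?I + (NNINT y. ennreal (1 / 2) * (?E y))"
    by (intro add_left_mono lhs)
  also have "\<dots> = (NNINT y. nsq (fiber_integral \<phi> y) + ennreal (1 / 2) * (?E y))"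
    by (rule nn_integral_add[symmetric]) measurable
  also have "\<dots> \<le> (NNINT y. ennreal (pi / 2) * (?Q y))"
    by (intro nn_integral_mono pt)
  also have "\<dots> = ennreal (pi / 2) * (NNINT y. NNINT p. k y p * nsq (fiber \<phi> (snd y) p))"
    by (rule nn_integral_cmult) measurable
  finally show ?thesis unfolding rhs .
qed

section \<open>Choice of the radial profile\<close>

text \<open>Otherwise \<open>X\<close> exceeds its integral \<open>c\<close> throughout the unit
  interval, and integrating the strict inequality gives \<open>c < c\<close>. Finiteness of
  \<open>c\<close>, on which strictness rests, follows from \<open>c < X (1 / 2)\<close>.\<close>

lemma ex_le_nn_integral_unit:
  fixes X :: "real \<Rightarrow> ennreal"
  assumes [measurable]: "X \<in> borel_measurable borel"
  obtains s where "0 < s" "s < 1" "X s \<le> (NNINT s. indicator {0<..<1} s * X s)"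
proof -
  define c where "c = (NNINT s. indicator {0<..<1} s * X s)"
  have "\<exists>s\<in>{0<..<1}. X s \<le> c"
  proof (rule ccontr)
    assume "\<not> (\<exists>s\<in>{0<..<1}. X s \<le> c)"
    then have gt: "\<And>s. s \<in> {0<..<1} \<Longrightarrow> c < X s" by (auto simp: not_le)
    have "c < X (1 / 2)" by (rule gt) simp
    then have cfin: "c < top" by (rule order.strict_trans2) (rule top_greatest)
    have cc: "(NNINT s::real. indicator {0<..<1} s * c) = c"
      by (subst nn_integral_multc) auto
    have "(NNINT s::real. indicator {0<..<1} s * c) < (NNINT s. indicator {0<..<1} s * X s)"
    proof (rule nn_integral_less)
      show "(NNINT s::real. indicator {0<..<1} s * c) \<noteq> \<infinity>" using cc cfin by simp
      show "AE s in lborel. indicator {0<..<1} s * c \<le> indicator {0<..<1} s * X s"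
        using gt by (auto split: split_indicator intro!: less_imp_le)
      show "\<not> (AE s in lborel. indicator {0<..<1} s * X s \<le> indicator {0<..<1} s * c)"
      proof
        assume "AE s in lborel. indicator {0<..<1} s * X s \<le> indicator {0<..<1} s * c"
        then have "AE s in lborel. s \<notin> {0<..<1::real}"
          by eventually_elim (use gt in \<open>force simp: not_le[symmetric]\<close>)
        then have "emeasure lborel {0<..<1::real} = 0"
          by (subst (asm) AE_iff_measurable[of "{0<..<1}"]) auto
        then show False by simp
      qed
    qed simp_all
    then show False using cc by (simp add: c_def)
  qed
  then show ?thesis using that by (auto simp: c_def)
qed

text \<open>For each \<open>s\<close> the subtracted function depends on \<open>norm z\<close> only.
  Averaging the squared distance over \<open>s\<close> and substituting \<open>q = s * T\<close>
  turns \<open>ds\<close> into \<open>dq / T\<close>, the weight in \<open>fiber_gap\<close>; hence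
  the average is \<open>pi^2\<close> times the gap, and some \<open>s\<close> is no worse.\<close>

lemma ex_radial_near_fiber:
  assumes [measurable]: "\<phi> \<in> borel_measurable borel"
  obtains s where "0 < s" "s < 1"
    "(NNINT z::plane \<times> plane. nsq (\<phi> ((norm (fst z))\<^sup>2) * \<phi> ((norm (snd z))\<^sup>2) - fiber \<phi> ((norm z)\<^sup>2) (s * (norm z)\<^sup>2)))
      \<le> ennreal (pi\<^sup>2) * fiber_gap \<phi>"
proof -
  define D where "D T p q = nsq (fiber \<phi> T p - fiber \<phi> T q)" for T p q
  have Dm [measurable (raw)]: "(\<lambda>x. D (f x) (g x) (h x)) \<in> borel_measurable M"
    if [measurable]: "f \<in> borel_measurable M" "g \<in> borel_measurable M" "h \<in> borel_measurable M" for f g h and M :: "'b measure"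
    unfolding D_def by measurable
  let ?t = "\<lambda>T s p. indicator {0<..<1} s * (indicator {0<..<T} p * D T p (s * T))"
  let ?v = "\<lambda>T p s. indicator {0<..<T} p * (indicator {0<..<T} (0 + T * s) * (ennreal (1 / T) * D T p (0 + T * s)))"
  define X where "X s = (NNINT z::plane \<times> plane. nsq (\<phi> ((norm (fst z))\<^sup>2) * \<phi> ((norm (snd z))\<^sup>2) - fiber \<phi> ((norm z)\<^sup>2) (s * (norm z)\<^sup>2)))" for s
  have X: "X s = ennreal (pi\<^sup>2) * (NNINT T. NNINT p. indicator {0<..<T} p * D T p (s * T))" for s
  proof -
    have "X s = (NNINT z::plane \<times> plane. D ((norm z)\<^sup>2) ((norm (fst z))\<^sup>2) (s * (norm z)\<^sup>2))"
      unfolding X_def D_def by (simp add: fiber_def norm_sq_snd)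
    also have "\<dots> = ennreal (pi\<^sup>2) * (NNINT T. NNINT p. indicator {0<..<T} p * D T p (s * T))"
      by (rule nn_integral_norm_coords[where g="\<lambda>T p. D T p (s * T)"]) (simp add: split_beta)
    finally show ?thesis .
  qed
  have Xm: "X \<in> borel_measurable borel" unfolding X by measurable
  have "(NNINT s. indicator {0<..<1} s * X s) = ennreal (pi\<^sup>2) * fiber_gap \<phi>"
  proof -
    have "(NNINT s. indicator {0<..<1} s * X s) = ennreal (pi\<^sup>2) * (NNINT s. NNINT T. NNINT p. ?t T s p)"
    proof -
      define Y where "Y s = (NNINT T. NNINT p. indicator {0<..<T} p * D T p (s * T))" for s
      have [measurable]: "Y \<in> borel_measurable borel" unfolding Y_def by measurable
      have "(NNINT s. indicator {0<..<1} s * X s) = (NNINT s. ennreal (pi\<^sup>2) * (indicator {0<..<1} s * Y s))"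
        by (simp add: X Y_def mult.left_commute)
      also have "\<dots> = ennreal (pi\<^sup>2) * (NNINT s. indicator {0<..<1} s * Y s)"
        by (rule nn_integral_cmult) measurable
      also have "(NNINT s. indicator {0<..<1} s * Y s) = (NNINT s. NNINT T. NNINT p. ?t T s p)"
        by (rule nn_integral_cong) (auto simp: Y_def split: split_indicator)
      finally show ?thesis .
    qed
    also have "(NNINT s. NNINT T. NNINT p. ?t T s p)
      = (NNINT T. NNINT s. NNINT p. ?t T s p)"
      by (rule lborel_pair.Fubini') measurable
    also have "\<dots> = (NNINT T. NNINT p. NNINT s. ?t T s p)"
      by (rule nn_integral_cong, rule lborel_pair.Fubini') measurable
    also have "\<dots> = fiber_gap \<phi>"
      unfolding fiber_gap_def D_def[symmetric]
    proof (rule nn_integral_cong, rule nn_integral_cong)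
      fix T p :: real
      show "(NNINT s. ?t T s p)
        = (NNINT q. indicator {0<..<T} p * (indicator {0<..<T} q * (ennreal (1 / T) * D T p q)))"
      proof (cases "0 < T")
        case True
        have "(NNINT q. indicator {0<..<T} p * (indicator {0<..<T} q * (ennreal (1 / T) * D T p q)))
          = ennreal \<bar>T\<bar> * (NNINT s. ?v T p s)"
          by (rule nn_integral_real_affine) (measurable, use True in simp)
        also have "\<dots> = (NNINT s. ennreal \<bar>T\<bar> * (?v T p s))"
          by (rule nn_integral_cmult[symmetric]) measurable
        also have "\<dots> = (NNINT s. ?t T s p)"
        proof (rule nn_integral_cong)
          fix s :: real
          have 1: "indicator {0<..<T} (0 + T * s) = (indicator {0<..<1} s :: ennreal)"
            using True by (auto simp: indicator_def zero_less_mult_iff)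
          have 2: "ennreal \<bar>T\<bar> * ennreal (1 / T) = 1" using True by (subst ennreal_mult[symmetric]) auto
          have "ennreal \<bar>T\<bar> * (?v T p s)
            = (ennreal \<bar>T\<bar> * ennreal (1 / T)) * (?t T s p)"
            unfolding 1 by (simp add: mult_ac)
          then show "ennreal \<bar>T\<bar> * (?v T p s) = ?t T s p"
            unfolding 2 by simp
        qed
        finally show ?thesis by simp
      qed simp
    qed
    finally show ?thesis .
  qed
  then obtain s where "0 < s" "s < 1" "X s \<le> ennreal (pi\<^sup>2) * fiber_gap \<phi>"
    using ex_le_nn_integral_unit[OF Xm] by auto
  then show ?thesis using that unfolding X_def by blast
qed

subsection \<open>The regularized evolution\<close>

lemma integral_tensor:
  fixes f :: "'a::euclidean_space \<Rightarrow> complex" and g :: "'b::euclidean_space \<Rightarrow> complex"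
  assumes f: "integrable lborel f" and g: "integrable lborel g"
  shows "integrable lborel (\<lambda>z. f (fst z) * g (snd z))"
    and "(LINT z|lborel. f (fst z) * g (snd z)) = (LINT x|lborel. f x) * (LINT y|lborel. g y)"
proof -
  have [measurable]: "f \<in> borel_measurable borel" "g \<in> borel_measurable borel" using f g by auto
  have i: "integrable (lborel \<Otimes>\<^sub>M lborel) (\<lambda>(x, y). f x * g y)"
  proof (rule lborel_pair.Fubini_integrable)
    show "integrable lborel (\<lambda>x. LINT y|lborel. norm (case (x, y) of (x, y) \<Rightarrow> f x * g y))"
      using f by (simp add: norm_mult)
    show "AE x in lborel. integrable lborel (\<lambda>y. case (x, y) of (x, y) \<Rightarrow> f x * g y)"
      using g by (auto intro!: integrable_mult_right)
  qed measurable
  then show "integrable lborel (\<lambda>z. f (fst z) * g (snd z))" by (simp add: lborel_prod case_prod_beta')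
  show "(LINT z|lborel. f (fst z) * g (snd z)) = (LINT x|lborel. f x) * (LINT y|lborel. g y)"
    using lborel_pair.integral_fst'[OF i] by (simp add: lborel_prod case_prod_beta')
qed

lemma fourier_tensor:
  fixes f :: "'a::euclidean_space \<Rightarrow> complex" and g :: "'b::euclidean_space \<Rightarrow> complex"
  assumes f: "integrable lborel f" and g: "integrable lborel g"
  shows "fourier (\<lambda>z. f (fst z) * g (snd z)) (x, y) = fourier f x * fourier g y"
proof -
  have "fourier f x * fourier g y = (LINT z|lborel. (expi (fst z \<bullet> x) * f (fst z)) * (expi (snd z \<bullet> y) * g (snd z)))"
    unfolding fourier_def
    by (rule integral_tensor(2)[symmetric]) (intro integrable_exp_mult f g, measurable)+
  also have "\<dots> = fourier (\<lambda>z. f (fst z) * g (snd z)) (x, y)"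
    unfolding fourier_def
    by (intro Bochner_Integration.integral_cong refl) (simp add: inner_prod_def exp_add exp_diff exp_minus algebra_simps divide_inverse)
  finally show ?thesis by simp
qed

text \<open>No energy is negative. This keeps the damping factor \<open>exp (- e * T)\<close> at
  most 1 wherever it matters.\<close>

lemma fiber_integral_eq_0:
  assumes "snd y < 0" shows "fiber_integral \<phi> y = 0"
proof -
  have "kappa ((norm (fst y))\<^sup>2) (snd y) p = 0" for p
  proof -
    have "(norm (fst y))\<^sup>2 * snd y \<le> 0" using assms by (intro mult_nonneg_nonpos) auto
    then have "heron ((norm (fst y))\<^sup>2) (snd y) p \<le> 0"
      unfolding heron_def using zero_le_power2[of "2 * p - snd y"] zero_le_power2[of "(norm (fst y))\<^sup>2"] by linarith
    then show ?thesis by (simp add: kappa_def)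
  qed
  then show ?thesis by (simp add: fiber_integral_def)
qed

text \<open>The heat average of the solution at time \<open>snd z\<close>, written directly in terms
  of \<phi> as an absolutely convergent integral. The Gaussian amounts to the complex time
  \<open>t - \<i> * e\<close>, so on the product of two copies it depends on the energy
  alone.\<close>

definition evolution :: "real \<Rightarrow> (real \<Rightarrow> complex) \<Rightarrow> plane \<times> real \<Rightarrow> complex" where
  "evolution e \<phi> z = (1 / (2 * pi)) ^ 2 * fourier (\<lambda>w. gauss e w *
     (expi (snd z * (norm w)\<^sup>2) * \<phi> ((norm w)\<^sup>2))) (- fst z)"

text \<open>Squaring turns the evolution into the space-time Fourier transform of the push-forward of
  \<open>F (x, y) = \<phi> (|x|\<^sup>2) * \<phi> (|y|\<^sup>2)\<close> under \<open>(x, y) \<mapsto> (x + y, |x|\<^sup>2 + |y|\<^sup>2)\<close>, whose density is the integral over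
  the fibres.\<close>

lemma evolution_square:
  assumes [measurable]: "\<phi> \<in> borel_measurable borel" and L2: "(\<lambda>w::plane. \<phi> ((norm w)\<^sup>2)) \<in> Lp 2" and e: "e > 0"
  defines "h \<equiv> (\<lambda>y. complex_of_real (exp (- e * snd y)) * fiber_integral \<phi> y)"
  shows "integrable lborel h"
    and "(evolution e \<phi> z)\<^sup>2 = (1 / (2 * pi)) ^ 4 * fourier h (- fst z, snd z)"
proof -
  define K where "K x t w = expi (fst (fst w) \<bullet> (- x) + t * snd (fst w)) *
     (complex_of_real (exp (- e * snd (fst w))) * fiber \<phi> (snd (fst w)) (snd w))"
    for x :: "plane" and t and w :: "(plane \<times> real) \<times> real"
  have [measurable]: "K x t \<in> borel_measurable borel" for x t unfolding K_def by measurable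
  define g where "g t w = gauss e w *
     (expi (t * (norm w)\<^sup>2) * \<phi> ((norm w)\<^sup>2))" for t and w :: plane
  have ig: "integrable lborel (g t)" for t
  proof -
    have "integrable lborel (\<lambda>w::plane. gauss e w * \<phi> ((norm w)\<^sup>2))"
      by (rule integrable_mult_L2[OF gaussian_L2[OF e] L2])
    then have "integrable lborel (\<lambda>w::plane. expi (t * (norm w)\<^sup>2) * (gauss e w * \<phi> ((norm w)\<^sup>2)))"
      by (rule integrable_exp_mult) measurable
    then show ?thesis by (simp add: g_def[abs_def] mult.left_commute)
  qed
  have Kz: "expi (fst z \<bullet> (- x)) * g t (fst z) * (expi (snd z \<bullet> (- x)) * g t (snd z)) = K x t (sum_coords z)" for x t z
    unfolding K_def sum_coords_def g_def fiber_def fst_conv snd_conv norm_sq_snd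
    by (simp add: norm_prod_sq inner_add_left algebra_simps exp_add exp_diff exp_minus divide_inverse)
  have ie: "integrable lborel (\<lambda>w. expi (w \<bullet> (- x)) * g t w)" for x t
    by (intro integrable_exp_mult ig) measurable
  have iK: "integrable lborel (\<lambda>z. K x t (sum_coords z))" for x t
    unfolding Kz[symmetric] by (rule integral_tensor(1)[OF ie ie])
  define k where "k w = fiber_weight w" for w :: "(plane \<times> real) \<times> real"
  have [measurable]: "k \<in> borel_measurable borel" unfolding k_def by measurable
  have k0: "k w \<ge> 0" for w by (simp add: k_def kappa_nonneg)
  have distr: "distr lborel borel sum_coords = density lborel (\<lambda>w. ennreal (k w))"
    unfolding k_def by (rule distr_sum_coords)
  have ikK: "integrable lborel (\<lambda>w. k w *\<^sub>R K x t w)" for x t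
  proof -
    have "integrable (distr lborel borel sum_coords) (K x t)"
      by (subst integrable_distr_eq) (simp_all add: iK)
    then show ?thesis unfolding distr by (subst (asm) integrable_density) (auto simp: k0)
  qed
  have prodK: "integrable (lborel \<Otimes>\<^sub>M lborel) (\<lambda>w. k w *\<^sub>R K x t w)" for x t
    using ikK by (simp add: lborel_prod)
  have inner: "(LINT p|lborel. k (y, p) *\<^sub>R K x t (y, p)) = expi (y \<bullet> (- x, t)) * h y" for x t y
  proof -
    have "(LINT p|lborel. k (y, p) *\<^sub>R K x t (y, p))
      = (LINT p|lborel. (expi (y \<bullet> (- x, t)) * complex_of_real (exp (- e * snd y))) * (complex_of_real (kappa ((norm (fst y))\<^sup>2) (snd y) p) * fiber \<phi> (snd y) p))"
      by (intro Bochner_Integration.integral_cong refl) (simp add: k_def K_def scaleR_conv_of_real inner_prod_def mult_ac)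
    also have "\<dots> = expi (y \<bullet> (- x, t)) * h y"
      by (simp only: integral_mult_right_zero h_def fiber_integral_def mult.assoc)
    finally show ?thesis .
  qed
  \<comment> \<open>At \<open>x = 0\<close> and \<open>t = 0\<close> the oscillating factor is 1, so
    integrating out the fibre coordinate leaves \<open>h\<close> itself.\<close>
  have "integrable lborel (\<lambda>y. LINT p|lborel. k (y, p) *\<^sub>R K 0 0 (y, p))"
    using lborel_pair.integrable_fst'[OF prodK[of 0 0]] by simp
  then show ih: "integrable lborel h"
    unfolding inner by (simp add: inner_prod_def)
  have "(evolution e \<phi> z)\<^sup>2 = (1 / (2 * pi)) ^ 4 * (fourier (g (snd z)) (- fst z) * fourier (g (snd z)) (- fst z))"
    unfolding evolution_def g_def by (simp add: power2_eq_square power4_eq_xxxx mult_ac)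
  also have "fourier (g (snd z)) (- fst z) * fourier (g (snd z)) (- fst z) = (LINT w|lborel. K (fst z) (snd z) (sum_coords w))"
    unfolding fourier_def Kz[symmetric] by (rule integral_tensor(2)[OF ie ie, symmetric])
  also have "\<dots> = (LINT w|distr lborel borel sum_coords. K (fst z) (snd z) w)"
    by (subst integral_distr) simp_all
  also have "\<dots> = (LINT w|lborel. k w *\<^sub>R K (fst z) (snd z) w)"
    unfolding distr by (subst integral_density) (auto simp: k0)
  also have "\<dots> = (LINT y|lborel. LINT p|lborel. k (y, p) *\<^sub>R K (fst z) (snd z) (y, p))"
    using lborel_pair.integral_fst'[OF prodK[of "fst z" "snd z"]] by (simp add: lborel_prod)
  also have "\<dots> = fourier h (- fst z, snd z)"
    unfolding inner fourier_def ..
  finally show "(evolution e \<phi> z)\<^sup>2 = (1 / (2 * pi)) ^ 4 * fourier h (- fst z, snd z)" .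
qed

text \<open>The fourth power is the squared modulus of the square, hence
  \<open>(1 / (2 * pi)) ^ 8\<close> times that of a space-time transform. Plancherel's inequality in
  dimension three returns \<open>(2 * pi) ^ 3\<close>, and the bound no longer depends on
  \<open>e\<close>.\<close>

lemma evolution_L4_le:
  assumes [measurable]: "\<phi> \<in> borel_measurable borel" and L2: "(\<lambda>w::plane. \<phi> ((norm w)\<^sup>2)) \<in> Lp 2" and e: "e > 0"
  shows "(NNINT z. ennreal (norm (evolution e \<phi> z) ^ 4)) \<le> ennreal ((1 / (2 * pi)) ^ 5) * (NNINT y. nsq (fiber_integral \<phi> y))"
proof -
  define h where "h = (\<lambda>y. complex_of_real (exp (- e * snd y)) * fiber_integral \<phi> y)"
  have ih: "integrable lborel h" and sq: "\<And>z. (evolution e \<phi> z)\<^sup>2 = (1 / (2 * pi)) ^ 4 * fourier h (- fst z, snd z)"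
    unfolding h_def using evolution_square[OF assms(1) L2 e] by blast+
  have [measurable]: "h \<in> borel_measurable borel" using ih by auto
  define N where "N y = nsq (fourier h y)" for y
  have [measurable]: "N \<in> borel_measurable borel" unfolding N_def by measurable
  have pt: "ennreal (norm (evolution e \<phi> z) ^ 4) = ennreal ((1 / (2 * pi)) ^ 8) * N (- fst z, snd z)" for z
  proof -
    have "norm (evolution e \<phi> z) ^ 4 = (norm ((evolution e \<phi> z)\<^sup>2))\<^sup>2" by (simp add: norm_power flip: power_mult)
    also have "\<dots> = (1 / (2 * pi)) ^ 8 * (norm (fourier h (- fst z, snd z)))\<^sup>2"
      unfolding sq by (simp add: norm_mult norm_power norm_divide power_mult_distrib power_divide flip: power_mult)
    finally show ?thesis unfolding N_def by (simp only:) (rule ennreal_mult, auto)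
  qed
  have Np: "(\<lambda>z. N (- fst z, snd z)) \<in> borel_measurable borel" by measurable
  have "(NNINT z. ennreal (norm (evolution e \<phi> z) ^ 4)) = ennreal ((1 / (2 * pi)) ^ 8) * (NNINT z. N (- fst z, snd z))"
    unfolding pt by (rule nn_integral_cmult) (use Np in simp)
  also have "(NNINT z. N (- fst z, snd z)) = (NNINT x. NNINT t. N (- x, t))"
    using nn_integral_lborel_pair[OF Np] by simp
  also have "\<dots> = (NNINT x. NNINT t. N (x, t))"
    using nn_integral_lborel_diff[of "\<lambda>x. NNINT t. N (x, t)" 0] by simp
  also have "\<dots> = (NNINT z. N z)"
    by (rule nn_integral_lborel_pair[symmetric]) simp
  also have "\<dots> \<le> ennreal ((2 * pi) ^ DIM(plane \<times> real)) * (NNINT y. nsq (h y))"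
    unfolding N_def by (rule plancherel_le[OF ih])
  also have "\<dots> \<le> ennreal ((2 * pi) ^ DIM(plane \<times> real)) * (NNINT y. nsq (fiber_integral \<phi> y))"
  proof (intro mult_left_mono nn_integral_mono ennreal_leI power_mono)
    fix y :: "plane \<times> real"
    show "norm (h y) \<le> norm (fiber_integral \<phi> y)"
    proof (cases "snd y < 0")
      case True
      then show ?thesis by (simp add: h_def fiber_integral_eq_0)
    next
      case False
      then have "exp (- e * snd y) \<le> 1" using e by simp
      then show ?thesis by (simp add: h_def norm_mult mult_left_le_one_le)
    qed
  qed auto
  finally have "(NNINT z. ennreal (norm (evolution e \<phi> z) ^ 4))
    \<le> ennreal ((1 / (2 * pi)) ^ 8) * (ennreal ((2 * pi) ^ DIM(plane \<times> real)) * (NNINT y. nsq (fiber_integral \<phi> y)))"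
    by (simp add: mult_left_mono)
  also have "\<dots> = ennreal ((1 / (2 * pi)) ^ 5) * (NNINT y. nsq (fiber_integral \<phi> y))"
  proof -
    have "(1 / (2 * pi)) ^ 8 * (2 * pi) ^ 3 = (1 / (2 * pi)) ^ 5"
      by (simp add: power_divide field_simps flip: power_add)
    then have "ennreal ((1 / (2 * pi)) ^ 8) * ennreal ((2 * pi) ^ DIM(plane \<times> real)) = ennreal ((1 / (2 * pi)) ^ 5)"
      by (subst ennreal_mult[symmetric]) auto
    then show ?thesis by (simp only: mult.assoc[symmetric])
  qed
  finally show ?thesis .
qed

subsection \<open>Distance to the radial functions\<close>

text \<open>Small \<open>d\<close> keeps the coefficient of the main term \<open>a\<close> close to
  1, at the price of a large one for \<open>b\<close>, which will tend to 0 first.\<close>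

lemma norm_add_sq_weighted:
  fixes a b :: "'a::real_normed_vector"
  assumes "d > 0"
  shows "(norm (a + b))\<^sup>2 \<le> (1 + d) * (norm a)\<^sup>2 + (1 + 1 / d) * (norm b)\<^sup>2"
proof -
  define s where "s = sqrt d"
  have s: "s > 0" "s * s = d" using assms by (auto simp: s_def)
  have "(norm (a + b))\<^sup>2 \<le> (norm a + norm b)\<^sup>2" by (intro power_mono norm_triangle_ineq) auto
  also have "\<dots> = (norm a)\<^sup>2 + (norm b)\<^sup>2 + 2 * (s * norm a) * (norm b / s)"
    using s by (simp add: power2_eq_square algebra_simps)
  also have "\<dots> \<le> (norm a)\<^sup>2 + (norm b)\<^sup>2 + ((s * norm a)\<^sup>2 + (norm b / s)\<^sup>2)"
    by (intro add_left_mono sum_squares_bound)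
  also have "\<dots> = (1 + d) * (norm a)\<^sup>2 + (1 + 1 / d) * (norm b)\<^sup>2"
    by (simp add: power_mult_distrib power_divide power2_eq_square[of s] s algebra_simps)
  finally show ?thesis .
qed

lemma ennreal_integral_le:
  assumes "\<And>x. 0 \<le> f x"
  shows "ennreal (integral\<^sup>L M f) \<le> (\<integral>\<^sup>+ x. ennreal (f x) \<partial>M)"
  using assms by (cases "integrable M f") (auto simp: nn_integral_eq_integral not_integrable_integral_eq)

lemma L2_Dist_nonneg: "F \<noteq> {} \<Longrightarrow> 0 \<le> L2_Dist g F"
  unfolding L2_Dist_def by (intro cINF_greatest) (auto simp: Lp_norm_def intro!: real_root_ge_zero integral_nonneg)

text \<open>Passing through the nonnegative integral is safe: if \<open>g - h\<close> is not square
  integrable, its \<open>Lp_norm\<close> is 0 by default and the bound still holds.\<close>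

lemma L2_Dist_sq_le:
  fixes g :: "'a::euclidean_space \<Rightarrow> complex"
  assumes "h \<in> F"
  shows "ennreal ((L2_Dist g F)\<^sup>2) \<le> (NNINT x. nsq (g x - h x))"
proof -
  have nn: "0 \<le> Lp_norm 2 (\<lambda>x. g x - k x)" for k
    by (auto simp: Lp_norm_def intro!: real_root_ge_zero integral_nonneg)
  have "L2_Dist g F \<le> Lp_norm 2 (\<lambda>x. g x - h x)"
    unfolding L2_Dist_def by (intro cINF_lower bdd_belowI2[where m=0] assms nn)
  then have "(L2_Dist g F)\<^sup>2 \<le> (Lp_norm 2 (\<lambda>x. g x - h x))\<^sup>2"
    using L2_Dist_nonneg[of F g] assms by (intro power_mono) auto
  also have "\<dots> = (LINT x|lborel. (norm (g x - h x))\<^sup>2)"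
    unfolding Lp_norm_def by (intro real_root_pow_pos2) (auto intro!: integral_nonneg)
  finally have "ennreal ((L2_Dist g F)\<^sup>2) \<le> ennreal (LINT x|lborel. (norm (g x - h x))\<^sup>2)" by (rule ennreal_leI)
  also have "\<dots> \<le> (NNINT x. nsq (g x - h x))" by (rule ennreal_integral_le) simp
  finally show ?thesis .
qed

lemma nn_integral_tensor:
  fixes f :: "'a::euclidean_space \<Rightarrow> ennreal" and g :: "'b::euclidean_space \<Rightarrow> ennreal"
  assumes [measurable]: "f \<in> borel_measurable borel" "g \<in> borel_measurable borel"
  shows "(NNINT z. f (fst z) * g (snd z)) = (NNINT x. f x) * (NNINT y. g y)"
proof -
  have "(\<lambda>z. f (fst z) * g (snd z)) \<in> borel_measurable borel" by measurable
  from nn_integral_lborel_pair[OF this] show ?thesis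
    by (simp add: nn_integral_cmult nn_integral_multc)
qed

lemma tensor_L2:
  fixes f :: "'a::euclidean_space \<Rightarrow> complex" and g :: "'b::euclidean_space \<Rightarrow> complex"
  assumes "f \<in> Lp 2" "g \<in> Lp 2"
  shows "(\<lambda>z. f (fst z) * g (snd z)) \<in> Lp 2"
proof -
  have [measurable]: "f \<in> borel_measurable borel" "g \<in> borel_measurable borel" using assms by (auto intro: Lp_measurable)
  have "(NNINT z. nsq (f (fst z) * g (snd z)))
    = (NNINT x. nsq (f x)) * (NNINT y. nsq (g y))"
    using nn_integral_tensor[of "\<lambda>x. nsq (f x)" "\<lambda>y. nsq (g y)"]
    by (simp add: norm_mult power_mult_distrib ennreal_mult)
  also have "\<dots> < \<infinity>" using assms by (auto simp: Lp_iff ennreal_mult_less_top)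
  finally show ?thesis unfolding Lp_iff by simp
qed

lemma nn_integral_lborel_uminus:
  fixes f :: "'a::euclidean_space \<Rightarrow> ennreal"
  assumes "f \<in> borel_measurable borel"
  shows "(NNINT y. f (- y)) = (NNINT y. f y)"
  using nn_integral_lborel_diff[OF assms, of 0] by simp

text \<open>The difference telescopes into two products, each with one small factor
  \<open>f - heat f\<close> and one factor of bounded norm; norms of tensor products
  multiply.\<close>

lemma heat_tensor_L2_tendsto:
  fixes f :: "'a::euclidean_space \<Rightarrow> complex"
  assumes f: "f \<in> Lp 2" and e: "\<And>k. e k > 0" "e \<longlonglongrightarrow> 0"
  shows "(\<lambda>k. NNINT z. nsq (f (fst z) * f (snd z) - heat (e k) f (fst z) * heat (e k) f (snd z))) \<longlonglongrightarrow> 0"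
proof (rule tendsto_zero_ennrealI)
  let ?d = "\<lambda>k z. f (fst z) * f (snd z) - heat (e k) f (fst z) * heat (e k) f (snd z)"
  fix d :: real assume d: "d > 0"
  have [measurable]: "f \<in> borel_measurable borel" using f by (rule Lp_measurable)
  define N where "N = (LINT x|lborel. (norm (f x))\<^sup>2)"
  have N0: "N \<ge> 0" unfolding N_def by simp
  have N: "(NNINT x. nsq (f x)) = ennreal N" unfolding N_def by (rule nn_integral_Lp[OF f])
  \<comment> \<open>The total error is at most \<open>2 * (N * c + c * (2 * (N + 1)))\<close>, that
    is \<open>2 * c * (3 * N + 2)\<close>; the cap 1 on \<open>c\<close> yields the bound
    \<open>2 * (N + 1)\<close> for the regularized function.\<close>
  define c where "c = min 1 (d / (6 * N + 4))"
  have c: "c > 0" "c \<le> 1" "2 * c * (3 * N + 2) \<le> d"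
  proof -
    show "c > 0" "c \<le> 1" using d N0 by (auto simp: c_def)
    have "c * (6 * N + 4) \<le> d / (6 * N + 4) * (6 * N + 4)" using N0 by (intro mult_right_mono) (auto simp: c_def)
    also have "\<dots> = d" using N0 by simp
    finally show "2 * c * (3 * N + 2) \<le> d" by (simp add: algebra_simps)
  qed
  show "eventually (\<lambda>k. (NNINT z. nsq (?d k z)) \<le> ennreal d) sequentially"
    using tendsto_zero_ennrealD[OF heat_L2_tendsto[OF f e] c(1)]
  proof (rule eventually_mono)
    fix k
    define a where "a x = nsq (heat (e k) f x - f x)" for x
    have [measurable]: "a \<in> borel_measurable borel" unfolding a_def by measurable
    assume *: "(NNINT x. nsq (heat (e k) f x - f x)) \<le> ennreal c"
    then have A: "(NNINT x. a x) \<le> ennreal c" by (simp add: a_def)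
    have H: "(NNINT x. nsq (heat (e k) f x)) \<le> ennreal (2 * (N + 1))"
    proof -
      have "(NNINT x. nsq (heat (e k) f x)) \<le> 2 * (ennreal N + (NNINT x. a x))"
        using nn_integral_nsq_diff_le[of f lborel "\<lambda>x. f x - heat (e k) f x"]
        by (simp add: N a_def norm_minus_commute)
      also have "\<dots> \<le> 2 * (ennreal N + ennreal 1)"
        using A c by (intro mult_left_mono add_left_mono order_trans[OF A] ennreal_leI) auto
      also have "\<dots> = ennreal (2 * (N + 1))"
        using N0 by (subst ennreal_mult) simp_all
      finally show ?thesis .
    qed
    have "(NNINT z. nsq (?d k z))
      \<le> (NNINT z. 2 * (nsq (f (fst z)) * a (snd z) + a (fst z) * nsq (heat (e k) f (snd z))))"
    proof (intro nn_integral_mono)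
      fix z :: "'a \<times> 'a"
      have eq: "?d k z
        = f (fst z) * (f (snd z) - heat (e k) f (snd z)) - (heat (e k) f (fst z) - f (fst z)) * heat (e k) f (snd z)"
        by (simp add: algebra_simps)
      show "nsq (?d k z)
        \<le> 2 * (nsq (f (fst z)) * a (snd z) + a (fst z) * nsq (heat (e k) f (snd z)))"
        unfolding eq a_def
        by (rule order_trans[OF nsq_diff_le]) (simp add: norm_mult power_mult_distrib norm_minus_commute ennreal_mult)
    qed
    also have "\<dots> = 2 * ((NNINT z. nsq (f (fst z)) * a (snd z)) + (NNINT z. a (fst z) * nsq (heat (e k) f (snd z))))"
    proof -
      have 1: "(\<lambda>z::'a \<times> 'a. nsq (f (fst z)) * a (snd z)) \<in> borel_measurable lborel" by simp
      have 2: "(\<lambda>z::'a \<times> 'a. a (fst z) * nsq (heat (e k) f (snd z))) \<in> borel_measurable lborel" by simp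
      show ?thesis using 1 2 by (simp add: nn_integral_cmult nn_integral_add)
    qed
    also have "\<dots> = 2 * (ennreal N * (NNINT y. a y) + (NNINT x. a x) * (NNINT y. nsq (heat (e k) f y)))"
      by (subst nn_integral_tensor, simp, simp, subst nn_integral_tensor) (simp_all add: N)
    also have "\<dots> \<le> 2 * (ennreal N * ennreal c + ennreal c * ennreal (2 * (N + 1)))"
      by (intro mult_left_mono add_mono mult_mono A H) auto
    also have "\<dots> = ennreal (2 * (N * c + c * (2 * (N + 1))))"
      using N0 c by (simp add: ennreal_mult)
    also have "\<dots> \<le> ennreal d" using c(3) by (intro ennreal_leI) (simp add: algebra_simps)
    finally show "(NNINT z. nsq (?d k z)) \<le> ennreal d" .
  qed
qed

text \<open>The product of two heat averages is the inverse transform of \<open>E\<close> times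
  \<open>G \<otimes> G\<close>, where the two Gaussians combine to the radial Gaussian
  \<open>E\<close> on the product space. Replacing \<open>G \<otimes> G\<close> by \<open>R\<close>
  gives a radial competitor \<open>r\<close>, and Plancherel's inequality bounds the difference
  since \<open>E\<close> is at most 1. The second term pays for the passage from \<open>f\<close> to
  its heat average.\<close>

lemma L2_Dist_tensor_le_heat:
  fixes f G :: "'a::euclidean_space \<Rightarrow> complex" and R :: "'a \<times> 'a \<Rightarrow> complex"
  assumes fG: "is_L2_fourier f G" and R: "R \<in> Lp 2" "radial R" and e: "e > 0" and d: "d > 0"
  shows "ennreal ((L2_Dist (tensor f f) L2_rad)\<^sup>2)
    \<le> ennreal (1 + d) * (ennreal ((1 / (2 * pi)) ^ (2 * DIM('a))) * (NNINT z. nsq (G (fst z) * G (snd z) - R z)))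
      + ennreal (1 + 1 / d) * (NNINT z. nsq (f (fst z) * f (snd z) - heat e f (fst z) * heat e f (snd z)))"
proof -
  let ?h = "\<lambda>z. heat e f (fst z) * heat e f (snd z)"
  let ?G = "\<lambda>z. G (fst z) * G (snd z)"
  have fL: "f \<in> Lp 2" and GL: "G \<in> Lp 2" using fG by (auto simp: is_L2_fourier_def)
  have [measurable]: "f \<in> borel_measurable borel" "G \<in> borel_measurable borel" "R \<in> borel_measurable borel"
    using fL GL R by (auto intro: Lp_measurable)
  define n where "n = DIM('a)"
  define C :: complex where "C = (1 / (2 * complex_of_real pi)) ^ (2 * n)"
  define g where "g w = gauss e w * G w" for w
  define E where "E z = gauss e z" for z :: "'a \<times> 'a"
  have [measurable]: "E \<in> borel_measurable borel" unfolding E_def by measurable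
  have ig: "integrable lborel g" unfolding g_def by (rule integrable_mult_L2[OF gaussian_L2[OF e] GL])
  have gg: "g (fst z) * g (snd z) = E z * (?G z)" for z
    unfolding g_def E_def norm_prod_sq by (simp add: algebra_simps exp_add exp_diff exp_minus divide_inverse)
  have EL: "E \<in> Lp 2" unfolding E_def by (rule gaussian_L2[OF e])
  have igg: "integrable lborel (\<lambda>z. E z * (?G z))"
    by (rule integrable_mult_L2[OF EL tensor_L2[OF GL GL]])
  have iR: "integrable lborel (\<lambda>z. E z * R z)" by (rule integrable_mult_L2[OF EL R(1)])
  define r where "r X = C * fourier (\<lambda>z. E z * R z) (- X)" for X
  have mF: "fourier (\<lambda>z. E z * R z) \<in> borel_measurable borel" by (rule fourier_measurable) measurable
  have [measurable]: "r \<in> borel_measurable borel" unfolding r_def using mF by measurable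
  have heat: "heat e f x * heat e f y = C * fourier (\<lambda>z. E z * (?G z)) (- (x, y))" for x y
  proof -
    have "heat e f x * heat e f y = C * (fourier g (- x) * fourier g (- y))"
      unfolding heat_eq_fourier[OF fG e] g_def C_def n_def mult_2[of "DIM('a)"] power_add by (simp add: mult_ac)
    also have "fourier g (- x) * fourier g (- y) = fourier (\<lambda>z. g (fst z) * g (snd z)) (- x, - y)"
      by (rule fourier_tensor[OF ig ig, symmetric])
    finally show ?thesis by (simp add: gg)
  qed
  have diff: "heat e f (fst X) * heat e f (snd X) - r X = C * fourier (\<lambda>z. E z * (?G z - R z)) (- X)" for X
  proof -
    have "fourier (\<lambda>z. E z * (?G z - R z)) w = fourier (\<lambda>z. E z * (?G z)) w - fourier (\<lambda>z. E z * R z) w" for w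
    proof -
      have i1: "integrable lborel (\<lambda>z. expi (z \<bullet> w) * (E z * (?G z)))"
        by (rule integrable_exp_mult[OF igg]) simp
      have i2: "integrable lborel (\<lambda>z. expi (z \<bullet> w) * (E z * R z))"
        by (rule integrable_exp_mult[OF iR]) simp
      show ?thesis
        unfolding fourier_def using Bochner_Integration.integral_diff[OF i1 i2] by (simp only: right_diff_distrib)
    qed
    then show ?thesis using heat[of "fst X" "snd X"] by (simp add: r_def right_diff_distrib)
  qed
  have nC: "(norm C)\<^sup>2 = (1 / (2 * pi)) ^ (2 * n) * (1 / (2 * pi)) ^ (2 * n)"
    by (simp add: C_def norm_power norm_divide power2_eq_square)
  have cc: "(1 / (2 * pi)) ^ (2 * n) * (2 * pi) ^ (2 * n) = 1"
    by (simp add: power_divide)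
  have bound: "(NNINT X. nsq (C * fourier (\<lambda>z. E z * Q z) (- X)))
      \<le> ennreal ((1 / (2 * pi)) ^ (2 * n)) * (NNINT z. nsq (Q z))"
    if iQ: "integrable lborel (\<lambda>z. E z * Q z)" and [measurable]: "Q \<in> borel_measurable borel" for Q
  proof -
    have m: "fourier (\<lambda>z. E z * Q z) \<in> borel_measurable borel" by (rule fourier_measurable) measurable
    have "(NNINT X. nsq (C * fourier (\<lambda>z. E z * Q z) (- X)))
      = (NNINT X. nsq C * nsq (fourier (\<lambda>z. E z * Q z) (- X)))"
      by (simp add: norm_mult power_mult_distrib ennreal_mult)
    also have "\<dots> = nsq C * (NNINT X. nsq (fourier (\<lambda>z. E z * Q z) (- X)))"
      by (rule nn_integral_cmult) (use m in measurable)
    also have "(NNINT X. nsq (fourier (\<lambda>z. E z * Q z) (- X))) = (NNINT X. nsq (fourier (\<lambda>z. E z * Q z) X))"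
      by (rule nn_integral_lborel_uminus) (use m in measurable)
    also have "nsq C * \<dots> \<le> nsq C * (ennreal ((2 * pi) ^ DIM('a \<times> 'a)) * (NNINT z. nsq (E z * Q z)))"
      by (intro mult_left_mono plancherel_le iQ) auto
    also have "\<dots> \<le> nsq C * (ennreal ((2 * pi) ^ DIM('a \<times> 'a)) * (NNINT z. nsq (Q z)))"
      using e by (intro mult_left_mono nn_integral_mono ennreal_leI power_mono) (auto simp: E_def norm_mult intro!: mult_left_le_one_le)
    also have "\<dots> = ennreal ((1 / (2 * pi)) ^ (2 * n)) * (NNINT z. nsq (Q z))"
    proof -
      have "DIM('a \<times> 'a) = 2 * n" by (simp add: n_def)
      then have "(norm C)\<^sup>2 * (2 * pi) ^ DIM('a \<times> 'a) = (1 / (2 * pi)) ^ (2 * n)"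
        using cc by (simp only: nC mult.assoc mult_1_right)
      then have "nsq C * ennreal ((2 * pi) ^ DIM('a \<times> 'a)) = ennreal ((1 / (2 * pi)) ^ (2 * n))"
        by (subst ennreal_mult[symmetric]) auto
      then show ?thesis by (simp only: mult.assoc[symmetric])
    qed
    finally show ?thesis .
  qed
  have "r \<in> L2_rad"
  proof -
    have "(NNINT X. nsq (r X)) \<le> ennreal ((1 / (2 * pi)) ^ (2 * n)) * (NNINT z. nsq (R z))"
      unfolding r_def by (rule bound[OF iR]) simp
    also have "\<dots> < \<infinity>" using R(1) by (simp add: Lp_iff ennreal_mult_less_top)
    finally have "r \<in> Lp 2" by (simp add: Lp_iff)
    moreover have "radial r"
    proof -
      have "radial (fourier (\<lambda>z. E z * R z))"
      proof (rule radial_fourier)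
        show "radial (\<lambda>z. E z * R z)"
          unfolding radial_def
        proof (intro allI impI)
          fix x y :: "'a \<times> 'a" assume "norm x = norm y"
          moreover from this have "R x = R y" using R(2) unfolding radial_def by blast
          ultimately show "E x * R x = E y * R y" by (simp add: E_def)
        qed
      qed auto
      then show ?thesis unfolding radial_def r_def by (metis norm_minus_cancel)
    qed
    ultimately show ?thesis unfolding L2_rad_def by auto
  qed
  then have "ennreal ((L2_Dist (tensor f f) L2_rad)\<^sup>2) \<le> (NNINT z. nsq (tensor f f z - r z))"
    by (rule L2_Dist_sq_le)
  also have "\<dots> \<le> (NNINT z. ennreal (1 + d) * nsq (?h z - r z)
      + ennreal (1 + 1 / d) * nsq (f (fst z) * f (snd z) - ?h z))"
  proof (intro nn_integral_mono)
    fix z :: "'a \<times> 'a"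
    have "tensor f f z - r z = (?h z - r z) + (f (fst z) * f (snd z) - ?h z)"
      by (simp add: tensor_def split_beta)
    then have "(norm (tensor f f z - r z))\<^sup>2 \<le> (1 + d) * (norm (?h z - r z))\<^sup>2 + (1 + 1 / d) * (norm (f (fst z) * f (snd z) - ?h z))\<^sup>2"
      by (simp only: norm_add_sq_weighted[OF d])
    then show "nsq (tensor f f z - r z) \<le> ennreal (1 + d) * nsq (?h z - r z)
      + ennreal (1 + 1 / d) * nsq (f (fst z) * f (snd z) - ?h z)"
      using d by (subst (1 2) ennreal_mult[symmetric], simp_all del: ennreal_plus, subst ennreal_plus[symmetric], simp_all del: ennreal_plus add: ennreal_leI)
  qed
  also have "\<dots> = ennreal (1 + d) * (NNINT z. nsq (?h z - r z))
      + ennreal (1 + 1 / d) * (NNINT z. nsq (f (fst z) * f (snd z) - ?h z))"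
  proof -
    have 1: "(\<lambda>z. nsq (?h z - r z)) \<in> borel_measurable lborel" by simp
    have 2: "(\<lambda>z. nsq (f (fst z) * f (snd z) - ?h z)) \<in> borel_measurable lborel" by simp
    show ?thesis
      by (subst nn_integral_add) (use 1 2 in \<open>auto simp: nn_integral_cmult simp del: ennreal_plus\<close>)
  qed
  also have "(NNINT z. nsq (?h z - r z))
      \<le> ennreal ((1 / (2 * pi)) ^ (2 * n)) * (NNINT z. nsq (?G z - R z))"
    unfolding diff
  proof (rule bound)
    show "integrable lborel (\<lambda>z. E z * (?G z - R z))"
      using Bochner_Integration.integrable_diff[OF igg iR] by (simp add: right_diff_distrib)
  qed measurable
  finally show ?thesis
    unfolding n_def by (simp add: mult_left_mono add_right_mono)
qed

text \<open>The order of limits matters: \<open>e\<close> tends to 0 for fixed \<open>d\<close>,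
  which removes the term with coefficient \<open>1 + 1 / d\<close>, and only then \<open>d\<close>
  tends to 0.\<close>

lemma L2_Dist_tensor_le:
  fixes f G :: "'a::euclidean_space \<Rightarrow> complex" and R :: "'a \<times> 'a \<Rightarrow> complex"
  assumes fG: "is_L2_fourier f G" and R: "R \<in> Lp 2" "radial R"
    and c: "(NNINT z. nsq (G (fst z) * G (snd z) - R z)) = ennreal c" "c \<ge> 0"
  shows "(L2_Dist (tensor f f) L2_rad)\<^sup>2 \<le> (1 / (2 * pi)) ^ (2 * DIM('a)) * c"
proof -
  define D where "D = (L2_Dist (tensor f f) L2_rad)\<^sup>2"
  define B where "B = (1 / (2 * pi)) ^ (2 * DIM('a)) * c"
  have B: "B \<ge> 0" using c by (simp add: B_def)
  have f: "f \<in> Lp 2" using fG by (simp add: is_L2_fourier_def)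
  define b where "b k = (NNINT z. nsq (f (fst z) * f (snd z) - heat (1 / real (Suc k)) f (fst z) * heat (1 / real (Suc k)) f (snd z)))" for k
  have b: "b \<longlonglongrightarrow> 0"
    unfolding b_def by (intro heat_tensor_L2_tendsto f LIMSEQ_Suc[OF lim_1_over_n]) auto
  have step: "D \<le> (1 + d) * B" if d: "d > 0" for d :: real
  proof -
    have le: "ennreal D \<le> ennreal ((1 + d) * B) + ennreal (1 + 1 / d) * b k" for k
    proof -
      have "ennreal D \<le> ennreal (1 + d) * (ennreal ((1 / (2 * pi)) ^ (2 * DIM('a))) * ennreal c) + ennreal (1 + 1 / d) * b k"
        using L2_Dist_tensor_le_heat[OF fG R _ d, of "1 / real (Suc k)"] unfolding D_def b_def c by simp
      also have "ennreal (1 + d) * (ennreal ((1 / (2 * pi)) ^ (2 * DIM('a))) * ennreal c) = ennreal ((1 + d) * B)"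
        unfolding B_def using d c(2) by (subst ennreal_mult[symmetric], simp, simp, subst ennreal_mult) (simp_all del: ennreal_plus)
      finally show ?thesis .
    qed
    have "(\<lambda>k. ennreal ((1 + d) * B) + ennreal (1 + 1 / d) * b k) \<longlonglongrightarrow> ennreal ((1 + d) * B) + ennreal (1 + 1 / d) * 0"
      by (intro tendsto_add tendsto_const ennreal_tendsto_cmult b) (simp del: ennreal_plus)
    then have "ennreal D \<le> ennreal ((1 + d) * B) + ennreal (1 + 1 / d) * 0"
      by (rule LIMSEQ_le_const) (use le in blast)
    then show ?thesis using B d by (simp add: ennreal_le_iff)
  qed
  have "D \<le> B"
  proof (rule field_le_epsilon)
    fix x :: real assume x: "x > 0"
    have "x / (B + 1) * B \<le> x" using x B by (simp add: field_simps)
    moreover have "D \<le> (1 + x / (B + 1)) * B" by (rule step) (use x B in auto)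
    ultimately show "D \<le> B + x" by (simp add: algebra_simps)
  qed
  then show ?thesis by (simp add: D_def B_def)
qed

subsection \<open>The sharpened Strichartz inequality\<close>

lemma is_L2_fourier_cong_AE:
  assumes fg: "is_L2_fourier f g" and ae: "AE w in lborel. g w = h w" and m: "h \<in> borel_measurable borel"
  shows "is_L2_fourier f h"
proof -
  have eq: "(NNINT w. nsq (F w - h w)) = (NNINT w. nsq (F w - g w))" for F
    by (rule nn_integral_cong_AE) (use ae in \<open>auto elim!: AE_mp\<close>)
  have "(NNINT w. nsq (h w)) = (NNINT w. nsq (g w))"
    by (rule nn_integral_cong_AE) (use ae in \<open>auto elim!: AE_mp\<close>)
  then show ?thesis using fg m by (simp add: is_L2_fourier_def Lp_iff eq)
qed

lemma is_L2_fourier_unique: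
  assumes fg: "is_L2_fourier f g" and fh: "is_L2_fourier f h"
  shows "AE w in lborel. g w = h w"
proof -
  have [measurable]: "f \<in> borel_measurable borel" "g \<in> borel_measurable borel" "h \<in> borel_measurable borel"
    using fg fh by (auto simp: is_L2_fourier_def intro: Lp_measurable)
  define F where "F n = fourier (trunc (real n) f)" for n
  have [measurable]: "F n \<in> borel_measurable borel" for n
    unfolding F_def by (intro fourier_measurable fourier_truncation_measurable) measurable
  define a where "a n = (NNINT w. nsq (F n w - g w))" for n
  define b where "b n = (NNINT w. nsq (F n w - h w))" for n
  have ab: "a \<longlonglongrightarrow> 0" "b \<longlonglongrightarrow> 0" using fg fh by (auto simp: is_L2_fourier_def a_def[abs_def] b_def[abs_def] F_def)
  have le: "(NNINT w. nsq (g w - h w)) \<le> 2 * (a n + b n)" for n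
  proof -
    have "(NNINT w. nsq ((F n w - h w) - (F n w - g w))) \<le> 2 * (b n + a n)"
      unfolding a_def b_def by (rule nn_integral_nsq_diff_le) measurable
    then show ?thesis by (simp add: add.commute)
  qed
  have "(\<lambda>n. 2 * (a n + b n)) \<longlonglongrightarrow> 2 * (0 + 0)"
    by (intro ennreal_tendsto_cmult tendsto_add ab) simp
  then have "(NNINT w. nsq (g w - h w)) \<le> 2 * (0 + 0)"
    by (rule LIMSEQ_le_const) (use le in blast)
  then have "(NNINT w. nsq (g w - h w)) = 0" by simp
  then have "AE w in lborel. nsq (g w - h w) = 0"
    by (subst (asm) nn_integral_0_iff_AE) auto
  then show ?thesis by eventually_elim auto
qed

text \<open>Convergence in mean square gives pointwise convergence only along subsequences. So a
  subsequence realizing the liminf is fixed first and the almost everywhere convergent one is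
  extracted from it.\<close>

lemma heat_fatou:
  fixes v :: "'a::euclidean_space \<Rightarrow> complex"
  assumes v: "v \<in> Lp 2" and e: "\<And>k. e k > 0" "e \<longlonglongrightarrow> 0"
  shows "(NNINT x. ennreal (norm (v x) ^ p)) \<le> liminf (\<lambda>k. NNINT x. ennreal (norm (heat (e k) v x) ^ p))"
proof -
  have [measurable]: "v \<in> borel_measurable borel" using v by (rule Lp_measurable)
  define b where "b k = (NNINT x. ennreal (norm (heat (e k) v x) ^ p))" for k
  obtain r where r: "strict_mono (r :: nat \<Rightarrow> nat)" "(b \<circ> r) \<longlonglongrightarrow> liminf b"
    using liminf_subseq_lim[of b] by auto
  have "(\<lambda>k. NNINT x. nsq (heat (e (r k)) v x - v x)) \<longlonglongrightarrow> 0"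
    using LIMSEQ_subseq_LIMSEQ[OF heat_L2_tendsto[OF v e] r(1)] by (simp add: o_def)
  then obtain s where s: "strict_mono s" "AE x in lborel. (\<lambda>n. heat (e (r (s n))) v x) \<longlonglongrightarrow> v x"
    using L2_AE_subseq[of "\<lambda>n. heat (e (r n)) v" lborel v] by auto
  have "(NNINT x. ennreal (norm (v x) ^ p)) \<le> liminf (\<lambda>n. b (r (s n)))"
    unfolding b_def by (rule nn_integral_norm_power_fatou[OF _ s(2)]) simp
  also have "liminf (\<lambda>n. b (r (s n))) = liminf b"
    using LIMSEQ_subseq_LIMSEQ[OF r(2) s(1)] by (intro lim_imp_Liminf) (simp_all add: o_def)
  finally show ?thesis by (simp add: b_def[abs_def])
qed

text \<open>The transform \<open>g\<close> of \<open>f\<close> in the notion of solution may be a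
  different representative at each time; uniqueness identifies all of them with \<phi>. After
  averaging, the identity holds at every \<open>x\<close> and \<open>t\<close>.\<close>

lemma schroedinger_heat_eq_evolution:
  fixes f :: "plane \<Rightarrow> complex"
  assumes \<phi> [measurable]: "\<phi> \<in> borel_measurable borel"
    and fG: "is_L2_fourier f (\<lambda>w. \<phi> ((norm w)\<^sup>2))" and u: "is_schroedinger_solution f u" and e: "e > 0"
  shows "heat e (\<lambda>x. u (x, t)) x = evolution e \<phi> (x, t)"
proof -
  obtain g where g: "is_L2_fourier f g" "is_L2_fourier (\<lambda>x. u (x, t)) (\<lambda>w. expi (t * (norm w)\<^sup>2) * g w)"
    using u unfolding is_schroedinger_solution_def is_schroedinger_propagation_def by blast
  have "AE w in lborel. expi (t * (norm w)\<^sup>2) * g w = expi (t * (norm w)\<^sup>2) * \<phi> ((norm w)\<^sup>2)"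
    using is_L2_fourier_unique[OF g(1) fG] by eventually_elim simp
  from is_L2_fourier_cong_AE[OF g(2) this]
  have "is_L2_fourier (\<lambda>x. u (x, t)) (\<lambda>w. expi (t * (norm w)\<^sup>2) * \<phi> ((norm w)\<^sup>2))" by measurable
  from heat_eq_fourier[OF this e] show ?thesis by (simp add: evolution_def)
qed

text \<open>Heat averages are known to converge only at fixed time, so Fatou's lemma is used once in
  \<open>x\<close> for each \<open>t\<close> and once more in \<open>t\<close>.\<close>

lemma schroedinger_L4_le:
  fixes f :: "plane \<Rightarrow> complex"
  assumes \<phi> [measurable]: "\<phi> \<in> borel_measurable borel"
    and fG: "is_L2_fourier f (\<lambda>w. \<phi> ((norm w)\<^sup>2))" and u: "is_schroedinger_solution f u"
  shows "(NNINT z. ennreal (norm (u z) ^ 4)) \<le> ennreal ((1 / (2 * pi)) ^ 5) * (NNINT y. nsq (fiber_integral \<phi> y))"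
    (is "_ \<le> ?B")
proof -
  have L2: "(\<lambda>w::plane. \<phi> ((norm w)\<^sup>2)) \<in> Lp 2" using fG by (simp add: is_L2_fourier_def)
  have [measurable]: "u \<in> borel_measurable borel" using u by (simp add: is_schroedinger_solution_def)
  define e where "e k = 1 / real (Suc k)" for k
  let ?I = "\<lambda>k t. NNINT x. ennreal (norm (evolution (e k) \<phi> (x, t)) ^ 4)"
  have e: "e k > 0" "e \<longlonglongrightarrow> 0" for k
    unfolding e_def[abs_def] using LIMSEQ_Suc[OF lim_1_over_n[where 'a=real]] by auto
  have ut: "(\<lambda>x. u (x, t)) \<in> Lp 2" for t
    using u unfolding is_schroedinger_solution_def is_schroedinger_propagation_def is_L2_fourier_def by blast
  \<comment> \<open>Joint measurability is inherited from \<open>u\<close>, since the evolution is a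
    parametrized integral of \<open>u\<close> against the heat kernel.\<close>
  have evm: "evolution (e k) \<phi> \<in> borel_measurable borel" for k
  proof -
    have "evolution (e k) \<phi> = (\<lambda>z. heat (e k) (\<lambda>x. u (x, snd z)) (fst z))"
      by (auto simp: fun_eq_iff schroedinger_heat_eq_evolution[OF \<phi> fG u e(1)])
    also have "\<dots> \<in> borel_measurable borel" unfolding heat_def by measurable
    finally show ?thesis .
  qed
  have um: "(\<lambda>z. ennreal (norm (u z) ^ 4)) \<in> borel_measurable borel" by measurable
  have em: "(\<lambda>z. ennreal (norm (evolution (e k) \<phi> z) ^ 4)) \<in> borel_measurable borel" for k using evm by measurable
  have em': "(\<lambda>t. ?I k t) \<in> borel_measurable lborel" for k
    using evm by measurable
  have "(NNINT z. ennreal (norm (u z) ^ 4)) = (NNINT x. NNINT t. ennreal (norm (u (x, t)) ^ 4))"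
    by (rule nn_integral_lborel_pair[OF um])
  also have "\<dots> = (NNINT t. NNINT x. ennreal (norm (u (x, t)) ^ 4))"
    by (rule lborel_pair.Fubini') measurable
  also have "\<dots> \<le> (NNINT t. liminf (\<lambda>k. ?I k t))"
    using heat_fatou[OF ut e, where p=4] schroedinger_heat_eq_evolution[OF \<phi> fG u e(1)]
    by (intro nn_integral_mono) simp
  also have "\<dots> \<le> liminf (\<lambda>k. NNINT t. ?I k t)"
    by (rule nn_integral_liminf) (rule em')
  also have "\<dots> \<le> limsup (\<lambda>k. NNINT t. ?I k t)"
    by (rule Liminf_le_Limsup) simp
  also have "\<dots> \<le> ?B"
  proof (intro Limsup_bounded always_eventually allI)
    fix k
    have "(NNINT t. ?I k t) = (NNINT x. NNINT t. ennreal (norm (evolution (e k) \<phi> (x, t)) ^ 4))"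
      by (rule lborel_pair.Fubini') (use evm in measurable)
    also have "\<dots> = (NNINT z. ennreal (norm (evolution (e k) \<phi> z) ^ 4))"
      by (rule nn_integral_lborel_pair[OF em, symmetric])
    also have "\<dots> \<le> ?B" by (rule evolution_L4_le[OF \<phi> L2 e(1)])
    finally show "(NNINT t. ?I k t) \<le> ?B" .
  qed
  finally show ?thesis .
qed

text \<open>Here the constants meet. The transform satisfies \<open>M \<le> (2 * pi)^2 * N\<close>,
  and \<open>(2 * pi)^4 * D \<le> c \<le> pi^2 * \<delta>\<close> means that the gap \<delta> is at
  least \<open>16 * pi^2 * D\<close>. The two inequalities enter
  \<open>pi / 2 * M^2 - pi * \<delta>\<close> with opposite signs, which is why one-sided Plancherel
  bounds suffice.\<close>

lemma schroedinger_L4_sharpened: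
  fixes f :: "plane \<Rightarrow> complex"
  assumes f: "f \<in> L2_rad" and u: "is_schroedinger_solution f u"
  defines "N \<equiv> (LINT x|lborel. (norm (f x))\<^sup>2)"
  shows "(NNINT z. ennreal (norm (u z) ^ 4)) \<le> ennreal (1 / 4 * (N\<^sup>2 - 2 / pi\<^sup>2 * (L2_Dist (tensor f f) L2_rad)\<^sup>2))"
proof -
  have fL: "f \<in> Lp 2" using f by (simp add: L2_rad_def)
  obtain g where g: "is_L2_fourier f g"
    using u unfolding is_schroedinger_solution_def is_schroedinger_propagation_def by blast
  obtain \<phi> where \<phi> [measurable]: "\<phi> \<in> borel_measurable borel" and g\<phi>: "AE w in lborel. g w = \<phi> ((norm w)\<^sup>2)"
    using L2_fourier_radial[OF g f] by blast
  have fG: "is_L2_fourier f (\<lambda>w. \<phi> ((norm w)\<^sup>2))"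
    by (rule is_L2_fourier_cong_AE[OF g g\<phi>]) measurable
  define G where "G w = \<phi> ((norm w)\<^sup>2)" for w :: plane
  have GL: "G \<in> Lp 2" using fG unfolding G_def[abs_def] by (simp add: is_L2_fourier_def)
  have N0: "N \<ge> 0" by (simp add: N_def)
  have fN: "(NNINT x. nsq (f x)) = ennreal N" unfolding N_def by (rule nn_integral_Lp[OF fL])
  define M where "M = (LINT w|lborel. (norm (G w))\<^sup>2)"
  have M0: "M \<ge> 0" by (simp add: M_def)
  have GM: "(NNINT w. nsq (G w)) = ennreal M" unfolding M_def by (rule nn_integral_Lp[OF GL])
  have "ennreal M \<le> ennreal ((2 * pi)\<^sup>2) * ennreal N"
    using L2_fourier_norm_le[OF fG] unfolding fN GM[symmetric] G_def by simp
  then have MN: "M \<le> (2 * pi)\<^sup>2 * N"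
    using N0 by (subst (asm) ennreal_mult[symmetric]) (auto simp: ennreal_le_iff)
  define F where "F z = G (fst z) * G (snd z)" for z :: "plane \<times> plane"
  have FL: "F \<in> Lp 2" unfolding F_def[abs_def] by (rule tensor_L2[OF GL GL])
  have [measurable]: "F \<in> borel_measurable borel" using FL by (rule Lp_measurable)
  have FM: "(NNINT z. nsq (F z)) = ennreal (M\<^sup>2)"
  proof -
    have [measurable]: "G \<in> borel_measurable borel" using GL by (rule Lp_measurable)
    show ?thesis
      using nn_integral_tensor[of "\<lambda>x. nsq (G x)" "\<lambda>y. nsq (G y)"] M0
      by (simp add: F_def norm_mult power_mult_distrib ennreal_mult GM power2_eq_square[of M])
  qed
  obtain s where s: "0 < s" "s < 1"
    "(NNINT z. nsq (F z - fiber \<phi> ((norm z)\<^sup>2) (s * (norm z)\<^sup>2))) \<le> ennreal (pi\<^sup>2) * fiber_gap \<phi>"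
    using ex_radial_near_fiber[OF \<phi>] unfolding F_def G_def by blast
  define R where "R z = fiber \<phi> ((norm z)\<^sup>2) (s * (norm z)\<^sup>2)" for z :: "plane \<times> plane"
  have [measurable]: "R \<in> borel_measurable borel" unfolding R_def by measurable
  define I where "I = (NNINT y. nsq (fiber_integral \<phi> y))"
  have gap: "I + ennreal pi * fiber_gap \<phi> \<le> ennreal (pi / 2 * M\<^sup>2)"
  proof -
    have "I + ennreal pi * fiber_gap \<phi> \<le> ennreal (pi / 2) * ennreal (M\<^sup>2)"
      using fiber_integral_gap[OF \<phi>] FM unfolding I_def F_def G_def by simp
    also have "\<dots> = ennreal (pi / 2 * M\<^sup>2)" by (rule ennreal_mult[symmetric]) auto
    finally show ?thesis .
  qed
  have fin: "I < top" "ennreal pi * fiber_gap \<phi> < top"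
    using le_less_trans[OF gap ennreal_less_top] by (auto simp: ennreal_add_eq_top less_top[symmetric])
  then have "fiber_gap \<phi> < top" by (auto simp: ennreal_mult_less_top)
  then obtain \<delta> where \<delta>: "fiber_gap \<phi> = ennreal \<delta>" "\<delta> \<ge> 0" by (cases "fiber_gap \<phi>") auto
  obtain i where i: "I = ennreal i" "i \<ge> 0" using fin(1) by (cases I) auto
  have gap': "i + pi * \<delta> \<le> pi / 2 * M\<^sup>2"
  proof -
    have "ennreal (i + pi * \<delta>) \<le> ennreal (pi / 2 * M\<^sup>2)"
      using gap i \<delta> by (simp add: ennreal_mult)
    then show ?thesis by (subst (asm) ennreal_le_iff) auto
  qed
  have FRle: "(NNINT z. nsq (F z - R z)) \<le> ennreal (pi\<^sup>2 * \<delta>)"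
    using s(3) \<delta> unfolding R_def by (simp add: ennreal_mult)
  then obtain c where c: "(NNINT z. nsq (F z - R z)) = ennreal c" "c \<ge> 0"
    using le_less_trans[OF FRle ennreal_less_top] by (cases "(NNINT z. nsq (F z - R z))") auto
  have c\<delta>: "c \<le> pi\<^sup>2 * \<delta>" using FRle \<delta>(2) unfolding c(1) by (subst (asm) ennreal_le_iff) auto
  have RL: "R \<in> Lp 2"
  proof -
    have "(NNINT z. nsq (F z - (F z - R z))) \<le> 2 * ((NNINT z. nsq (F z)) + (NNINT z. nsq (F z - R z)))"
      by (rule nn_integral_nsq_diff_le) measurable
    then have "(NNINT z. nsq (R z)) \<le> 2 * (ennreal (M\<^sup>2) + ennreal c)" by (simp add: FM c)
    also have "\<dots> < \<infinity>" by (simp add: ennreal_mult_less_top)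
    finally show ?thesis by (simp add: Lp_iff)
  qed
  have Rr: "radial R" unfolding radial_def R_def by simp
  define D where "D = (L2_Dist (tensor f f) L2_rad)\<^sup>2"
  have D: "(2 * pi) ^ 4 * D \<le> c"
  proof -
    have "D \<le> (1 / (2 * pi)) ^ (2 * DIM(plane)) * c"
      unfolding D_def using c by (intro L2_Dist_tensor_le[OF fG RL Rr]) (auto simp: F_def G_def)
    then have "D \<le> (1 / (2 * pi)) ^ 4 * c" by simp
    then have "(2 * pi) ^ 4 * D \<le> (2 * pi) ^ 4 * ((1 / (2 * pi)) ^ 4 * c)" by (intro mult_left_mono) auto
    also have "\<dots> = c" by (simp add: power_divide)
    finally show ?thesis .
  qed
  have "(2 * pi) ^ 4 * D \<le> pi\<^sup>2 * \<delta>" using D c\<delta> by linarith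
  then have D\<delta>: "16 * pi\<^sup>2 * D \<le> \<delta>" by (simp add: power_mult_distrib power4_eq_xxxx power2_eq_square)
  have "M\<^sup>2 \<le> ((2 * pi)\<^sup>2 * N)\<^sup>2" using MN M0 by (intro power_mono)
  then have M2: "M\<^sup>2 \<le> 16 * pi ^ 4 * N\<^sup>2" by (simp add: power_mult_distrib flip: power_mult)
  have "i \<le> pi / 2 * M\<^sup>2 - pi * \<delta>" using gap' by simp
  also have "\<dots> \<le> pi / 2 * (16 * pi ^ 4 * N\<^sup>2) - pi * (16 * pi\<^sup>2 * D)"
    using M2 D\<delta> by (intro diff_mono mult_left_mono) auto
  also have "\<dots> = (2 * pi) ^ 5 * (1 / 4 * (N\<^sup>2 - 2 / pi\<^sup>2 * D))"
    by (simp add: power_mult_distrib field_simps eval_nat_numeral)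
  finally have "(1 / (2 * pi)) ^ 5 * i \<le> (1 / (2 * pi)) ^ 5 * ((2 * pi) ^ 5 * (1 / 4 * (N\<^sup>2 - 2 / pi\<^sup>2 * D)))"
    by (intro mult_left_mono) auto
  also have "\<dots> = 1 / 4 * (N\<^sup>2 - 2 / pi\<^sup>2 * D)"
  proof -
    have "(1 / (2 * pi)) ^ 5 * (2 * pi) ^ 5 = 1" by (simp add: power_divide)
    then show ?thesis by (simp only: mult.assoc[symmetric] mult_1_left)
  qed
  finally have final: "(1 / (2 * pi)) ^ 5 * i \<le> 1 / 4 * (N\<^sup>2 - 2 / pi\<^sup>2 * D)" .
  have "(NNINT z. ennreal (norm (u z) ^ 4)) \<le> ennreal ((1 / (2 * pi)) ^ 5) * I"
    unfolding I_def by (rule schroedinger_L4_le[OF \<phi> fG u])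
  also have "\<dots> = ennreal ((1 / (2 * pi)) ^ 5 * i)" unfolding i(1) using i(2) by (intro ennreal_mult[symmetric]) auto
  also have "\<dots> \<le> ennreal (1 / 4 * (N\<^sup>2 - 2 / pi\<^sup>2 * D))" by (rule ennreal_leI[OF final])
  finally show ?thesis by (simp only: D_def)
qed

theorem theorem1:
  "\<exists>\<gamma>::real. \<gamma> > 0 \<and>
     (\<forall>(f :: real ^ 2 \<Rightarrow> complex) (u :: (real ^ 2) \<times> real \<Rightarrow> complex).
        f \<in> L2_rad \<longrightarrow> \<not> (AE x in lborel. f x = 0) \<longrightarrow> is_schroedinger_solution f u \<longrightarrow>
        u \<in> Lp 4 \<and>
        Lp_norm 4 u \<le> 1 / sqrt 2 * Lp_norm 2 f *
          root 4 (1 - \<gamma> * ((L2_Dist (tensor f f) L2_rad)\<^sup>2 / Lp_norm 2 f ^ 4)))"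
proof (intro exI[of _ "2 / pi\<^sup>2"] conjI allI impI)
  show "2 / pi\<^sup>2 > 0" by simp
  fix f :: "real ^ 2 \<Rightarrow> complex" and u :: "(real ^ 2) \<times> real \<Rightarrow> complex"
  assume f: "f \<in> L2_rad" and nz: "\<not> (AE x in lborel. f x = 0)" and u: "is_schroedinger_solution f u"
  define N where "N = (LINT x|lborel. (norm (f x))\<^sup>2)"
  define D where "D = (L2_Dist (tensor f f) L2_rad)\<^sup>2"
  define I where "I = (LINT z|lborel. norm (u z) ^ 4)"
  have fL: "f \<in> Lp 2" using f by (simp add: L2_rad_def)
  then have [measurable]: "f \<in> borel_measurable borel" by (rule Lp_measurable)
  have [measurable]: "u \<in> borel_measurable borel" using u by (simp add: is_schroedinger_solution_def)
  have N: "N > 0"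
  proof -
    have "N \<noteq> 0"
    proof
      assume "N = 0"
      then have "(NNINT x. nsq (f x)) = 0"
        using nn_integral_Lp[OF fL] by (simp add: N_def)
      then have "AE x in lborel. nsq (f x) = 0"
        by (subst (asm) nn_integral_0_iff_AE) auto
      then have "AE x in lborel. f x = 0" by eventually_elim auto
      with nz show False ..
    qed
    moreover have "N \<ge> 0" by (simp add: N_def)
    ultimately show ?thesis by simp
  qed
  have le: "(NNINT z. ennreal (norm (u z) ^ 4)) \<le> ennreal (1 / 4 * (N\<^sup>2 - 2 / pi\<^sup>2 * D))"
    unfolding N_def D_def by (rule schroedinger_L4_sharpened[OF f u])
  show uL: "u \<in> Lp 4"
    unfolding Lp_iff using le_less_trans[OF le ennreal_less_top] by simp
  have uI: "(NNINT z. ennreal (norm (u z) ^ 4)) = ennreal I"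
    unfolding I_def by (rule nn_integral_Lp[OF uL])
  have I0: "I \<ge> 0" by (simp add: I_def)
  \<comment> \<open>Comparison with the zero function, which is radial. Together with
    \<open>2 \<le> pi^2\<close> it keeps the bracket nonnegative, so the bound can be read off from
    \<open>ennreal\<close>, where negative numbers collapse to 0, and the fourth root is a genuine
    one.\<close>
  have DN: "D \<le> N\<^sup>2"
  proof -
    have "(\<lambda>_. 0) \<in> (L2_rad :: ((real ^ 2) \<times> (real ^ 2) \<Rightarrow> complex) set)"
      by (auto simp: L2_rad_def Lp_def radial_def)
    from L2_Dist_sq_le[OF this, of "tensor f f"]
    have "ennreal D \<le> (NNINT z. nsq (f (fst z)) * nsq (f (snd z)))"
      by (simp add: D_def tensor_def split_beta norm_mult power_mult_distrib ennreal_mult)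
    also have "\<dots> = ennreal N * ennreal N"
      using nn_integral_Lp[OF fL] by (subst nn_integral_tensor) (simp_all add: N_def)
    also have "\<dots> = ennreal (N\<^sup>2)" using N by (simp add: power2_eq_square ennreal_mult)
    finally show ?thesis by (subst (asm) ennreal_le_iff) auto
  qed
  define x where "x = 1 - 2 / pi\<^sup>2 * (D / N\<^sup>2)"
  have x0: "x \<ge> 0"
  proof -
    have "2 \<le> pi\<^sup>2" using power_mono[OF pi_ge_two, of 2] by simp
    then have "2 / pi\<^sup>2 * (D / N\<^sup>2) \<le> 1 * 1"
      using DN N by (intro mult_mono) (auto simp: D_def)
    then show ?thesis by (simp add: x_def)
  qed
  have xN: "1 / 4 * (N\<^sup>2 - 2 / pi\<^sup>2 * D) = 1 / 4 * N\<^sup>2 * x"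
    using N by (simp add: x_def field_simps)
  have I: "I \<le> 1 / 4 * N\<^sup>2 * x"
    using le x0 unfolding uI xN by (subst (asm) ennreal_le_iff) auto
  have nf: "Lp_norm 2 f = sqrt N" by (simp add: Lp_norm_def N_def sqrt_def)
  have nf4: "Lp_norm 2 f ^ 4 = N\<^sup>2"
    using N by (simp add: nf power4_eq_xxxx power2_eq_square)
  show "Lp_norm 4 u \<le> 1 / sqrt 2 * Lp_norm 2 f * root 4 (1 - 2 / pi\<^sup>2 * ((L2_Dist (tensor f f) L2_rad)\<^sup>2 / Lp_norm 2 f ^ 4))"
  proof -
    define y where "y = 1 / sqrt 2 * sqrt N * root 4 x"
    have "y \<ge> 0" using N x0 by (simp add: y_def)
    have "y ^ 4 = (1 / sqrt 2) ^ 4 * sqrt N ^ 4 * root 4 x ^ 4" by (simp only: y_def power_mult_distrib)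
    also have "\<dots> = 1 / 4 * N\<^sup>2 * x"
    proof -
      have "(1 / sqrt 2) ^ 4 = (1 / 4 :: real)" by (simp add: power_divide power4_eq_xxxx)
      moreover have "sqrt N ^ 4 = N\<^sup>2" using nf4 by (simp only: nf)
      moreover have "root 4 x ^ 4 = x" using x0 by (intro real_root_pow_pos2) auto
      ultimately show ?thesis by (simp only:)
    qed
    finally have y4: "y ^ 4 = 1 / 4 * N\<^sup>2 * x" .
    have "Lp_norm 4 u = root 4 I" by (simp add: Lp_norm_def I_def)
    also have "\<dots> \<le> root 4 (y ^ 4)" using I by (simp add: y4)
    also have "\<dots> = y" using \<open>y \<ge> 0\<close> by (simp add: real_root_power_cancel)
    finally show ?thesis by (subst nf4, subst nf) (simp only: y_def x_def D_def)
  qed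
qed

end
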